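(* Consider the two-team static mean-field games $\mathcal P_N$ (with $N_1,N_2$ decision makers) and $\mathcal P_\infty$ (countably infinitely many decision makers in each team) described in the context. Assume: (a) There exist, for $i=1,2$, a probability measure $Q^i$ on $\mathbb Y^i$ and a bounded measurable function $\hat f^i:\mathbb Y^i\times\Omega_0\to\mathbb R_+$ such that for all $N_1,N_2\in\mathbb N$ and all Borel sets $B^i_k\subseteq\mathbb Y^i$, the conditional distribution $\tilde\mu^N(\cdot\mid\omega_0)$ of $(y^1_{1:N_1},y^2_{1:N_2})$ given $\omega_0$ satisfies $$\tilde\mu^N\Big(\prod_{i=1}^2B^i_1\times\cdots\times B^i_{N_i}\,\Big|\,\omega_0\Big)=\prod_{i=1}^2\prod_{k=1}^{N_i}\int_{B^i_k}\hat f^i(y^i_k,\omega_0)\,Q^i(dy^i_k)$$ (in particular, conditioned on $\omega_0$, all observations are independent and those within a team are identically distributed). (b) For $i=1,2$, $\mathbb U^i$ is compact and $c^i(\omega_0,\cdot,\cdot,\cdot)$ is continuous on $\mathbb U^i\times\tilde{\mathbb U}^1\times\tilde{\mathbb U}^2$ for every $\omega_0$. Let $(P_\pi^{1*},P_\pi^{2*})\in L^1_{\mathrm{PR,SYM}}\times L^2_{\mathrm{PR,SYM}}$ be an independently randomized symmetric Nash equilibrium for $\mathcal P_\infty$ (among all policies in $L^1\times L^2$). Then (its restriction to the first $N_1$, resp. $N_2$, components) constitutes an $\epsilon_{N_{1:2}}$-Nash equilibrium for $\mathcal P_N$ among all policies in $L^1_N\times L^2_N$, i.e. for $i=1,2$,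 $$J^i_{\pi,N}(P^{i*}_{\pi,N_i},P^{-i*}_{\pi,N_{-i}})\le\inf_{P^i_\pi\in L^i_N}J^i_{\pi,N}(P^i_\pi,P^{-i*}_{\pi,N_{-i}})+\epsilon_{N_{1:2}},$$ where $\epsilon_{N_{1:2}}\to0$ as $N_1,N_2\to\infty$.
   Context: Game. There are two players (teams) $i\in\{1,2\}$; $-i$ denotes the other one. In $\mathcal P_N$ team $i$ consists of decision makers (DMs) $k=1,\dots,N_i$; in $\mathcal P_\infty$ of DMs $k\in\mathbb N$. DM $k$ of team $i$ observes $y^i_k\in\mathbb Y^i$ and chooses $u^i_k\in\mathbb U^i$, where $\mathbb Y^i\subseteq\mathbb R^{m_i}$ and $\mathbb U^i\subseteq\mathbb R^{n_i}$ are Borel. The game is static: the observations are exogenous random variables on a probability space, unaffected by actions. $\omega_0$ is an exogenous random variable with values in a Borel space $\Omega_0$. $\mathcal P(\cdot)$ denotes the Borel probability measures on a space. For $i=1,2$, $\Xi^i:\mathcal P(\mathbb U^i)\to\tilde{\mathbb U}^i$ is weakly continuous, with $\tilde{\mathbb U}^i$ a subset of a Euclidean space, and $c^i:\Omega_0\times\mathbb U^i\times\tilde{\mathbb U}^1\times\tilde{\mathbb U}^2\to\mathbb R_+$ is Borel. $\mu^N$ is the joint law of $(\omega_0,y^1_{1:N_1},y^2_{1:N_2})$. Policies. A (relaxed) policy of DM $k$ of team $i$ is a stochastic kernel $\gamma^i_k(du\mid y)$ from $\mathbb Y^i$ to $\mathbb U^i$, identified with the measure $\gamma^i_k(du\mid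 y)Q^i(dy)\in\mathcal P(\mathbb U^i\times\mathbb Y^i)$; $\Gamma^i_k$ is the set of these (the same set for all $k$), with the weak convergence topology on these measures and its Borel $\sigma$-field. The randomized policies of team $i$ are $L^i_N=\mathcal P(\prod_{k=1}^{N_i}\Gamma^i_k)$ in $\mathcal P_N$ and $L^i=\mathcal P(\prod_{k\in\mathbb N}\Gamma^i_k)$ in $\mathcal P_\infty$. The symmetric, privately (independently) randomized policies are $$L^i_{\mathrm{PR,SYM}}=\Big\{P_\pi\in L^i:\ P_\pi(\gamma^i_1\in A_1,\gamma^i_2\in A_2,\dots)=\prod_{k\in\mathbb N}\tilde P_\pi(\gamma^i_k\in A_k)\ \forall A_k\in\mathcal B(\Gamma^i_k),\ \text{for some }\tilde P_\pi\in\mathcal P(\Gamma^i_k)\text{ not depending on }k\Big\}.$$ For $P^i_\pi\in L^i$, $P^i_{\pi,N_i}$ is its marginal on the first $N_i$ components. Expected costs. For $(P^1_\pi,P^2_\pi)\in L^1_N\times L^2_N$, $$J^i_{\pi,N}(P^1_\pi,P^2_\pi)=\int P^1_\pi(d\underline\gamma^1)P^2_\pi(d\underline\gamma^2)\mu^N(d\omega_0,d\underline y)\,c^i_N(\underline\gamma,\underline y,\omega_0),$$ $$c^i_N(\underline\gamma,\underline y,\omega_0)=\int\frac1{N_i}\sum_{k=1}^{N_i}c^i\Big(\omega_0,u^i_k,\Xi^1\big(\tfrac1{N_1}\sum_{p=1}^{N_1}\delta_{u^1_p}\big),\Xi^2\big(\tfrac1{N_2}\sum_{p=1}^{N_2}\delta_{u^2_p}\big)\Big)\prod_{j=1}^2\prod_{k=1}^{N_j}\gamma^j_k(du^j_k\mid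 y^j_k),$$ and for $(P^1_\pi,P^2_\pi)\in L^1\times L^2$, $J^i_{\pi,\infty}(P^1_\pi,P^2_\pi)=\limsup_{N_1,N_2\to\infty}J^i_{\pi,N}(P^1_{\pi,N_1},P^2_{\pi,N_2})$. A pair $(P^{1*}_\pi,P^{2*}_\pi)$ is a Nash equilibrium for $\mathcal P_\infty$ if $J^i_{\pi,\infty}(P^{i*}_\pi,P^{-i*}_\pi)\le J^i_{\pi,\infty}(P^i_\pi,P^{-i*}_\pi)$ for all $P^i_\pi\in L^i$, $i=1,2$. Standing convention: $N_1,N_2\to\infty$ at the same rate, i.e. all limits are along a fixed sequence of pairs $(N_1,N_2)$ with both tending to infinity and with constants $0<a\le b<\infty$ such that $a\le\liminf N_1/N_2\le\limsup N_1/N_2\le b$.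
   Formalization: Added assumption: for i=1,2 the cost c^i(ω_0,u,Ξ^1(m_1),Ξ^2(m_2)) is bounded, over all actions u and all probability measures m_1,m_2 on the action sets, by a function of ω_0 that is integrable under the law of ω_0; without integrability the claim is false. *)

theory Defs
  imports "HOL-Probability.Probability"
begin

section \<open>Spaces of probability measures\<close>

definition borel_on :: "'a::topological_space set \<Rightarrow> 'a measure" where
  "borel_on X = restrict_space borel X"

definition prob_measures :: "'a::topological_space set \<Rightarrow> 'a measure set" where
  "prob_measures X = space (prob_algebra (borel_on X))"

text \<open>The coarsest topology on the Borel probability measures on \<open>X\<close> that makes
  \<open>\<mu> \<mapsto> \<integral> f d\<mu>\<close> continuous for every bounded continuous \<open>f\<close> on \<open>X\<close>.\<close>

definition weak_topology :: "'a::topological_space set \<Rightarrow> 'a measure topology" where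
  "weak_topology X = topology_generated_by
     {{\<mu> \<in> prob_measures X. integral\<^sup>L \<mu> f \<in> V} | (f :: 'a \<Rightarrow> real) V.
        continuous_on X f \<and> bounded (f ` X) \<and> open V}"

lemma topspace_weak_topology: "topspace (weak_topology X) = prob_measures X"
proof -
  have "prob_measures X \<in> {{\<mu> \<in> prob_measures X. integral\<^sup>L \<mu> f \<in> V} | (f :: 'a \<Rightarrow> real) V.
        continuous_on X f \<and> bounded (f ` X) \<and> open V}"
    by (rule CollectI, rule exI[of _ "\<lambda>_. 0"], rule exI[of _ UNIV]) (auto simp: image_constant_conv)
  then show ?thesis
    unfolding weak_topology_def topology_generated_by_topspace by blast
qed

definition borel_of :: "'a topology \<Rightarrow> 'a measure" where
  "borel_of T = sigma (topspace T) {S. openin T S}"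

definition empirical :: "'u::topological_space set \<Rightarrow> nat \<Rightarrow> (nat \<Rightarrow> 'u) \<Rightarrow> 'u measure" where
  "empirical U N u = distr (uniform_count_measure {..<N}) (borel_on U) u"

lemma emeasure_empirical:
  assumes "0 < N" "\<And>p. p < N \<Longrightarrow> u p \<in> U" "A \<in> sets (borel_on U)"
  shows "emeasure (empirical U N u) A
    = ennreal (1 / real N) * (\<Sum>p<N. emeasure (return (borel_on U) (u p)) A)"
proof -
  have m: "u \<in> measurable (uniform_count_measure {..<N}) (borel_on U)"
    using assms(2) by (auto simp: measurable_def borel_on_def space_restrict_space space_uniform_count_measure sets_uniform_count_measure)
  have "emeasure (empirical U N u) A
      = emeasure (uniform_count_measure {..<N}) (u -` A \<inter> {..<N})"
    using m assms by (simp add: empirical_def emeasure_distr space_uniform_count_measure)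
  also have "\<dots> = ennreal (real (card (u -` A \<inter> {..<N})) / real N)"
    using assms by (subst emeasure_uniform_count_measure) auto
  also have "real (card (u -` A \<inter> {..<N})) = (\<Sum>p<N. indicator A (u p))"
  proof -
    have "(\<Sum>p<N. indicator A (u p)) = (\<Sum>p<N. indicator (u -` A) p :: real)"
      by (intro sum.cong) (auto simp: indicator_def)
    also have "\<dots> = real (card (u -` A \<inter> {..<N}))"
      by (simp add: indicator_def sum.If_cases Int_commute vimage_def Int_def conj_commute)
    finally show ?thesis by simp
  qed
  also have "ennreal ((\<Sum>p<N. indicator A (u p)) / real N)
      = ennreal (1 / real N) * ennreal (\<Sum>p<N. indicator A (u p))"
    by (subst ennreal_mult[symmetric]) (auto intro: sum_nonneg)
  also have "ennreal (\<Sum>p<N. indicator A (u p)) = (\<Sum>p<N. emeasure (return (borel_on U) (u p)) A)"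
    using assms by (subst sum_ennreal[symmetric]) (auto simp: ennreal_indicator)
  finally show ?thesis .
qed


section \<open>Teams and policies\<close>

text \<open>Decision makers are numbered from \<open>0\<close>, so that the first \<open>N\<close> of them are \<open>{..<N}\<close>.
  The reference measure \<open>refm\<close> is the measure with which policies are identified with joint
  measures on actions and observations.\<close>

record ('s, 'y, 'u, 'v) team =
  obs_space :: "'y set"
  act_space :: "'u set"
  stat_space :: "'v set"
  obs :: "nat \<Rightarrow> 's \<Rightarrow> 'y"
  stat :: "'u measure \<Rightarrow> 'v"
  refm :: "'y measure"

type_synonym ('y, 'u) kernel = "'y \<Rightarrow> 'u measure"

definition kernels ::
  "('s, 'y::euclidean_space, 'u::euclidean_space, 'v) team \<Rightarrow> ('y, 'u) kernel set" where
  "kernels T = borel_on (obs_space T) \<rightarrow>\<^sub>M prob_algebra (borel_on (act_space T))"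

text \<open>The measure \<open>\<kappa>(du|y) Q(dy)\<close>.\<close>

definition joint_of ::
  "('s, 'y::euclidean_space, 'u::euclidean_space, 'v) team \<Rightarrow> ('y, 'u) kernel \<Rightarrow> ('u \<times> 'y) measure" where
  "joint_of T \<kappa> = refm T \<bind>
     (\<lambda>y. distr (\<kappa> y) (borel_on (act_space T \<times> obs_space T)) (\<lambda>u. (u, y)))"

definition policies ::
  "('s, 'y::euclidean_space, 'u::euclidean_space, 'v) team \<Rightarrow> ('u \<times> 'y) measure set" where
  "policies T = joint_of T ` kernels T"

text \<open>A version of the kernel of a policy. It is unique only up to null sets of the reference
  measure; expected costs integrate over the observations for fixed policies first, and therefore
  do not depend on the version once the observations have densities with respect to \<open>refm\<close>.\<close>

definition kernel_of ::
  "('s, 'y::euclidean_space, 'u::euclidean_space, 'v) team \<Rightarrow> ('u \<times> 'y) measure \<Rightarrow> ('y, 'u) kernel" where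
  "kernel_of T \<gamma> = (SOME \<kappa>. \<kappa> \<in> kernels T \<and> joint_of T \<kappa> = \<gamma>)"

definition policy_space ::
  "('s, 'y::euclidean_space, 'u::euclidean_space, 'v) team \<Rightarrow> ('u \<times> 'y) measure measure" where
  "policy_space T =
     borel_of (subtopology (weak_topology (act_space T \<times> obs_space T)) (policies T))"

text \<open>The topology of \<open>policies T\<close> is second countable, so the product \<open>\<sigma>\<close>-algebra used here
  is the Borel \<open>\<sigma>\<close>-algebra of the product topology.\<close>

definition profile_space ::
  "('s, 'y::euclidean_space, 'u::euclidean_space, 'v) team \<Rightarrow> nat set \<Rightarrow> (nat \<Rightarrow> ('u \<times> 'y) measure) measure" where
  "profile_space T I = PiM I (\<lambda>_. policy_space T)"

definition randomized ::
  "('s, 'y::euclidean_space, 'u::euclidean_space, 'v) team \<Rightarrow> nat set \<Rightarrow> (nat \<Rightarrow> ('u \<times> 'y) measure) measure set" where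
  "randomized T I = space (prob_algebra (profile_space T I))"

definition marginal ::
  "('s, 'y::euclidean_space, 'u::euclidean_space, 'v) team \<Rightarrow> nat \<Rightarrow>
     (nat \<Rightarrow> ('u \<times> 'y) measure) measure \<Rightarrow> (nat \<Rightarrow> ('u \<times> 'y) measure) measure" where
  "marginal T N P = distr P (profile_space T {..<N}) (\<lambda>\<gamma>. restrict \<gamma> {..<N})"

text \<open>The infinite product of probabilities is the limit of the partial products, because
  \<open>prodinf\<close> does not cover products that decrease to \<open>0\<close>.\<close>

definition private_symmetric ::
  "('s, 'y::euclidean_space, 'u::euclidean_space, 'v) team \<Rightarrow> (nat \<Rightarrow> ('u \<times> 'y) measure) measure set" where
  "private_symmetric T = {P \<in> randomized T UNIV.
     \<exists>P0 \<in> space (prob_algebra (policy_space T)).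
       \<forall>A. (\<forall>k. A k \<in> sets (policy_space T)) \<longrightarrow>
         (\<lambda>n. \<Prod>k<n. measure P0 (A k)) \<longlonglongrightarrow> measure P {\<gamma> \<in> space P. \<forall>k. \<gamma> k \<in> A k}}"

definition wf_team ::
  "'s measure \<Rightarrow> ('s, 'y::euclidean_space, 'u::euclidean_space, 'v::euclidean_space) team \<Rightarrow> bool" where
  "wf_team M T \<longleftrightarrow>
     obs_space T \<in> sets borel \<and>
     act_space T \<in> sets borel \<and>
     (\<forall>k. obs T k \<in> M \<rightarrow>\<^sub>M borel_on (obs_space T)) \<and>
     continuous_map (weak_topology (act_space T)) (top_of_set (stat_space T)) (stat T) \<and>
     refm T \<in> prob_measures (obs_space T)"


section \<open>Two-team games\<close>

record ('s, 'w, 'y1, 'u1, 'v1, 'y2, 'u2, 'v2) game =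
  base :: "'s measure"
  state_space :: "'w set"
  state :: "'s \<Rightarrow> 'w"
  team1 :: "('s, 'y1, 'u1, 'v1) team"
  team2 :: "('s, 'y2, 'u2, 'v2) team"
  cost1 :: "'w \<Rightarrow> 'u1 \<Rightarrow> 'v1 \<Rightarrow> 'v2 \<Rightarrow> real"
  cost2 :: "'w \<Rightarrow> 'u2 \<Rightarrow> 'v1 \<Rightarrow> 'v2 \<Rightarrow> real"

definition borel_cost ::
  "'w::topological_space set \<Rightarrow> 'u::topological_space set \<Rightarrow> 'v1::topological_space set \<Rightarrow>
     'v2::topological_space set \<Rightarrow> ('w \<Rightarrow> 'u \<Rightarrow> 'v1 \<Rightarrow> 'v2 \<Rightarrow> real) \<Rightarrow> bool" where
  "borel_cost W U V1 V2 c \<longleftrightarrow>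
     (\<lambda>(w, u, v1, v2). c w u v1 v2) \<in> borel_measurable (borel_on (W \<times> U \<times> V1 \<times> V2)) \<and>
     (\<forall>w\<in>W. \<forall>u\<in>U. \<forall>v1\<in>V1. \<forall>v2\<in>V2. 0 \<le> c w u v1 v2)"

definition static_game ::
  "('s, 'w::polish_space, 'y1::euclidean_space, 'u1::euclidean_space, 'v1::euclidean_space,
    'y2::euclidean_space, 'u2::euclidean_space, 'v2::euclidean_space) game \<Rightarrow> bool" where
  "static_game G \<longleftrightarrow>
     prob_space (base G) \<and>
     state_space G \<in> sets borel \<and>
     state G \<in> base G \<rightarrow>\<^sub>M borel_on (state_space G) \<and>
     wf_team (base G) (team1 G) \<and>
     wf_team (base G) (team2 G) \<and>
     borel_cost (state_space G) (act_space (team1 G))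
       (stat_space (team1 G)) (stat_space (team2 G)) (cost1 G) \<and>
     borel_cost (state_space G) (act_space (team2 G))
       (stat_space (team1 G)) (stat_space (team2 G)) (cost2 G)"

definition state_law ::
  "('s, 'w::polish_space, 'y1, 'u1, 'v1, 'y2, 'u2, 'v2) game \<Rightarrow> 'w measure" where
  "state_law G = distr (base G) (borel_on (state_space G)) (state G)"

definition obs_profile_space ::
  "('s, 'w, 'y1::euclidean_space, 'u1, 'v1, 'y2::euclidean_space, 'u2, 'v2) game \<Rightarrow> nat \<Rightarrow> nat \<Rightarrow>
     ((nat \<Rightarrow> 'y1) \<times> (nat \<Rightarrow> 'y2)) measure" where
  "obs_profile_space G N1 N2 =
     PiM {..<N1} (\<lambda>_. borel_on (obs_space (team1 G))) \<Otimes>\<^sub>M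
     PiM {..<N2} (\<lambda>_. borel_on (obs_space (team2 G)))"

definition obs_profile ::
  "('s, 'w, 'y1, 'u1, 'v1, 'y2, 'u2, 'v2) game \<Rightarrow> nat \<Rightarrow> nat \<Rightarrow> 's \<Rightarrow>
     (nat \<Rightarrow> 'y1) \<times> (nat \<Rightarrow> 'y2)" where
  "obs_profile G N1 N2 x =
     (\<lambda>k\<in>{..<N1}. obs (team1 G) k x, \<lambda>k\<in>{..<N2}. obs (team2 G) k x)"

definition joint_law ::
  "('s, 'w::polish_space, 'y1::euclidean_space, 'u1, 'v1, 'y2::euclidean_space, 'u2, 'v2) game \<Rightarrow>
     nat \<Rightarrow> nat \<Rightarrow> ('w \<times> (nat \<Rightarrow> 'y1) \<times> (nat \<Rightarrow> 'y2)) measure" where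
  "joint_law G N1 N2 =
     distr (base G) (borel_on (state_space G) \<Otimes>\<^sub>M obs_profile_space G N1 N2)
       (\<lambda>x. (state G x, obs_profile G N1 N2 x))"

text \<open>\<open>K\<close> is a version of the regular conditional distribution of the observations of the first
  \<open>N1\<close> and \<open>N2\<close> decision makers given the exogenous state.\<close>

definition cond_obs_law ::
  "('s, 'w::polish_space, 'y1::euclidean_space, 'u1, 'v1, 'y2::euclidean_space, 'u2, 'v2) game \<Rightarrow>
     nat \<Rightarrow> nat \<Rightarrow> ('w \<Rightarrow> ((nat \<Rightarrow> 'y1) \<times> (nat \<Rightarrow> 'y2)) measure) \<Rightarrow> bool" where
  "cond_obs_law G N1 N2 K \<longleftrightarrow>
     K \<in> borel_on (state_space G) \<rightarrow>\<^sub>M prob_algebra (obs_profile_space G N1 N2) \<and>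
     (\<forall>A \<in> sets (borel_on (state_space G)). \<forall>B \<in> sets (obs_profile_space G N1 N2).
        emeasure (joint_law G N1 N2) (A \<times> B) = (\<integral>\<^sup>+w\<in>A. emeasure (K w) B \<partial>state_law G))"

definition bounded_density ::
  "'w::polish_space set \<Rightarrow> 'y::euclidean_space set \<Rightarrow> ('y \<Rightarrow> 'w \<Rightarrow> real) \<Rightarrow> bool" where
  "bounded_density W Y f \<longleftrightarrow>
     (\<lambda>(y, w). f y w) \<in> borel_measurable (borel_on (Y \<times> W)) \<and>
     (\<forall>y\<in>Y. \<forall>w\<in>W. 0 \<le> f y w) \<and>
     (\<exists>C. \<forall>y\<in>Y. \<forall>w\<in>W. f y w \<le> C)"

definition obs_densities ::
  "('s, 'w::polish_space, 'y1::euclidean_space, 'u1, 'v1, 'y2::euclidean_space, 'u2, 'v2) game \<Rightarrow>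
     ('y1 \<Rightarrow> 'w \<Rightarrow> real) \<Rightarrow> ('y2 \<Rightarrow> 'w \<Rightarrow> real) \<Rightarrow> bool" where
  "obs_densities G f1 f2 \<longleftrightarrow>
     bounded_density (state_space G) (obs_space (team1 G)) f1 \<and>
     bounded_density (state_space G) (obs_space (team2 G)) f2 \<and>
     (\<forall>N1 N2. 0 < N1 \<longrightarrow> 0 < N2 \<longrightarrow>
       (\<exists>K. cond_obs_law G N1 N2 K \<and>
         (AE w in state_law G. \<forall>B1 B2.
            (\<forall>k<N1. B1 k \<in> sets (borel_on (obs_space (team1 G)))) \<longrightarrow>
            (\<forall>k<N2. B2 k \<in> sets (borel_on (obs_space (team2 G)))) \<longrightarrow>
            emeasure (K w) (PiE {..<N1} B1 \<times> PiE {..<N2} B2) =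
              (\<Prod>k<N1. \<integral>\<^sup>+y\<in>B1 k. ennreal (f1 y w) \<partial>refm (team1 G)) *
              (\<Prod>k<N2. \<integral>\<^sup>+y\<in>B2 k. ennreal (f2 y w) \<partial>refm (team2 G)))))"


section \<open>Expected costs and equilibria\<close>

definition stats ::
  "('s, 'w, 'y1, 'u1::euclidean_space, 'v1, 'y2, 'u2::euclidean_space, 'v2) game \<Rightarrow> nat \<Rightarrow> nat \<Rightarrow>
     (nat \<Rightarrow> 'u1) \<Rightarrow> (nat \<Rightarrow> 'u2) \<Rightarrow> 'v1 \<times> 'v2" where
  "stats G N1 N2 u1 u2 =
     (stat (team1 G) (empirical (act_space (team1 G)) N1 u1),
      stat (team2 G) (empirical (act_space (team2 G)) N2 u2))"

definition avg_cost1 ::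
  "('s, 'w, 'y1, 'u1::euclidean_space, 'v1, 'y2, 'u2::euclidean_space, 'v2) game \<Rightarrow> nat \<Rightarrow> nat \<Rightarrow>
     'w \<Rightarrow> (nat \<Rightarrow> 'u1) \<times> (nat \<Rightarrow> 'u2) \<Rightarrow> real" where
  "avg_cost1 G N1 N2 w = (\<lambda>(u1, u2). let (v1, v2) = stats G N1 N2 u1 u2
     in (1 / real N1) * (\<Sum>k<N1. cost1 G w (u1 k) v1 v2))"

definition avg_cost2 ::
  "('s, 'w, 'y1, 'u1::euclidean_space, 'v1, 'y2, 'u2::euclidean_space, 'v2) game \<Rightarrow> nat \<Rightarrow> nat \<Rightarrow>
     'w \<Rightarrow> (nat \<Rightarrow> 'u1) \<times> (nat \<Rightarrow> 'u2) \<Rightarrow> real" where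
  "avg_cost2 G N1 N2 w = (\<lambda>(u1, u2). let (v1, v2) = stats G N1 N2 u1 u2
     in (1 / real N2) * (\<Sum>k<N2. cost2 G w (u2 k) v1 v2))"

definition action_law ::
  "('s, 'y::euclidean_space, 'u::euclidean_space, 'v) team \<Rightarrow> nat \<Rightarrow>
     (nat \<Rightarrow> ('u \<times> 'y) measure) \<Rightarrow> (nat \<Rightarrow> 'y) \<Rightarrow> (nat \<Rightarrow> 'u) measure" where
  "action_law T N \<gamma> y = PiM {..<N} (\<lambda>k. kernel_of T (\<gamma> k) (y k))"

definition expected_cost ::
  "('s, 'w::polish_space, 'y1::euclidean_space, 'u1::euclidean_space, 'v1,
    'y2::euclidean_space, 'u2::euclidean_space, 'v2) game \<Rightarrow> nat \<Rightarrow> nat \<Rightarrow>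
     ('w \<Rightarrow> (nat \<Rightarrow> 'u1) \<times> (nat \<Rightarrow> 'u2) \<Rightarrow> real) \<Rightarrow>
     (nat \<Rightarrow> ('u1 \<times> 'y1) measure) measure \<Rightarrow> (nat \<Rightarrow> ('u2 \<times> 'y2) measure) measure \<Rightarrow> ennreal" where
  "expected_cost G N1 N2 g P1 P2 =
     (\<integral>\<^sup>+\<gamma>1. (\<integral>\<^sup>+\<gamma>2. (\<integral>\<^sup>+(w, y1, y2).
        (\<integral>\<^sup>+u. ennreal (g w u)
           \<partial>(action_law (team1 G) N1 \<gamma>1 y1 \<Otimes>\<^sub>M action_law (team2 G) N2 \<gamma>2 y2))
        \<partial>joint_law G N1 N2) \<partial>P2) \<partial>P1)"

definition J1 where "J1 G N1 N2 = expected_cost G N1 N2 (avg_cost1 G N1 N2)"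
definition J2 where "J2 G N1 N2 = expected_cost G N1 N2 (avg_cost2 G N1 N2)"

text \<open>\<open>S\<close> is the sequence of pairs of team sizes along which all limits are taken.\<close>

definition J1_inf where
  "J1_inf G S P1 P2 = limsup (\<lambda>n. case S n of (N1, N2) \<Rightarrow>
     J1 G N1 N2 (marginal (team1 G) N1 P1) (marginal (team2 G) N2 P2))"

definition J2_inf where
  "J2_inf G S P1 P2 = limsup (\<lambda>n. case S n of (N1, N2) \<Rightarrow>
     J2 G N1 N2 (marginal (team1 G) N1 P1) (marginal (team2 G) N2 P2))"

definition size_sequence :: "(nat \<Rightarrow> nat \<times> nat) \<Rightarrow> bool" where
  "size_sequence S \<longleftrightarrow>
     (\<forall>n. 0 < fst (S n) \<and> 0 < snd (S n)) \<and>
     filterlim (\<lambda>n. fst (S n)) at_top sequentially \<and>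
     filterlim (\<lambda>n. snd (S n)) at_top sequentially \<and>
     (\<exists>a b :: real. 0 < a \<and> a \<le> b \<and>
        ereal a \<le> liminf (\<lambda>n. ereal (real (fst (S n)) / real (snd (S n)))) \<and>
        limsup (\<lambda>n. ereal (real (fst (S n)) / real (snd (S n)))) \<le> ereal b)"

definition nash_infinite where
  "nash_infinite G S P1 P2 \<longleftrightarrow>
     P1 \<in> randomized (team1 G) UNIV \<and> P2 \<in> randomized (team2 G) UNIV \<and>
     (\<forall>P \<in> randomized (team1 G) UNIV. J1_inf G S P1 P2 \<le> J1_inf G S P P2) \<and>
     (\<forall>P \<in> randomized (team2 G) UNIV. J2_inf G S P1 P2 \<le> J2_inf G S P1 P)"

definition eps_nash_finite where
  "eps_nash_finite G N1 N2 e P1 P2 \<longleftrightarrow>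
     P1 \<in> randomized (team1 G) {..<N1} \<and> P2 \<in> randomized (team2 G) {..<N2} \<and>
     J1 G N1 N2 P1 P2 \<le> (INF P \<in> randomized (team1 G) {..<N1}. J1 G N1 N2 P P2) + ennreal e \<and>
     J2 G N1 N2 P1 P2 \<le> (INF P \<in> randomized (team2 G) {..<N2}. J2 G N1 N2 P1 P) + ennreal e"

definition continuous_cost ::
  "'w set \<Rightarrow> 'u::topological_space set \<Rightarrow> 'v1::topological_space set \<Rightarrow>
     'v2::topological_space set \<Rightarrow> ('w \<Rightarrow> 'u \<Rightarrow> 'v1 \<Rightarrow> 'v2 \<Rightarrow> real) \<Rightarrow> bool" where
  "continuous_cost W U V1 V2 c \<longleftrightarrow>
     (\<forall>w\<in>W. continuous_on (U \<times> V1 \<times> V2) (\<lambda>(u, v1, v2). c w u v1 v2))"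

text \<open>Integrable envelope for the costs on the values that the statistics take: continuity and
  compactness bound the costs for each state, but not uniformly or integrably in the state.\<close>

definition dominated_cost ::
  "'w measure \<Rightarrow> 'u set \<Rightarrow> 'v1 set \<Rightarrow> 'v2 set \<Rightarrow> ('w \<Rightarrow> 'u \<Rightarrow> 'v1 \<Rightarrow> 'v2 \<Rightarrow> real) \<Rightarrow> bool" where
  "dominated_cost \<mu> U V1 V2 c \<longleftrightarrow>
     (\<exists>h. integrable \<mu> h \<and>
        (\<forall>w\<in>space \<mu>. \<forall>u\<in>U. \<forall>v1\<in>V1. \<forall>v2\<in>V2. c w u v1 v2 \<le> h w))"

end

(* Given the state, a policy acts through the law of its actions only, and the expected cost of two
   randomised profiles is the integral over the state of the cost under the corresponding mixtures of
   product laws.  If the actions are conditionally independent, the law of large numbers replaces the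
   empirical measures by the average action laws with vanishing error: the statistics are only weakly
   continuous, but the probability measures on a compact action space are weakly sequentially compact,
   which gives the uniformity needed.  The error is pointwise in the state, and the integrable envelope
   passes it to expected costs.

   A profitable deviation of a finite team may be taken pure.  If every decision maker instead draws
   its policy uniformly and independently from the deviating profile, the average action law is the
   same, so the cost is nearly the same for large teams.  The uniform draw is also available in the
   infinite game, where it cannot beat the equilibrium; hence the gain in the finite game vanishes. *)
theory Submission
  imports Defs
begin

text \<open>The deviating profiles change with the team size, and their average action laws need not
  converge. The law of large numbers is therefore one for triangular arrays: a concentration bound
  that depends only on the range of the test function, and a contradiction along subsequences. Nor
  do the uniform draws converge to one competitor. The equilibrium inequality is used for each of
  them separately: when everybody uses one fixed draw, the limsup of the infinite game is a limit,
  so the limit cost of the equilibrium is at most that of every draw, whichever size it came from.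
  Sequential compactness comes from the real line: a Borel code maps the actions into a bounded
  interval, Helly selection works there, and the uniformly continuous inverse brings the limit back.
  A policy is a joint measure, and its kernel is a chosen version about whose dependence on the
  policy nothing is known. Reweighting the joint measure by the density of the observation yields
  the same action law and is measurable in the policy, which justifies exchanging integrals. All is
  done for one team against a fixed privately randomising opponent, and applied twice.\<close>

section \<open>Weak sequential compactness\<close>

text \<open>At the first digit \<open>k\<close> where the codes differ the sums move apart by
  \<open>(1/3)^k\<close>, and all later digits together can take back at most half of that. In base
  2 they could take back everything, which is why the base is 3.\<close>

lemma ternary_digits_determined:
  fixes b b' :: "nat \<Rightarrow> real"
  assumes b: "\<And>j. b j \<in> {0, 1}" "\<And>j. b' j \<in> {0, 1}"
    and close: "\<bar>(\<Sum>j. b j * (1/3)^j) - (\<Sum>j. b' j * (1/3)^j)\<bar> < (1/3)^m / 2"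
  shows "j \<le> m \<Longrightarrow> b j = b' j"
proof (rule ccontr)
  assume jm: "j \<le> m" and ne: "b j \<noteq> b' j"
  define k where "k = (LEAST i. b i \<noteq> b' i)"
  have kne: "b k \<noteq> b' k" unfolding k_def by (rule LeastI[where P="\<lambda>i. b i \<noteq> b' i", OF ne])
  have kj: "k \<le> j" unfolding k_def by (rule Least_le) (rule ne)
  have below: "b i = b' i" if "i < k" for i
    using not_less_Least[of i "\<lambda>i. b i \<noteq> b' i"] that unfolding k_def by blast
  define d where "d i = (b i - b' i) * (1/3::real)^i" for i
  have bnd: "\<bar>b i - b' i\<bar> \<le> 1" for i using b(1)[of i] b(2)[of i] by auto
  have geo: "summable (\<lambda>i. (1/3::real)^i)" by (rule summable_geometric) simp
  have dle: "norm (d i) \<le> (1/3)^i" for i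
    using mult_right_mono[OF bnd[of i], of "(1/3)^i"] unfolding d_def by (simp add: abs_mult)
  have s1: "summable (\<lambda>i. b i * (1/3)^i)"
  proof (rule summable_comparison_test'[OF geo, of 0])
    show "norm (b i * (1/3)^i) \<le> (1/3::real)^i" for i using b(1)[of i] by auto
  qed
  have s2: "summable (\<lambda>i. b' i * (1/3)^i)"
  proof (rule summable_comparison_test'[OF geo, of 0])
    show "norm (b' i * (1/3)^i) \<le> (1/3::real)^i" for i using b(2)[of i] by auto
  qed
  have sd: "summable d" by (rule summable_comparison_test'[OF geo, of 0]) (use dle in auto)
  have eq: "(\<Sum>j. b j * (1/3)^j) - (\<Sum>j. b' j * (1/3)^j) = suminf d"
    unfolding d_def by (subst suminf_diff[OF s1 s2]) (simp add: algebra_simps)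
  have split: "suminf d = (\<Sum>n. d (n + Suc k)) + (\<Sum>i<Suc k. d i)"
    by (rule suminf_split_initial_segment[OF sd])
  have "(\<Sum>i<Suc k. d i) = d k" using below by (simp add: d_def)
  moreover have "\<bar>d k\<bar> = (1/3)^k"
    using kne b(1)[of k] b(2)[of k] by (auto simp: d_def abs_mult)
  moreover have "\<bar>\<Sum>n. d (n + Suc k)\<bar> \<le> (1/3)^k / 2"
  proof -
    have tl: "summable (\<lambda>n. (1/3::real)^(n + Suc k))" using geo by (rule summable_ignore_initial_segment)
    have "summable (\<lambda>n. norm (d (n + Suc k)))"
      by (rule summable_comparison_test'[OF tl, of 0]) (use dle in \<open>simp only: real_norm_def abs_abs\<close>)
    then have "norm (\<Sum>n. d (n + Suc k)) \<le> (\<Sum>n. (1/3::real)^(n + Suc k))"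
      by (intro order_trans[OF summable_norm] suminf_le tl dle)
    also have "\<dots> = (\<Sum>n. (1/3::real)^n) * (1/3)^Suc k"
      by (subst suminf_mult2[OF geo]) (simp add: power_add)
    also have "\<dots> = (1/3)^k / 2" by (subst suminf_geometric) auto
    finally show ?thesis by simp
  qed
  ultimately have "\<bar>suminf d\<bar> \<ge> (1/3)^k / 2" using split by linarith
  moreover have "(1/3::real)^m \<le> (1/3)^k"
    using kj jm by (intro power_decreasing) auto
  ultimately show False using close eq by linarith
qed

text \<open>The digits of the code tell in which balls of a countable basis a point lies, so that
  the code has a uniformly continuous inverse although it is itself only Borel.\<close>

lemma compact_borel_code:
  fixes U :: "'a::{metric_space, second_countable_topology} set"
  assumes "compact U"
  obtains s :: "'a \<Rightarrow> real" where "s \<in> borel_measurable borel"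
    "\<And>x. 0 \<le> s x \<and> s x \<le> 2"
    "\<And>e. 0 < e \<Longrightarrow> \<exists>d>0. \<forall>x\<in>U. \<forall>y\<in>U. \<bar>s x - s y\<bar> < d \<longrightarrow> dist x y < e"
proof -
  obtain D :: "'a set" where D: "countable D" "\<And>X. open X \<Longrightarrow> X \<noteq> {} \<Longrightarrow> \<exists>d\<in>D. d \<in> X"
    using countable_dense_exists by (metis (no_types, lifting))
  \<comment> \<open>Balls of radius \<open>1 / (k + 1)\<close> around a countable dense set. The
    empty set is added below so that the family is certainly nonempty and can be enumerated.\<close>
  define \<B> where "\<B> = (\<lambda>(x, k). ball x (1 / real (Suc k))) ` (D \<times> UNIV)"
  define B where "B = from_nat_into (insert {} \<B>)"
  have cB: "countable (insert {} \<B>)" using D(1) unfolding \<B>_def by simp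
  have rB: "range B = insert {} \<B>" unfolding B_def by (rule range_from_nat_into) (use cB in auto)
  have oB: "open (B j)" for j
  proof -
    have "B j \<in> insert {} \<B>" using rB by blast
    then show ?thesis by (auto simp: \<B>_def)
  qed
  define s where "s x = (\<Sum>j. indicator (B j) x * (1/3::real)^j)" for x
  have geo: "summable (\<lambda>i. (1/3::real)^i)" by (rule summable_geometric) simp
  have sm: "summable (\<lambda>j. indicator (B j) x * (1/3::real)^j)" for x
    by (rule summable_comparison_test'[OF geo, of 0]) (auto simp: indicator_def)
  show thesis
  proof (rule that)
    have [measurable]: "B j \<in> sets borel" for j using oB by simp
    show "s \<in> borel_measurable borel" unfolding s_def by measurable
    show "0 \<le> s x \<and> s x \<le> 2" for x
    proof
      show "0 \<le> s x" unfolding s_def by (rule suminf_nonneg[OF sm]) auto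
      have "s x \<le> (\<Sum>i. (1/3::real)^i)" unfolding s_def
        by (rule suminf_le[OF _ sm geo]) (auto simp: indicator_def)
      also have "\<dots> \<le> 2" by (subst suminf_geometric) auto
      finally show "s x \<le> 2" .
    qed
    fix e :: real assume e: "0 < e"
    obtain k where k: "1 / real (Suc k) < e / 2" using e by (metis half_gt_zero nat_approx_posE)
    \<comment> \<open>Some listed ball of radius below \<open>e / 2\<close> contains
      \<open>x\<close>; its diameter is below \<open>e\<close>.\<close>
    have "\<exists>j. x \<in> B j \<and> (\<forall>y\<in>B j. \<forall>z\<in>B j. dist y z < e)" for x
    proof -
      obtain z where z: "z \<in> D" "z \<in> ball x (1 / real (Suc k))"
        using D(2)[of "ball x (1 / real (Suc k))"] by (auto simp del: mem_ball)
      have "ball z (1 / real (Suc k)) \<in> range B" using z(1) unfolding rB \<B>_def by force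
      then obtain j where j: "B j = ball z (1 / real (Suc k))" by force
      have "dist y y' < e" if "y \<in> B j" "y' \<in> B j" for y y'
        using that k dist_triangle2[of y y' z] unfolding j by (simp add: dist_commute)
      then show ?thesis using z(2) j by (auto intro!: exI[of _ j] simp: dist_commute)
    qed
    then obtain i where i: "\<And>x. x \<in> B (i x)" "\<And>x y z. y \<in> B (i x) \<Longrightarrow> z \<in> B (i x) \<Longrightarrow> dist y z < e" by metis
    obtain C where C: "finite C" "C \<subseteq> (\<lambda>x. i x) ` U" "U \<subseteq> (\<Union>j\<in>C. B j)"
    proof -
      have "U \<subseteq> (\<Union>j\<in>i ` U. B j)" using i(1) by blast
      from compactE_image[OF assms _ this] show thesis using oB that by metis
    qed
    \<comment> \<open>The largest index in the finite subcover; the added 0 covers an empty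
      subcover. Codes that agree in the digits up to \<open>m\<close> put \<open>y\<close> into the
      same ball of the subcover as \<open>x\<close>.\<close>
    define m where "m = Max (insert 0 C)"
    have m: "j \<le> m" if "j \<in> C" for j using that C(1) unfolding m_def by simp
    show "\<exists>d>0. \<forall>x\<in>U. \<forall>y\<in>U. \<bar>s x - s y\<bar> < d \<longrightarrow> dist x y < e"
    proof (intro exI[of _ "(1/3)^m / 2"] conjI ballI impI)
      fix x y assume x: "x \<in> U" "y \<in> U" and c: "\<bar>s x - s y\<bar> < (1/3)^m / 2"
      obtain j where j: "j \<in> C" "x \<in> B j" using C(3) x(1) by blast
      have "indicator (B j) x = (indicator (B j) y :: real)"
        by (rule ternary_digits_determined[where b="\<lambda>j. indicator (B j) x" and b'="\<lambda>j. indicator (B j) y" and m=m])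
           (use c m[OF j(1)] in \<open>auto simp: s_def indicator_def\<close>)
      then have "y \<in> B j" using j(2) by (auto simp: indicator_def split: if_splits)
      moreover obtain z where "j = i z" using j(1) C(2) by blast
      ultimately show "dist x y < e" using j(2) i(2) by auto
    qed auto
  qed
qed

section \<open>Probability measures on a subset and their weak limits\<close>

lemma space_borel_on [simp]: "space (borel_on X) = X"
  by (simp add: borel_on_def space_restrict_space)

lemma mem_prob_measures: "\<tau> \<in> prob_measures X \<longleftrightarrow> prob_space \<tau> \<and> sets \<tau> = sets (borel_on X)"
  by (auto simp: prob_measures_def space_prob_algebra)

lemma prob_measuresD:
  assumes "\<tau> \<in> prob_measures X"
  shows "prob_space \<tau>" "sets \<tau> = sets (borel_on X)" "space \<tau> = X"
  using assms sets_eq_imp_space_eq[of \<tau> "borel_on X"] by (auto simp: mem_prob_measures)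

lemma measurable_continuous_borel_on:
  assumes "continuous_on X f"
  shows "f \<in> borel_measurable (borel_on X)"
  using assms unfolding borel_on_def by (rule borel_measurable_continuous_on_restrict)

lemma measurable_borel_onI:
  "f \<in> M \<rightarrow>\<^sub>M borel \<Longrightarrow> (\<And>x. x \<in> space M \<Longrightarrow> f x \<in> X) \<Longrightarrow> f \<in> M \<rightarrow>\<^sub>M borel_on X"
  unfolding borel_on_def by (intro measurable_restrict_space2) auto

lemma measurable_borel_onD: "f \<in> M \<rightarrow>\<^sub>M borel_on X \<Longrightarrow> f \<in> M \<rightarrow>\<^sub>M borel"
  unfolding borel_on_def by (simp add: measurable_restrict_space2_iff)

text \<open>Transported by the code, the measures live on a bounded interval and are tight, so a
  subsequence converges on the real line. The code is only Borel and its image need not be closed;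
  the limit is therefore brought back by the extension of the inverse to the closure
  \<open>C\<close> of the image.\<close>

theorem prob_measures_sequentially_compact:
  fixes U :: "'a::euclidean_space set"
  assumes U: "compact U" and \<tau>: "\<And>n::nat. \<tau> n \<in> prob_measures U"
  obtains r \<tau>' where "strict_mono (r :: nat \<Rightarrow> nat)" "\<tau>' \<in> prob_measures U"
    "\<And>f :: 'a \<Rightarrow> real. continuous_on U f \<Longrightarrow>
       (\<lambda>n. integral\<^sup>L (\<tau> (r n)) f) \<longlonglongrightarrow> integral\<^sup>L \<tau>' f"
proof -
  obtain s :: "'a \<Rightarrow> real" where s[measurable]: "s \<in> borel_measurable borel"
    and s02: "\<And>x. 0 \<le> s x \<and> s x \<le> 2"
    and uc: "\<And>e. 0 < e \<Longrightarrow> \<exists>d>0. \<forall>x\<in>U. \<forall>y\<in>U. \<bar>s x - s y\<bar> < d \<longrightarrow> dist x y < e"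
    using compact_borel_code[OF U] by blast
  have inj: "inj_on s U"
  proof (rule inj_onI)
    fix x y assume xy: "x \<in> U" "y \<in> U" "s x = s y"
    have "dist x y < e" if "0 < e" for e using uc[OF that] xy by force
    then show "x = y" using zero_less_dist_iff[of x y] by blast
  qed
  define g where "g = inv_into U s"
  have gs: "g (s x) = x" if "x \<in> U" for x using that inj unfolding g_def by simp
  have "uniformly_continuous_on (s ` U) g"
    unfolding uniformly_continuous_on_def
  proof (intro allI impI)
    fix e :: real assume "0 < e"
    from uc[OF this] obtain d where "d > 0" "\<forall>x\<in>U. \<forall>y\<in>U. \<bar>s x - s y\<bar> < d \<longrightarrow> dist x y < e" by blast
    then show "\<exists>d>0. \<forall>x\<in>s ` U. \<forall>x'\<in>s ` U. dist x' x < d \<longrightarrow> dist (g x') (g x) < e"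
      by (intro exI[of _ d]) (auto simp: gs dist_real_def)
  qed
  define C where "C = closure (s ` U)"
  \<comment> \<open>Uniform continuity is what allows the inverse to be extended to limit points of
    the image; as \<open>U\<close> is closed, the extension still takes values in
    \<open>U\<close>.\<close>
  obtain \<psi> where \<psi>: "uniformly_continuous_on C \<psi>" "\<And>x. x \<in> s ` U \<Longrightarrow> g x = \<psi> x"
  proof (rule uniformly_continuous_on_extension_on_closure[OF \<open>uniformly_continuous_on (s ` U) g\<close>])
    fix h assume "uniformly_continuous_on (closure (s ` U)) h" "\<And>x. x \<in> s ` U \<Longrightarrow> g x = h x"
    then show thesis using that[of h] unfolding C_def by blast
  qed
  have \<psi>c: "continuous_on C \<psi>" using \<psi>(1) by (rule uniformly_continuous_imp_continuous)
  have \<psi>s: "\<psi> (s x) = x" if "x \<in> U" for x using gs[OF that] \<psi>(2)[OF imageI[OF that]] by simp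
  have \<psi>U: "\<psi> x \<in> U" if "x \<in> C" for x
  proof -
    have "\<psi> ` s ` U \<subseteq> U" using \<psi>s by auto
    then have "\<psi> ` C \<subseteq> U" unfolding C_def
      by (intro image_closure_subset) (use \<psi>c compact_imp_closed[OF U] in \<open>auto simp: C_def\<close>)
    then show ?thesis using that by blast
  qed
  have sC: "s x \<in> C" if "x \<in> U" for x using that closure_subset[of "s ` U"] unfolding C_def by blast
  have C: "closed C" unfolding C_def by simp
  interpret \<tau>: prob_space "\<tau> n" for n using prob_measuresD(1)[OF \<tau>] .
  have st[measurable_cong]: "sets (\<tau> n) = sets (borel_on U)" for n using prob_measuresD(2)[OF \<tau>] .
  have sm[measurable]: "s \<in> borel_measurable (borel_on U)" unfolding borel_on_def
    by (rule measurable_restrict_space1) simp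
  obtain u0 where u0: "u0 \<in> U" using \<tau>.not_empty[of 0] prob_measuresD(3)[OF \<tau>, of 0] by auto
  define \<mu> where "\<mu> n = distr (\<tau> n) borel s" for n
  have rd: "real_distribution (\<mu> n)" for n
    unfolding \<mu>_def by (rule \<tau>.real_distribution_distr) measurable
  have tight: "tight \<mu>" unfolding tight_def
  proof (intro conjI allI impI rd)
    fix e :: real assume "0 < e"
    \<comment> \<open>The codes lie in \<open>[0, 2]\<close>; the half-open interval starts at -1 so
      that 0 is included, and it carries the whole mass of every member.\<close>
    have "measure (\<mu> n) {-1<..2} = measure (\<tau> n) (space (\<tau> n))" for n unfolding \<mu>_def
    proof (subst measure_distr)
      have "s x \<in> {-1<..2}" for x using s02[of x] by simp
      then have "s -` {-1<..2} = UNIV" by blast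
      then show "measure (\<tau> n) (s -` {-1<..2} \<inter> space (\<tau> n)) = measure (\<tau> n) (space (\<tau> n))" by simp
    qed auto
    then show "\<exists>a b. a < b \<and> (\<forall>n. 1 - e < measure (\<mu> n) {a<..b})"
      using \<open>0 < e\<close> by (intro exI[of _ "-1"] exI[of _ 2]) (auto simp: \<tau>.prob_space)
  qed
  obtain r \<nu> where r: "strict_mono r" and \<nu>: "real_distribution \<nu>" and wc: "weak_conv_m (\<mu> \<circ> r) \<nu>"
    using tight_imp_convergent_subsubsequence[OF tight, of id] strict_mono_id by auto
  interpret \<nu>: real_distribution \<nu> by fact
  have conv: "(\<lambda>n. integral\<^sup>L (\<mu> (r n)) F) \<longlonglongrightarrow> integral\<^sup>L \<nu> F"
    if "continuous_on UNIV F" "\<And>x. norm (F x) \<le> B" for F :: "real \<Rightarrow> real" and B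
    using weak_conv_imp_integral_bdd_continuous_conv[of "\<mu> \<circ> r" \<nu> F B] rd \<nu> wc that
    by (auto simp: continuous_on_eq_continuous_at)
  have int\<mu>: "integral\<^sup>L (\<mu> n) F = (\<integral>x. F (s x) \<partial>\<tau> n)" if "continuous_on UNIV F" for F :: "real \<Rightarrow> real" and n
    unfolding \<mu>_def by (rule integral_distr) (use borel_measurable_continuous_onI[OF that] in auto)
  \<comment> \<open>The integrals of the bounded continuous function
    \<open>min 1 (infdist x C)\<close> vanish along the sequence, hence in the limit; its zeros are
    exactly the points of the closed set \<open>C\<close>.\<close>
  have AEC: "AE x in \<nu>. x \<in> C"
  proof -
    define F where "F x = min 1 (infdist x C)" for x
    have Fc: "continuous_on UNIV F" unfolding F_def by (intro continuous_intros)
    have F1: "norm (F x) \<le> 1" "0 \<le> F x" for x unfolding F_def by (auto simp: infdist_nonneg)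
    have "(\<integral>x. F (s x) \<partial>\<tau> n) = (\<integral>x. 0 \<partial>\<tau> n)" for n
      by (rule Bochner_Integration.integral_cong) (auto simp: F_def sC prob_measuresD(3)[OF \<tau>])
    then have "(\<lambda>n. 0) \<longlonglongrightarrow> integral\<^sup>L \<nu> F" using conv[OF Fc F1(1)] int\<mu>[OF Fc] by simp
    then have z: "integral\<^sup>L \<nu> F = 0" by (simp add: LIMSEQ_const_iff)
    have "integrable \<nu> F"
      by (rule \<nu>.integrable_const_bound[where B=1]) (use F1 borel_measurable_continuous_onI[OF Fc] in auto)
    then have AE0: "AE x in \<nu>. F x = 0" using z F1(2) by (subst (asm) integral_nonneg_eq_0_iff_AE) auto
    have "C \<noteq> {}" using sC[OF u0] by blast
    from AE0 show ?thesis
      by eventually_elim (use \<open>C \<noteq> {}\<close> in \<open>auto simp: F_def min_def in_closed_iff_infdist_zero[OF C] split: if_splits\<close>)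
  qed
  obtain \<psi>' where \<psi>'c: "continuous_on UNIV \<psi>'" and \<psi>': "\<And>x. x \<in> C \<Longrightarrow> \<psi>' x = \<psi> x"
  proof -
    obtain B where B: "\<forall>x\<in>U. norm x \<le> B" using compact_imp_bounded[OF U] by (auto simp: bounded_iff)
    have "0 \<le> B" using B u0 norm_ge_zero order_trans by blast
    show thesis
      by (rule Tietze[OF \<psi>c, of UNIV B]) (use C B \<psi>U that \<open>0 \<le> B\<close> in auto)
  qed
  \<comment> \<open>The value \<open>u0\<close> off \<open>C\<close> only keeps
    \<open>\<phi>\<close> inside \<open>U\<close>; \<open>\<nu>\<close> does not charge that
    part.\<close>
  define \<phi> where "\<phi> x = (if x \<in> C then \<psi>' x else u0)" for x
  have \<phi>U: "\<phi> x \<in> U" for x using \<psi>U u0 \<psi>' by (simp add: \<phi>_def)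
  have \<phi>[measurable]: "\<phi> \<in> borel \<rightarrow>\<^sub>M borel_on U"
  proof (rule measurable_borel_onI[OF _ \<phi>U])
    have [measurable]: "\<psi>' \<in> borel_measurable borel" using \<psi>'c by (rule borel_measurable_continuous_onI)
    have [measurable]: "C \<in> sets borel" using C by simp
    show "\<phi> \<in> borel_measurable borel" unfolding \<phi>_def by measurable
  qed
  define \<tau>' where "\<tau>' = distr \<nu> (borel_on U) \<phi>"
  show thesis
  proof (rule that[OF r])
    show "\<tau>' \<in> prob_measures U" unfolding \<tau>'_def mem_prob_measures
      by (auto intro!: \<nu>.prob_space_distr)
    fix f :: "'a \<Rightarrow> real" assume f: "continuous_on U f"
    have fm[measurable]: "f \<in> borel_measurable (borel_on U)" using f by (rule measurable_continuous_borel_on)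
    obtain B where B: "\<forall>x\<in>U. norm (f x) \<le> B"
      using compact_imp_bounded[OF compact_continuous_image[OF f U]] by (auto simp: bounded_iff)
    have "0 \<le> B" using B u0 norm_ge_zero order_trans by blast
    have "continuous_on C (\<lambda>x. f (\<psi> x))"
      by (rule continuous_on_compose2[OF f \<psi>c]) (use \<psi>U in auto)
    \<comment> \<open>A test function on \<open>U\<close> becomes one on the whole line by Tietze
      extension with the same bound, as weak convergence on the line asks for.\<close>
    then obtain F where Fc: "continuous_on UNIV F" and F: "\<And>x. x \<in> C \<Longrightarrow> F x = f (\<psi> x)"
      and FB: "\<And>x. norm (F x) \<le> B"
      by (rule Tietze[of C "\<lambda>x. f (\<psi> x)" UNIV B]) (use C \<open>0 \<le> B\<close> B \<psi>U in auto)
    have Fm[measurable]: "F \<in> borel_measurable borel" using Fc by (rule borel_measurable_continuous_onI)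
    have "integral\<^sup>L \<tau>' f = (\<integral>x. f (\<phi> x) \<partial>\<nu>)" unfolding \<tau>'_def by (rule integral_distr) auto
    also have "\<dots> = integral\<^sup>L \<nu> F"
    proof (rule integral_cong_AE)
      show "AE x in \<nu>. f (\<phi> x) = F x" using AEC by eventually_elim (simp add: \<phi>_def F \<psi>')
    qed auto
    finally have 1: "integral\<^sup>L \<tau>' f = integral\<^sup>L \<nu> F" .
    have "integral\<^sup>L (\<mu> n) F = integral\<^sup>L (\<tau> n) f" for n unfolding int\<mu>[OF Fc]
      by (rule Bochner_Integration.integral_cong) (auto simp: F sC \<psi>s prob_measuresD(3)[OF \<tau>])
    then show "(\<lambda>n. integral\<^sup>L (\<tau> (r n)) f) \<longlonglongrightarrow> integral\<^sup>L \<tau>' f"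
      using conv[OF Fc FB] unfolding 1 by simp
  qed
qed

section \<open>Weakly continuous statistics\<close>

text \<open>Induction over the generation of the open set: an intersection merges the two sets of
  test functions and takes the smaller radius, a union uses the member containing
  \<open>\<tau>\<close>, and a subbasic set contains a ball around the integral.\<close>

lemma weak_topology_neighbourhood:
  assumes W: "openin (weak_topology X) W" and "\<tau> \<in> W"
  shows "\<exists>F \<delta>. finite F \<and> 0 < \<delta> \<and> (\<forall>f\<in>F. continuous_on X f \<and> bounded (f ` X)) \<and>
    (\<forall>\<sigma>\<in>prob_measures X. (\<forall>f\<in>F. \<bar>integral\<^sup>L \<sigma> f - integral\<^sup>L \<tau> f\<bar> < (\<delta>::real)) \<longrightarrow> \<sigma> \<in> W)"
proof -
  have "generate_topology_on {{\<mu> \<in> prob_measures X. integral\<^sup>L \<mu> f \<in> V} | (f :: 'a \<Rightarrow> real) V.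
        continuous_on X f \<and> bounded (f ` X) \<and> open V} W"
    using W unfolding weak_topology_def by (simp add: openin_topology_generated_by_iff)
  then show ?thesis using \<open>\<tau> \<in> W\<close>
  proof induction
    case (Int a b)
    obtain F \<delta> where F: "finite F" "0 < \<delta>" "\<forall>f\<in>F. continuous_on X f \<and> bounded (f ` X)"
      "\<forall>\<sigma>\<in>prob_measures X. (\<forall>f\<in>F. \<bar>integral\<^sup>L \<sigma> f - integral\<^sup>L \<tau> f\<bar> < (\<delta>::real)) \<longrightarrow> \<sigma> \<in> a"
      using Int by blast
    obtain F' \<delta>' where F': "finite F'" "0 < \<delta>'" "\<forall>f\<in>F'. continuous_on X f \<and> bounded (f ` X)"
      "\<forall>\<sigma>\<in>prob_measures X. (\<forall>f\<in>F'. \<bar>integral\<^sup>L \<sigma> f - integral\<^sup>L \<tau> f\<bar> < (\<delta>'::real)) \<longrightarrow> \<sigma> \<in> b"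
      using Int by blast
    show ?case
      by (rule exI[of _ "F \<union> F'"], rule exI[of _ "min \<delta> \<delta>'"]) (use F F' in auto)
  next
    case (UN K)
    then obtain k where k: "k \<in> K" "\<tau> \<in> k" by blast
    obtain F \<delta> where F: "finite F" "0 < \<delta>" "\<forall>f\<in>F. continuous_on X f \<and> bounded (f ` X)"
      "\<forall>\<sigma>\<in>prob_measures X. (\<forall>f\<in>F. \<bar>integral\<^sup>L \<sigma> f - integral\<^sup>L \<tau> f\<bar> < (\<delta>::real)) \<longrightarrow> \<sigma> \<in> k"
      using UN.IH[OF k] by blast
    show ?case
    proof (intro exI[of _ F] exI[of _ \<delta>] conjI ballI impI)
      fix \<sigma> assume "\<sigma> \<in> prob_measures X" "\<forall>f\<in>F. \<bar>integral\<^sup>L \<sigma> f - integral\<^sup>L \<tau> f\<bar> < \<delta>"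
      then have "\<sigma> \<in> k" using F(4) by simp
      then show "\<sigma> \<in> \<Union>K" using k(1) by blast
    qed (use F in auto)
  next
    case (Basis s)
    then obtain f :: "'a \<Rightarrow> real" and V where s: "s = {\<mu> \<in> prob_measures X. integral\<^sup>L \<mu> f \<in> V}"
      and f: "continuous_on X f" "bounded (f ` X)" "open V" by blast
    have "integral\<^sup>L \<tau> f \<in> V" using Basis s by simp
    then obtain \<delta> where \<delta>: "0 < \<delta>" "\<And>y. dist y (integral\<^sup>L \<tau> f) < \<delta> \<Longrightarrow> y \<in> V"
      using f(3) unfolding open_dist by blast
    show ?case
      by (rule exI[of _ "{f}"], rule exI[of _ \<delta>]) (use f \<delta> in \<open>auto simp: s dist_real_def\<close>)
  qed simp
qed

text \<open>An open condition on the statistic is reduced to finitely many scalar integrals being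
  close, the form to which a law of large numbers for averages applies.\<close>

lemma weakly_continuous_neighbourhood:
  assumes \<Xi>: "continuous_map (weak_topology X) (top_of_set V) \<Xi>"
    and \<tau>: "\<tau> \<in> prob_measures X" and A: "open A" "\<Xi> \<tau> \<in> A"
  obtains F and \<delta> :: real where "finite F" "0 < \<delta>" "\<And>f. f \<in> F \<Longrightarrow> continuous_on X f"
    "\<And>f. f \<in> F \<Longrightarrow> bounded (f ` X)"
    "\<And>\<sigma>. \<sigma> \<in> prob_measures X \<Longrightarrow> (\<And>f. f \<in> F \<Longrightarrow> \<bar>integral\<^sup>L \<sigma> f - integral\<^sup>L \<tau> f\<bar> < \<delta>) \<Longrightarrow> \<Xi> \<sigma> \<in> A"
proof -
  have "openin (weak_topology X) {x \<in> topspace (weak_topology X). \<Xi> x \<in> V \<inter> A}"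
    using \<Xi> A(1) by (intro openin_continuous_map_preimage[OF \<Xi>]) (simp add: openin_open_Int)
  moreover have "\<tau> \<in> {x \<in> topspace (weak_topology X). \<Xi> x \<in> V \<inter> A}"
    using \<tau> A \<Xi> by (auto simp: topspace_weak_topology continuous_map_def)
  ultimately have "\<exists>F \<delta>. finite F \<and> 0 < (\<delta>::real) \<and> (\<forall>f\<in>F. continuous_on X f \<and> bounded (f ` X)) \<and>
    (\<forall>\<sigma>\<in>prob_measures X. (\<forall>f\<in>F. \<bar>integral\<^sup>L \<sigma> f - integral\<^sup>L \<tau> f\<bar> < \<delta>) \<longrightarrow> \<sigma> \<in> {x \<in> topspace (weak_topology X). \<Xi> x \<in> V \<inter> A})"
    by (rule weak_topology_neighbourhood)
  then obtain F \<delta> where *: "finite F" "0 < (\<delta>::real)" "\<forall>f\<in>F. continuous_on X f \<and> bounded (f ` X)"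
    "\<forall>\<sigma>\<in>prob_measures X. (\<forall>f\<in>F. \<bar>integral\<^sup>L \<sigma> f - integral\<^sup>L \<tau> f\<bar> < \<delta>) \<longrightarrow> \<sigma> \<in> {x \<in> topspace (weak_topology X). \<Xi> x \<in> V \<inter> A}"
    by (elim exE conjE)
  show thesis by (rule that[of F \<delta>]) (use * in auto)
qed

lemma weakly_continuous_range:
  assumes "continuous_map (weak_topology X) (top_of_set V) \<Xi>" "\<tau> \<in> prob_measures X"
  shows "\<Xi> \<tau> \<in> V"
  using assms by (auto simp: topspace_weak_topology continuous_map_def)

lemma empirical_in_prob_measures:
  assumes "0 < N" "\<And>k. k < N \<Longrightarrow> u k \<in> U"
  shows "empirical U N u \<in> prob_measures U"
proof -
  have m: "u \<in> uniform_count_measure {..<N} \<rightarrow>\<^sub>M borel_on U"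
    using assms(2) by (auto simp: measurable_def space_uniform_count_measure sets_uniform_count_measure)
  have "prob_space (uniform_count_measure {..<N})"
    using assms(1) by (intro prob_space_uniform_count_measure) auto
  with m show ?thesis unfolding empirical_def mem_prob_measures
    by (auto intro: prob_space.prob_space_distr)
qed

lemma integral_empirical:
  fixes f :: "'a::topological_space \<Rightarrow> real"
  assumes "0 < N" "\<And>k. k < N \<Longrightarrow> u k \<in> U" and f: "f \<in> borel_measurable (borel_on U)"
  shows "integral\<^sup>L (empirical U N u) f = (\<Sum>k<N. f (u k)) / real N"
proof -
  have m: "u \<in> uniform_count_measure {..<N} \<rightarrow>\<^sub>M borel_on U"
    using assms(2) by (auto simp: measurable_def space_uniform_count_measure sets_uniform_count_measure)
  show ?thesis unfolding empirical_def
    by (subst integral_distr[OF m f]) (simp add: integral_uniform_count_measure)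
qed

text \<open>Integrals against an empirical measure are finite averages of continuous functions of
  the coordinates. Continuity in the action profile is the route to measurability.\<close>

lemma continuous_on_stat_empirical:
  fixes U :: "'u::euclidean_space set" and \<Xi> :: "'u measure \<Rightarrow> 'v::euclidean_space"
  assumes \<Xi>: "continuous_map (weak_topology U) (top_of_set V) \<Xi>" and N: "0 < N"
  shows "continuous_on {u. \<forall>k<N. u k \<in> U} (\<lambda>u. \<Xi> (empirical U N u))"
  unfolding continuous_on_def
proof (intro ballI tendstoI)
  let ?S = "{u. \<forall>k<N. u k \<in> U}"
  fix u and e :: real assume u: "u \<in> ?S" and e: "0 < e"
  have p: "empirical U N u' \<in> prob_measures U" if "u' \<in> ?S" for u'
    using empirical_in_prob_measures[OF N] that by blast
  from weakly_continuous_neighbourhood[OF \<Xi> p[OF u], of "ball (\<Xi> (empirical U N u)) e"] e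
  obtain F \<delta> where F: "finite F" "0 < (\<delta>::real)" "\<And>f. f \<in> F \<Longrightarrow> continuous_on U f"
    "\<And>\<sigma>. \<sigma> \<in> prob_measures U \<Longrightarrow> (\<And>f. f \<in> F \<Longrightarrow> \<bar>integral\<^sup>L \<sigma> f - integral\<^sup>L (empirical U N u) f\<bar> < \<delta>)
      \<Longrightarrow> \<Xi> \<sigma> \<in> ball (\<Xi> (empirical U N u)) e"
    by (metis centre_in_ball open_ball)
  have ie: "integral\<^sup>L (empirical U N u') f = (\<Sum>k<N. f (u' k)) / real N" if "u' \<in> ?S" "f \<in> F" for u' f
    using that by (intro integral_empirical N measurable_continuous_borel_on F(3)) auto
  have "eventually (\<lambda>u'. \<bar>(\<Sum>k<N. f (u' k)) / real N - (\<Sum>k<N. f (u k)) / real N\<bar> < \<delta>) (at u within ?S)"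
    if f: "f \<in> F" for f
  proof -
    have "continuous_on ?S (\<lambda>u. (\<Sum>k<N. f (u k)) / real N)"
      by (intro continuous_intros continuous_on_compose2[OF F(3)[OF f]]
            continuous_on_subset[OF continuous_on_product_coordinates]) (use N in auto)
    then have "((\<lambda>u. (\<Sum>k<N. f (u k)) / real N) \<longlongrightarrow> (\<Sum>k<N. f (u k)) / real N) (at u within ?S)"
      using u unfolding continuous_on_def by blast
    from tendstoD[OF this F(2)] show ?thesis by (simp add: dist_real_def)
  qed
  then have "\<forall>f\<in>F. eventually (\<lambda>u'. \<bar>(\<Sum>k<N. f (u' k)) / real N - (\<Sum>k<N. f (u k)) / real N\<bar> < \<delta>) (at u within ?S)"
    by blast
  then have "eventually (\<lambda>u'. \<forall>f\<in>F. \<bar>(\<Sum>k<N. f (u' k)) / real N - (\<Sum>k<N. f (u k)) / real N\<bar> < \<delta>) (at u within ?S)"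
    by (rule eventually_ball_finite[OF F(1)])
  moreover have "eventually (\<lambda>u'. u' \<in> ?S) (at u within ?S)"
    by (simp add: eventually_at_filter)
  ultimately show "eventually (\<lambda>u'. dist (\<Xi> (empirical U N u')) (\<Xi> (empirical U N u)) < e) (at u within ?S)"
  proof eventually_elim
    case (elim u')
    have "\<Xi> (empirical U N u') \<in> ball (\<Xi> (empirical U N u)) e"
      by (rule F(4)[OF p]) (use elim u in \<open>auto simp: ie\<close>)
    then show ?case by (simp add: dist_commute)
  qed
qed

text \<open>Continuity concerns functions on all of \<open>nat\<close>, while the finite product
  carries functions that are \<open>undefined\<close> beyond \<open>N\<close>. The embedding of the
  latter is measurable coordinate by coordinate because the extra coordinates are constant.\<close>

lemma measurable_stat_empirical:
  fixes U :: "'u::euclidean_space set" and \<Xi> :: "'u measure \<Rightarrow> 'v::euclidean_space"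
  assumes \<Xi>: "continuous_map (weak_topology U) (top_of_set V) \<Xi>" and N: "0 < N"
  shows "(\<lambda>u. \<Xi> (empirical U N u)) \<in> borel_measurable (PiM {..<N} (\<lambda>_. borel_on U))"
proof -
  let ?S = "{u. \<forall>k<N. u k \<in> U}"
  have "(\<lambda>u. \<Xi> (empirical U N u)) \<in> borel_measurable (restrict_space borel ?S)"
    using continuous_on_stat_empirical[OF \<Xi> N] by (rule borel_measurable_continuous_on_restrict)
  moreover have "(\<lambda>u. u) \<in> PiM {..<N} (\<lambda>_. borel_on U) \<rightarrow>\<^sub>M restrict_space borel ?S"
  proof (rule measurable_restrict_space2)
    show "(\<lambda>u. u) \<in> space (PiM {..<N} (\<lambda>_. borel_on U)) \<rightarrow> ?S"
      by (auto simp: space_PiM PiE_def Pi_def)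
    have "(\<lambda>u. u) \<in> PiM {..<N} (\<lambda>_. borel_on U) \<rightarrow>\<^sub>M PiM UNIV (\<lambda>_. borel)"
    proof (rule measurable_PiM_single')
      fix k :: nat
      show "(\<lambda>u. u k) \<in> borel_measurable (PiM {..<N} (\<lambda>_. borel_on U))"
      proof (cases "k < N")
        case True
        then have "(\<lambda>u. u k) \<in> PiM {..<N} (\<lambda>_. borel_on U) \<rightarrow>\<^sub>M borel_on U"
          by (intro measurable_component_singleton) auto
        then show ?thesis by (rule measurable_borel_onD)
      next
        case False
        then have "u k = undefined" if "u \<in> space (PiM {..<N} (\<lambda>_. borel_on U))" for u :: "nat \<Rightarrow> 'u"
          using that by (auto simp: space_PiM PiE_def extensional_def)
        then show ?thesis by (subst measurable_cong[where g="\<lambda>_. undefined"]) auto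
      qed
    qed auto
    then show "(\<lambda>u. u) \<in> PiM {..<N} (\<lambda>_. borel_on U) \<rightarrow>\<^sub>M borel"
      by (simp cong: measurable_cong_sets add: sets_PiM_equal_borel)
  qed
  ultimately show ?thesis using measurable_comp by (fastforce simp: comp_def)
qed

text \<open>For an empirical measure this is the average cost over the team; for an average action
  law it is the cost in the limit. One functional for both turns the passage to the limit into a
  continuity statement.\<close>

definition mean_field_cost ::
  "('u measure \<Rightarrow> 'v1) \<Rightarrow> ('u2 measure \<Rightarrow> 'v2) \<Rightarrow> ('u \<Rightarrow> 'v1 \<Rightarrow> 'v2 \<Rightarrow> real) \<Rightarrow>
    'u measure \<Rightarrow> 'u2 measure \<Rightarrow> real" where
  "mean_field_cost \<Xi>1 \<Xi>2 c \<tau> \<sigma> = (\<integral>u. c u (\<Xi>1 \<tau>) (\<Xi>2 \<sigma>) \<partial>\<tau>)"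

lemma continuous_on_action_section:
  assumes "continuous_on (U \<times> V1 \<times> V2) (\<lambda>(u, v1, v2). c u v1 v2)" "v1 \<in> V1" "v2 \<in> V2"
  shows "continuous_on U (\<lambda>u. c u v1 v2)"
proof -
  have "continuous_on U (\<lambda>u. (u, v1, v2))" by (intro continuous_intros)
  from continuous_on_compose2[OF assms(1) this] assms(2,3) show ?thesis by auto
qed

text \<open>Both the integrand and the measure change with \<open>\<tau>\<close>. Compactness of
  \<open>U\<close> keeps the cost close to its value at the old statistics uniformly in the action,
  which bounds the first change; the second is that of the integral of one fixed continuous
  function, which is added to the test functions. Each contributes at most
  \<open>e / 3\<close>.\<close>

lemma mean_field_cost_neighbourhood:
  fixes c :: "'u::euclidean_space \<Rightarrow> 'v1::euclidean_space \<Rightarrow> 'v2::euclidean_space \<Rightarrow> real"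
    and U2 :: "'u2::euclidean_space set"
  assumes U: "compact U"
    and \<Xi>1: "continuous_map (weak_topology U) (top_of_set V1) \<Xi>1"
    and \<Xi>2: "continuous_map (weak_topology U2) (top_of_set V2) \<Xi>2"
    and c: "continuous_on (U \<times> V1 \<times> V2) (\<lambda>(u, v1, v2). c u v1 v2)"
    and \<tau>: "\<tau> \<in> prob_measures U" and \<sigma>: "\<sigma> \<in> prob_measures U2" and e: "0 < e"
  obtains F1 F2 and \<delta> :: real where "finite F1" "finite F2" "0 < \<delta>"
    "\<And>f. f \<in> F1 \<Longrightarrow> continuous_on U f" "\<And>f. f \<in> F2 \<Longrightarrow> continuous_on U2 f"
    "\<And>f. f \<in> F2 \<Longrightarrow> bounded (f ` U2)"
    "\<And>\<tau>' \<sigma>'. \<tau>' \<in> prob_measures U \<Longrightarrow> \<sigma>' \<in> prob_measures U2 \<Longrightarrow>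
      (\<And>f. f \<in> F1 \<Longrightarrow> \<bar>integral\<^sup>L \<tau>' f - integral\<^sup>L \<tau> f\<bar> < \<delta>) \<Longrightarrow>
      (\<And>f. f \<in> F2 \<Longrightarrow> \<bar>integral\<^sup>L \<sigma>' f - integral\<^sup>L \<sigma> f\<bar> < \<delta>) \<Longrightarrow>
      \<bar>mean_field_cost \<Xi>1 \<Xi>2 c \<tau>' \<sigma>' - mean_field_cost \<Xi>1 \<Xi>2 c \<tau> \<sigma>\<bar> < e"
proof -
  define v1 where "v1 = \<Xi>1 \<tau>"
  define v2 where "v2 = \<Xi>2 \<sigma>"
  have v: "v1 \<in> V1" "v2 \<in> V2"
    unfolding v1_def v2_def using weakly_continuous_range[OF \<Xi>1 \<tau>] weakly_continuous_range[OF \<Xi>2 \<sigma>] by auto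
  have "continuous_on ((V1 \<times> V2) \<times> U) (\<lambda>(v, u). c u (fst v) (snd v))"
  proof -
    have "continuous_on ((V1 \<times> V2) \<times> U) (\<lambda>x. (snd x, fst (fst x), snd (fst x)))"
      by (intro continuous_intros)
    from continuous_on_compose2[OF c this] show ?thesis by (auto simp: case_prod_unfold image_subset_iff)
  qed
  \<comment> \<open>Tube argument: one neighbourhood of the pair of statistics serves all
    actions.\<close>
  then obtain X0 where X0: "(v1, v2) \<in> X0" "open X0"
    and X0_close: "\<forall>x\<in>X0 \<inter> V1 \<times> V2. \<forall>u\<in>U. dist (case (x, u) of (v, u) \<Rightarrow> c u (fst v) (snd v))
        (case ((v1, v2), u) of (v, u) \<Rightarrow> c u (fst v) (snd v)) \<le> e / 3"
    by (rule continuous_on_prod_compactE[OF _ U, of _ _ "(v1, v2)" "e / 3"]) (use v e in auto)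
  obtain A B where AB: "open A" "open B" "(v1, v2) \<in> A \<times> B" "A \<times> B \<subseteq> X0"
    using open_prod_elim[OF X0(2) X0(1)] by metis
  from weakly_continuous_neighbourhood[OF \<Xi>1 \<tau> AB(1)] AB(3)
  obtain F1 \<delta>1 where F1: "finite F1" "0 < (\<delta>1::real)" "\<And>f. f \<in> F1 \<Longrightarrow> continuous_on U f"
    "\<And>\<sigma>. \<sigma> \<in> prob_measures U \<Longrightarrow> (\<And>f. f \<in> F1 \<Longrightarrow> \<bar>integral\<^sup>L \<sigma> f - integral\<^sup>L \<tau> f\<bar> < \<delta>1) \<Longrightarrow> \<Xi>1 \<sigma> \<in> A"
    unfolding v1_def by (metis mem_Sigma_iff)
  from weakly_continuous_neighbourhood[OF \<Xi>2 \<sigma> AB(2)] AB(3)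
  obtain F2 \<delta>2 where F2: "finite F2" "0 < (\<delta>2::real)" "\<And>f. f \<in> F2 \<Longrightarrow> continuous_on U2 f"
    "\<And>f. f \<in> F2 \<Longrightarrow> bounded (f ` U2)"
    "\<And>\<tau>. \<tau> \<in> prob_measures U2 \<Longrightarrow> (\<And>f. f \<in> F2 \<Longrightarrow> \<bar>integral\<^sup>L \<tau> f - integral\<^sup>L \<sigma> f\<bar> < \<delta>2) \<Longrightarrow> \<Xi>2 \<tau> \<in> B"
    unfolding v2_def by (metis mem_Sigma_iff)
  let ?f = "\<lambda>u. c u v1 v2"
  have cf: "continuous_on U ?f" by (rule continuous_on_action_section[OF c v])
  show thesis
  proof (rule that[of "insert ?f F1" F2 "min (min \<delta>1 \<delta>2) (e/3)"])
    fix \<tau>' \<sigma>' assume \<tau>': "\<tau>' \<in> prob_measures U" and \<sigma>': "\<sigma>' \<in> prob_measures U2"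
      and a1: "\<And>f. f \<in> insert ?f F1 \<Longrightarrow> \<bar>integral\<^sup>L \<tau>' f - integral\<^sup>L \<tau> f\<bar> < min (min \<delta>1 \<delta>2) (e/3)"
      and a2: "\<And>f. f \<in> F2 \<Longrightarrow> \<bar>integral\<^sup>L \<sigma>' f - integral\<^sup>L \<sigma> f\<bar> < min (min \<delta>1 \<delta>2) (e/3)"
    have A: "\<Xi>1 \<tau>' \<in> A" by (rule F1(4)[OF \<tau>']) (use a1 in force)
    have B: "\<Xi>2 \<sigma>' \<in> B" by (rule F2(5)[OF \<sigma>']) (use a2 in force)
    have V: "\<Xi>1 \<tau>' \<in> V1" "\<Xi>2 \<sigma>' \<in> V2"
      using weakly_continuous_range[OF \<Xi>1 \<tau>'] weakly_continuous_range[OF \<Xi>2 \<sigma>'] by auto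
    let ?g = "\<lambda>u. c u (\<Xi>1 \<tau>') (\<Xi>2 \<sigma>')"
    interpret \<tau>': prob_space \<tau>' using prob_measuresD(1)[OF \<tau>'] .
    have int: "integrable \<tau>' h" if hc: "continuous_on U h" for h :: "'u \<Rightarrow> real"
    proof -
      obtain H where H: "\<forall>x\<in>U. norm (h x) \<le> H"
        using compact_imp_bounded[OF compact_continuous_image[OF hc U]] by (auto simp: bounded_iff)
      have "h \<in> borel_measurable \<tau>'"
        using measurable_continuous_borel_on[OF hc] by (simp cong: measurable_cong_sets add: prob_measuresD(2)[OF \<tau>'])
      then show ?thesis
        by (intro \<tau>'.integrable_const_bound[where B=H]) (use H prob_measuresD(3)[OF \<tau>'] in auto)
    qed
    have cg: "continuous_on U ?g" by (rule continuous_on_action_section[OF c V])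
    have close: "\<bar>?g u - ?f u\<bar> \<le> e / 3" if u: "u \<in> U" for u
    proof -
      have "(\<Xi>1 \<tau>', \<Xi>2 \<sigma>') \<in> X0 \<inter> V1 \<times> V2" using A B V AB(4) by blast
      from X0_close[THEN bspec, OF this, THEN bspec, OF u] show ?thesis by (simp add: dist_real_def)
    qed
    have idiff: "integrable \<tau>' (\<lambda>u. ?g u - ?f u)" by (intro int continuous_on_diff cg cf)
    have "\<bar>\<integral>u. ?g u - ?f u \<partial>\<tau>'\<bar> \<le> (\<integral>u. \<bar>?g u - ?f u\<bar> \<partial>\<tau>')" by (rule integral_abs_bound)
    also have "\<dots> \<le> e / 3"
    proof (rule \<tau>'.integral_le_const)
      show "integrable \<tau>' (\<lambda>u. \<bar>?g u - ?f u\<bar>)" using idiff by (rule integrable_abs)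
      show "AE u in \<tau>'. \<bar>?g u - ?f u\<bar> \<le> e / 3"
        by (rule AE_I2) (rule close, simp add: prob_measuresD(3)[OF \<tau>'])
    qed
    finally have "\<bar>\<integral>u. ?g u - ?f u \<partial>\<tau>'\<bar> \<le> e / 3" .
    then have "\<bar>integral\<^sup>L \<tau>' ?g - integral\<^sup>L \<tau>' ?f\<bar> \<le> e / 3"
      by (simp add: Bochner_Integration.integral_diff int cg cf)
    moreover have "\<bar>integral\<^sup>L \<tau>' ?f - integral\<^sup>L \<tau> ?f\<bar> < e / 3" using a1[of ?f] by simp
    ultimately show "\<bar>mean_field_cost \<Xi>1 \<Xi>2 c \<tau>' \<sigma>' - mean_field_cost \<Xi>1 \<Xi>2 c \<tau> \<sigma>\<bar> < e"
      using e unfolding mean_field_cost_def v1_def v2_def by linarith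
  next
    show "finite (insert ?f F1)" using F1(1) by simp
    show "0 < min (min \<delta>1 \<delta>2) (e / 3)" using F1(2) F2(2) e by simp
    show "continuous_on U f" if "f \<in> insert ?f F1" for f using that cf F1(3) by blast
  qed (use F2 in auto)
qed

section \<open>Law of large numbers for the empirical cost\<close>

lemma (in product_prob_space) indep_vars_coordinates:
  assumes "I \<noteq> {}"
  shows "P.indep_vars M (\<lambda>i x. x i) I"
proof (subst P.indep_vars_iff_distr_eq_PiM'[OF assms])
  show "(\<lambda>x. x i) \<in> PiM I M \<rightarrow>\<^sub>M M i" if "i \<in> I" for i
    using that by simp
  have "distr (PiM I M) (PiM I M) (\<lambda>x. \<lambda>i\<in>I. x i) = distr (PiM I M) (PiM I M) (\<lambda>x. x)"
    by (rule distr_cong) (auto simp: space_PiM)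
  also have "\<dots> = PiM I M" by simp
  also have "\<dots> = PiM I (\<lambda>i. distr (PiM I M) (M i) (\<lambda>x. x i))"
    by (rule PiM_cong) (auto simp: PiM_component)
  finally show "distr (PiM I M) (PiM I M) (\<lambda>x. \<lambda>i\<in>I. x i) = PiM I (\<lambda>i. distr (PiM I M) (M i) (\<lambda>x. x i))" .
qed

text \<open>Hoeffding's inequality. The bound sees the laws \<open>\<tau> k\<close> only through the
  range of \<open>f\<close>, so it is uniform when the laws change with \<open>N\<close>.\<close>

lemma PiM_average_concentration:
  fixes f :: "'a::topological_space \<Rightarrow> real"
  assumes N: "0 < N" and \<tau>: "\<And>k. \<tau> k \<in> prob_measures U"
    and f: "f \<in> borel_measurable (borel_on U)" and B: "0 < B" "\<And>u. u \<in> U \<Longrightarrow> \<bar>f u\<bar> \<le> B"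
    and \<delta>: "0 < \<delta>"
  shows "measure (PiM {..<N} \<tau>) {u \<in> space (PiM {..<N} \<tau>).
      \<delta> \<le> \<bar>(\<Sum>k<N. f (u k)) / real N - (\<Sum>k<N. integral\<^sup>L (\<tau> k) f) / real N\<bar>}
    \<le> 2 * exp (- (\<delta>\<^sup>2 / (2 * B\<^sup>2)) * real N)"
proof -
  interpret \<tau>: prob_space "\<tau> k" for k using prob_measuresD(1)[OF \<tau>] .
  interpret P: product_prob_space \<tau> "{..<N}" by standard
  have fm: "f \<in> borel_measurable (\<tau> k)" for k
    using f by (simp cong: measurable_cong_sets add: prob_measuresD(2)[OF \<tau>])
  have ind: "P.indep_vars (\<lambda>_. borel) (\<lambda>k u. f (u k)) {..<N}"
    by (rule P.indep_vars_compose2[OF P.indep_vars_coordinates]) (use N fm in auto)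
  have ex: "P.expectation (\<lambda>u. f (u k)) = integral\<^sup>L (\<tau> k) f" if "k < N" for k
  proof -
    have "integral\<^sup>L (distr (PiM {..<N} \<tau>) (\<tau> k) (\<lambda>u. u k)) f = P.expectation (\<lambda>u. f (u k))"
      by (rule integral_distr) (use that fm in auto)
    then show ?thesis using that by (simp add: P.PiM_component)
  qed
  interpret H: Hoeffding_ineq "PiM {..<N} \<tau>" "{..<N}" "\<lambda>k u. f (u k)" "\<lambda>_. -B" "\<lambda>_. B"
    "\<Sum>k<N. P.expectation (\<lambda>u. f (u k))"
  proof unfold_locales
    show "AE u in PiM {..<N} \<tau>. f (u k) \<in> {-B..B}" if "k \<in> {..<N}" for k
    proof (rule AE_I2)
      fix u assume "u \<in> space (PiM {..<N} \<tau>)"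
      then have "u k \<in> U" using that prob_measuresD(3)[OF \<tau>, of k] by (auto simp: space_PiM PiE_def Pi_def)
      then show "f (u k) \<in> {-B..B}" using B(2)[of "u k"] by auto
    qed
  qed (use ind in auto)
  have "measure (PiM {..<N} \<tau>) {u \<in> space (PiM {..<N} \<tau>).
      \<delta> * real N \<le> \<bar>(\<Sum>k<N. f (u k)) - (\<Sum>k<N. P.expectation (\<lambda>u. f (u k)))\<bar>}
      \<le> 2 * exp (-2 * (\<delta> * real N)\<^sup>2 / (\<Sum>k<N. (B - - B)\<^sup>2))"
    by (rule H.Hoeffding_ineq_abs_ge) (use \<delta> N B in \<open>auto intro!: sum_pos\<close>)
  \<comment> \<open>Each summand ranges over an interval of length \<open>2 * B\<close>, so the
    denominator is \<open>4 * N * B^2\<close>.\<close>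
  also have "-2 * (\<delta> * real N)\<^sup>2 / (\<Sum>k<N. (B - - B)\<^sup>2) = - (\<delta>\<^sup>2 / (2 * B\<^sup>2)) * real N"
    using N B by (simp add: field_simps power2_eq_square)
  also have "{u \<in> space (PiM {..<N} \<tau>). \<delta> * real N \<le> \<bar>(\<Sum>k<N. f (u k)) - (\<Sum>k<N. P.expectation (\<lambda>u. f (u k)))\<bar>}
     = {u \<in> space (PiM {..<N} \<tau>). \<delta> \<le> \<bar>(\<Sum>k<N. f (u k)) / real N - (\<Sum>k<N. integral\<^sup>L (\<tau> k) f) / real N\<bar>}"
  proof -
    have "\<delta> * real N \<le> \<bar>a - b\<bar> \<longleftrightarrow> \<delta> \<le> \<bar>a / real N - b / real N\<bar>" for a b
      using N by (simp add: diff_divide_distrib[symmetric] abs_divide pos_le_divide_eq)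
    then show ?thesis by (simp add: ex)
  qed
  finally show ?thesis .
qed

text \<open>Off \<open>B\<close> the error is at most \<open>\<epsilon>\<close>; on \<open>B\<close>
  two numbers from \<open>[0, H]\<close> differ by at most \<open>H\<close>.\<close>

lemma (in prob_space) expectation_near_const:
  assumes g: "random_variable borel g" "\<And>x. x \<in> space M \<Longrightarrow> 0 \<le> g x \<and> g x \<le> H"
    and a: "0 \<le> a" "a \<le> H" "0 \<le> \<epsilon>" and B: "B \<in> events"
    and near: "\<And>x. x \<in> space M - B \<Longrightarrow> \<bar>g x - a\<bar> \<le> \<epsilon>"
  shows "\<bar>expectation g - a\<bar> \<le> \<epsilon> + H * prob B"
proof -
  have ig: "integrable M g" by (rule integrable_const_bound[where B=H]) (use g in auto)
  have iB: "integrable M (\<lambda>x. \<epsilon>)" "integrable M (\<lambda>x. H * indicator B x)"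
    by (rule integrable_const) (rule integrable_const_bound[where B="\<bar>H\<bar>"], use B in \<open>auto simp: abs_mult indicator_def\<close>)
  have "\<bar>expectation g - a\<bar> = \<bar>expectation (\<lambda>x. g x - a)\<bar>"
    using ig by (simp add: prob_space)
  also have "\<dots> \<le> expectation (\<lambda>x. \<bar>g x - a\<bar>)" by (rule integral_abs_bound)
  also have "\<dots> \<le> expectation (\<lambda>x. \<epsilon> + H * indicator B x)"
  proof (rule integral_mono)
    fix x assume x: "x \<in> space M"
    show "\<bar>g x - a\<bar> \<le> \<epsilon> + H * indicator B x"
      using near[of x] g(2)[OF x] a x by (cases "x \<in> B") auto
  qed (use ig Bochner_Integration.integrable_add[OF iB] in auto)
  also have "\<dots> = \<epsilon> + H * prob B"
    unfolding Bochner_Integration.integral_add[OF iB] using B by (simp add: prob_space)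
  finally show ?thesis .
qed

text \<open>A law of large numbers for triangular arrays. The averages \<open>\<tau>'\<close> and
  \<open>\<sigma>'\<close> need not converge, so a persistent gap is followed along a subsequence on
  which both converge weakly; there both compared costs are close to the cost at the limit. The
  averages are specified by their integrals of continuous functions, which is all that the weak
  topology sees.\<close>

theorem expected_mean_field_cost_tendsto:
  fixes c :: "'u::euclidean_space \<Rightarrow> 'v1::euclidean_space \<Rightarrow> 'v2::euclidean_space \<Rightarrow> real"
    and U2 :: "'u2::euclidean_space set"
  assumes U1: "compact U1" and U2: "compact U2"
    and \<Xi>1: "continuous_map (weak_topology U1) (top_of_set V1) \<Xi>1"
    and \<Xi>2: "continuous_map (weak_topology U2) (top_of_set V2) \<Xi>2"
    and c: "continuous_on (U1 \<times> V1 \<times> V2) (\<lambda>(u, v1, v2). c u v1 v2)"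
    and H: "\<And>\<tau> \<sigma>. \<tau> \<in> prob_measures U1 \<Longrightarrow> \<sigma> \<in> prob_measures U2 \<Longrightarrow>
        0 \<le> mean_field_cost \<Xi>1 \<Xi>2 c \<tau> \<sigma> \<and> mean_field_cost \<Xi>1 \<Xi>2 c \<tau> \<sigma> \<le> H"
    and N: "\<And>n. 0 < N1 n" "\<And>n. 0 < N2 n" "filterlim N1 at_top sequentially" "filterlim N2 at_top sequentially"
    and \<tau>: "\<And>n k. \<tau> n k \<in> prob_measures U1" and \<sigma>: "\<And>n k. \<sigma> n k \<in> prob_measures U2"
    and \<tau>': "\<And>n. \<tau>' n \<in> prob_measures U1" and \<sigma>': "\<And>n. \<sigma>' n \<in> prob_measures U2"
    and avg1: "\<And>n f. continuous_on U1 f \<Longrightarrow> integral\<^sup>L (\<tau>' n) f = (\<Sum>k<N1 n. integral\<^sup>L (\<tau> n k) f) / real (N1 n)"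
    and avg2: "\<And>n f. continuous_on U2 f \<Longrightarrow> integral\<^sup>L (\<sigma>' n) f = (\<Sum>k<N2 n. integral\<^sup>L (\<sigma> n k) f) / real (N2 n)"
    and meas: "\<And>n. (\<lambda>(u1, u2). mean_field_cost \<Xi>1 \<Xi>2 c (empirical U1 (N1 n) u1) (empirical U2 (N2 n) u2))
      \<in> borel_measurable (PiM {..<N1 n} (\<lambda>_. borel_on U1) \<Otimes>\<^sub>M PiM {..<N2 n} (\<lambda>_. borel_on U2))"
  shows "(\<lambda>n. (\<integral>(u1, u2). mean_field_cost \<Xi>1 \<Xi>2 c (empirical U1 (N1 n) u1) (empirical U2 (N2 n) u2)
            \<partial>(PiM {..<N1 n} (\<tau> n) \<Otimes>\<^sub>M PiM {..<N2 n} (\<sigma> n)))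
          - mean_field_cost \<Xi>1 \<Xi>2 c (\<tau>' n) (\<sigma>' n)) \<longlonglongrightarrow> 0"
proof (rule ccontr)
  let ?\<Phi> = "mean_field_cost \<Xi>1 \<Xi>2 c"
  let ?P = "\<lambda>n. PiM {..<N1 n} (\<tau> n) \<Otimes>\<^sub>M PiM {..<N2 n} (\<sigma> n)"
  let ?g = "\<lambda>n. \<lambda>(u1, u2). ?\<Phi> (empirical U1 (N1 n) u1) (empirical U2 (N2 n) u2)"
  define D where "D n = integral\<^sup>L (?P n) (?g n) - ?\<Phi> (\<tau>' n) (\<sigma>' n)" for n
  assume "\<not> ?thesis"
  then have "\<not> D \<longlonglongrightarrow> 0" unfolding D_def by simp
  then obtain e where e: "0 < e" and inf: "\<not> (\<exists>m. \<forall>n\<ge>m. \<bar>D n\<bar> < e)"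
    unfolding LIMSEQ_iff by auto
  have "infinite {n. e \<le> \<bar>D n\<bar>}"
    unfolding infinite_nat_iff_unbounded_le using inf by (simp add: not_less)
  from infinite_enumerate[OF this] obtain r0 where r0: "strict_mono (r0::nat \<Rightarrow> nat)" "\<And>n. e \<le> \<bar>D (r0 n)\<bar>"
    by auto
  \<comment> \<open>Two successive extractions, one for each team, inside the subsequence on which
    the gap is at least \<open>e\<close>.\<close>
  obtain r1 \<tau>s where r1: "strict_mono (r1 :: nat \<Rightarrow> nat)" and \<tau>s: "\<tau>s \<in> prob_measures U1"
    and lim1: "\<And>f :: 'u \<Rightarrow> real. continuous_on U1 f \<Longrightarrow> (\<lambda>n. integral\<^sup>L (\<tau>' (r0 (r1 n))) f) \<longlonglongrightarrow> integral\<^sup>L \<tau>s f"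
    by (rule prob_measures_sequentially_compact[OF U1, of "\<lambda>n. \<tau>' (r0 n)"]) (rule \<tau>', rule that)
  obtain r2 \<sigma>s where r2: "strict_mono (r2 :: nat \<Rightarrow> nat)" and \<sigma>s: "\<sigma>s \<in> prob_measures U2"
    and lim2: "\<And>f :: 'u2 \<Rightarrow> real. continuous_on U2 f \<Longrightarrow> (\<lambda>n. integral\<^sup>L (\<sigma>' (r0 (r1 (r2 n)))) f) \<longlonglongrightarrow> integral\<^sup>L \<sigma>s f"
    by (rule prob_measures_sequentially_compact[OF U2, of "\<lambda>n. \<sigma>' (r0 (r1 n))"]) (rule \<sigma>', rule that)
  define r where "r n = r0 (r1 (r2 n))" for n
  have r: "strict_mono r"
    using strict_mono_o[OF r0(1) strict_mono_o[OF r1 r2]] by (simp add: r_def[abs_def] comp_def)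
  have lim1: "(\<lambda>n. integral\<^sup>L (\<tau>' (r n)) f) \<longlonglongrightarrow> integral\<^sup>L \<tau>s f" if "continuous_on U1 f" for f :: "'u \<Rightarrow> real"
    using LIMSEQ_subseq_LIMSEQ[OF lim1[OF that] r2] by (simp add: r_def comp_def)
  have lim2: "(\<lambda>n. integral\<^sup>L (\<sigma>' (r n)) f) \<longlonglongrightarrow> integral\<^sup>L \<sigma>s f" if "continuous_on U2 f" for f :: "'u2 \<Rightarrow> real"
    using lim2[OF that] by (simp add: r_def)
  \<comment> \<open>Three errors of at most \<open>e / 4\<close> will add up to less than
    \<open>e\<close>: the average laws against their limit, the samples on the good event, and the
    contribution of the bad event.\<close>
  have e4: "0 < e / 4" using e by simp
  obtain F1 F2 and \<delta> :: real where F: "finite F1" "finite F2" and \<delta>: "0 < \<delta>"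
    and F1: "\<And>f. f \<in> F1 \<Longrightarrow> continuous_on U1 f" and F2: "\<And>f. f \<in> F2 \<Longrightarrow> continuous_on U2 f"
    and near: "\<And>\<tau>' \<sigma>'. \<tau>' \<in> prob_measures U1 \<Longrightarrow> \<sigma>' \<in> prob_measures U2 \<Longrightarrow>
      (\<And>f. f \<in> F1 \<Longrightarrow> \<bar>integral\<^sup>L \<tau>' f - integral\<^sup>L \<tau>s f\<bar> < \<delta>) \<Longrightarrow>
      (\<And>f. f \<in> F2 \<Longrightarrow> \<bar>integral\<^sup>L \<sigma>' f - integral\<^sup>L \<sigma>s f\<bar> < \<delta>) \<Longrightarrow>
      \<bar>?\<Phi> \<tau>' \<sigma>' - ?\<Phi> \<tau>s \<sigma>s\<bar> < e / 4"
  proof (rule mean_field_cost_neighbourhood[OF U1 \<Xi>1 \<Xi>2 c \<tau>s \<sigma>s e4], goal_cases)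
    case (1 F1 F2 \<delta>)
    show ?case by (rule that[OF 1(2-6) 1(8)])
  qed
  have bounded1: "\<exists>B>0. \<forall>u\<in>U1. \<bar>f u\<bar> \<le> B" if "continuous_on U1 f" for f :: "'u \<Rightarrow> real"
    using compact_imp_bounded[OF compact_continuous_image[OF that U1]]
    by (auto simp: bounded_pos)
  have bounded2: "\<exists>B>0. \<forall>u\<in>U2. \<bar>f u\<bar> \<le> B" if "continuous_on U2 f" for f :: "'u2 \<Rightarrow> real"
    using compact_imp_bounded[OF compact_continuous_image[OF that U2]]
    by (auto simp: bounded_pos)
  \<comment> \<open>The radius \<open>\<delta>\<close> is split: half for the sample mean against
    the average law, half for the average law against its limit.\<close>
  define E1 where "E1 n f = {u \<in> space (PiM {..<N1 n} (\<tau> n)).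
      \<delta>/2 \<le> \<bar>(\<Sum>k<N1 n. f (u k)) / real (N1 n) - (\<Sum>k<N1 n. integral\<^sup>L (\<tau> n k) f) / real (N1 n)\<bar>}" for n f
  define E2 where "E2 n f = {u \<in> space (PiM {..<N2 n} (\<sigma> n)).
      \<delta>/2 \<le> \<bar>(\<Sum>k<N2 n. f (u k)) / real (N2 n) - (\<Sum>k<N2 n. integral\<^sup>L (\<sigma> n k) f) / real (N2 n)\<bar>}" for n f
  have exp0: "(\<lambda>n. 2 * exp (- a * real (N n))) \<longlonglongrightarrow> 0"
    if "filterlim N at_top sequentially" "0 < a" for a :: real and N :: "nat \<Rightarrow> nat"
  proof -
    have "filterlim (\<lambda>n. real (N n)) at_top sequentially"
      by (rule filterlim_compose[OF filterlim_real_sequentially that(1)])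
    then have "filterlim (\<lambda>n. - a * real (N n)) at_bot sequentially"
      by (intro filterlim_tendsto_neg_mult_at_bot[OF tendsto_const]) (use that in auto)
    then have "(\<lambda>n. exp (- a * real (N n))) \<longlonglongrightarrow> 0" by (rule filterlim_compose[OF exp_at_bot])
    from tendsto_mult_right_zero[OF this, of 2] show ?thesis by simp
  qed
  have m1: "(\<lambda>n. measure (PiM {..<N1 n} (\<tau> n)) (E1 n f)) \<longlonglongrightarrow> 0" if f: "f \<in> F1" for f
  proof -
    obtain B where B: "0 < B" "\<forall>u\<in>U1. \<bar>f u\<bar> \<le> B" using bounded1[OF F1[OF f]] by blast
    have le: "measure (PiM {..<N1 n} (\<tau> n)) (E1 n f) \<le> 2 * exp (- ((\<delta>/2)\<^sup>2 / (2 * B\<^sup>2)) * real (N1 n))" for n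
      unfolding E1_def
      by (rule PiM_average_concentration[OF N(1) \<tau> measurable_continuous_borel_on[OF F1[OF f]] B(1)])
         (use B \<delta> in auto)
    show ?thesis
      by (rule tendsto_sandwich[OF _ _ tendsto_const exp0[OF N(3), of "(\<delta>/2)\<^sup>2 / (2 * B\<^sup>2)"]])
         (use le \<delta> B in auto)
  qed
  have m2: "(\<lambda>n. measure (PiM {..<N2 n} (\<sigma> n)) (E2 n f)) \<longlonglongrightarrow> 0" if f: "f \<in> F2" for f
  proof -
    obtain B where B: "0 < B" "\<forall>u\<in>U2. \<bar>f u\<bar> \<le> B" using bounded2[OF F2[OF f]] by blast
    have le: "measure (PiM {..<N2 n} (\<sigma> n)) (E2 n f) \<le> 2 * exp (- ((\<delta>/2)\<^sup>2 / (2 * B\<^sup>2)) * real (N2 n))" for n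
      unfolding E2_def
      by (rule PiM_average_concentration[OF N(2) \<sigma> measurable_continuous_borel_on[OF F2[OF f]] B(1)])
         (use B \<delta> in auto)
    show ?thesis
      by (rule tendsto_sandwich[OF _ _ tendsto_const exp0[OF N(4), of "(\<delta>/2)\<^sup>2 / (2 * B\<^sup>2)"]])
         (use le \<delta> B in auto)
  qed
  define p where "p n = (\<Sum>f\<in>F1. measure (PiM {..<N1 n} (\<tau> n)) (E1 n f))
      + (\<Sum>f\<in>F2. measure (PiM {..<N2 n} (\<sigma> n)) (E2 n f))" for n
  have "p \<longlonglongrightarrow> 0" unfolding p_def
    by (intro tendsto_add_zero tendsto_null_sum m1 m2)
  then have "(\<lambda>n. H * p (r n)) \<longlonglongrightarrow> 0"
    using tendsto_mult_right_zero[OF LIMSEQ_subseq_LIMSEQ[OF _ r], of p] by (simp add: comp_def)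
  then have ev: "eventually (\<lambda>n. H * p (r n) < e / 4) sequentially" using e4 by (rule order_tendstoD)
  have ev1: "eventually (\<lambda>n. \<forall>f\<in>F1. \<bar>integral\<^sup>L (\<tau>' (r n)) f - integral\<^sup>L \<tau>s f\<bar> < \<delta> / 2) sequentially"
  proof (rule eventually_ball_finite[OF F(1)], rule ballI)
    fix f assume "f \<in> F1"
    from tendstoD[OF lim1[OF F1[OF this]], of "\<delta>/2"] \<delta>
    show "eventually (\<lambda>n. \<bar>integral\<^sup>L (\<tau>' (r n)) f - integral\<^sup>L \<tau>s f\<bar> < \<delta> / 2) sequentially"
      by (simp add: dist_real_def)
  qed
  have ev2: "eventually (\<lambda>n. \<forall>f\<in>F2. \<bar>integral\<^sup>L (\<sigma>' (r n)) f - integral\<^sup>L \<sigma>s f\<bar> < \<delta> / 2) sequentially"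
  proof (rule eventually_ball_finite[OF F(2)], rule ballI)
    fix f assume "f \<in> F2"
    from tendstoD[OF lim2[OF F2[OF this]], of "\<delta>/2"] \<delta>
    show "eventually (\<lambda>n. \<bar>integral\<^sup>L (\<sigma>' (r n)) f - integral\<^sup>L \<sigma>s f\<bar> < \<delta> / 2) sequentially"
      by (simp add: dist_real_def)
  qed
  \<comment> \<open>A single index at which all estimates hold is enough for the
    contradiction.\<close>
  obtain m where m: "H * p (r m) < e / 4"
    and m1: "\<And>f. f \<in> F1 \<Longrightarrow> \<bar>integral\<^sup>L (\<tau>' (r m)) f - integral\<^sup>L \<tau>s f\<bar> < \<delta> / 2"
    and m2: "\<And>f. f \<in> F2 \<Longrightarrow> \<bar>integral\<^sup>L (\<sigma>' (r m)) f - integral\<^sup>L \<sigma>s f\<bar> < \<delta> / 2"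
    using eventually_conj[OF ev eventually_conj[OF ev1 ev2]]
    by (auto dest: eventually_happens)
  define n where "n = r m"
  note m = m[folded n_def] m1[folded n_def] m2[folded n_def]
  have \<Phi>n: "\<bar>?\<Phi> (\<tau>' n) (\<sigma>' n) - ?\<Phi> \<tau>s \<sigma>s\<bar> < e / 4"
  proof (rule near[OF \<tau>' \<sigma>'])
    show "\<bar>integral\<^sup>L (\<tau>' n) f - integral\<^sup>L \<tau>s f\<bar> < \<delta>" if "f \<in> F1" for f using m(2)[OF that] \<delta> by linarith
    show "\<bar>integral\<^sup>L (\<sigma>' n) f - integral\<^sup>L \<sigma>s f\<bar> < \<delta>" if "f \<in> F2" for f using m(3)[OF that] \<delta> by linarith
  qed
  interpret \<tau>: prob_space "\<tau> n k" for k using prob_measuresD(1)[OF \<tau>] .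
  interpret \<sigma>: prob_space "\<sigma> n k" for k using prob_measuresD(1)[OF \<sigma>] .
  interpret A: product_prob_space "\<tau> n" "{..<N1 n}" by standard
  interpret B: product_prob_space "\<sigma> n" "{..<N2 n}" by standard
  interpret P: pair_prob_space "PiM {..<N1 n} (\<tau> n)" "PiM {..<N2 n} (\<sigma> n)" ..
  have sA: "sets (PiM {..<N1 n} (\<tau> n)) = sets (PiM {..<N1 n} (\<lambda>_. borel_on U1))"
    by (rule sets_PiM_cong) (auto simp: prob_measuresD(2)[OF \<tau>])
  have sB: "sets (PiM {..<N2 n} (\<sigma> n)) = sets (PiM {..<N2 n} (\<lambda>_. borel_on U2))"
    by (rule sets_PiM_cong) (auto simp: prob_measuresD(2)[OF \<sigma>])
  have fm1: "f \<in> borel_measurable (\<tau> n k)" if "f \<in> F1" for f k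
    using measurable_continuous_borel_on[OF F1[OF that]] by (simp cong: measurable_cong_sets add: prob_measuresD(2)[OF \<tau>])
  have fm2: "f \<in> borel_measurable (\<sigma> n k)" if "f \<in> F2" for f k
    using measurable_continuous_borel_on[OF F2[OF that]] by (simp cong: measurable_cong_sets add: prob_measuresD(2)[OF \<sigma>])
  have E1[measurable]: "E1 n f \<in> sets (PiM {..<N1 n} (\<tau> n))" if "f \<in> F1" for f
    unfolding E1_def using fm1[OF that] by measurable
  have E2[measurable]: "E2 n f \<in> sets (PiM {..<N2 n} (\<sigma> n))" if "f \<in> F2" for f
    unfolding E2_def using fm2[OF that] by measurable
  define Bad where "Bad = (\<Union>f\<in>F1. E1 n f \<times> space (PiM {..<N2 n} (\<sigma> n))) \<union>
      (\<Union>f\<in>F2. space (PiM {..<N1 n} (\<tau> n)) \<times> E2 n f)"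
  have R1: "E1 n f \<times> space (PiM {..<N2 n} (\<sigma> n)) \<in> sets (?P n)" if "f \<in> F1" for f
    using E1[OF that] by auto
  have R2: "space (PiM {..<N1 n} (\<tau> n)) \<times> E2 n f \<in> sets (?P n)" if "f \<in> F2" for f
    using E2[OF that] by auto
  have U1s: "(\<Union>f\<in>F1. E1 n f \<times> space (PiM {..<N2 n} (\<sigma> n))) \<in> sets (?P n)"
    using R1 F(1) by (intro sets.finite_UN) auto
  have U2s: "(\<Union>f\<in>F2. space (PiM {..<N1 n} (\<tau> n)) \<times> E2 n f) \<in> sets (?P n)"
    using R2 F(2) by (intro sets.finite_UN) auto
  have Bad: "Bad \<in> sets (?P n)" unfolding Bad_def using U1s U2s by (rule sets.Un)
  \<comment> \<open>Union bound; each rectangle has the probability of its nontrivial side.\<close>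
  have mBad: "measure (?P n) Bad \<le> p n"
  proof -
    have "measure (?P n) Bad \<le> measure (?P n) (\<Union>f\<in>F1. E1 n f \<times> space (PiM {..<N2 n} (\<sigma> n)))
        + measure (?P n) (\<Union>f\<in>F2. space (PiM {..<N1 n} (\<tau> n)) \<times> E2 n f)"
      unfolding Bad_def by (rule measure_Un_le[OF U1s U2s])
    also have "\<dots> \<le> (\<Sum>f\<in>F1. measure (?P n) (E1 n f \<times> space (PiM {..<N2 n} (\<sigma> n))))
        + (\<Sum>f\<in>F2. measure (?P n) (space (PiM {..<N1 n} (\<tau> n)) \<times> E2 n f))"
      by (intro add_mono measure_UNION_le F R1 R2)
    also have "\<dots> = p n" unfolding p_def
    proof (intro arg_cong2[where f="(+)"] sum.cong refl)
      fix f assume "f \<in> F1"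
      then show "measure (?P n) (E1 n f \<times> space (PiM {..<N2 n} (\<sigma> n))) = measure (PiM {..<N1 n} (\<tau> n)) (E1 n f)"
        by (simp add: measure_def B.P.emeasure_pair_measure_Times E1 B.P.emeasure_space_1)
    next
      fix f assume "f \<in> F2"
      then show "measure (?P n) (space (PiM {..<N1 n} (\<tau> n)) \<times> E2 n f) = measure (PiM {..<N2 n} (\<sigma> n)) (E2 n f)"
        by (simp add: measure_def B.P.emeasure_pair_measure_Times E2 A.P.emeasure_space_1)
    qed
    finally show ?thesis .
  qed
  have emp1: "empirical U1 (N1 n) u \<in> prob_measures U1"
    "continuous_on U1 f \<Longrightarrow> integral\<^sup>L (empirical U1 (N1 n) u) f = (\<Sum>k<N1 n. f (u k)) / real (N1 n)"
    if "u \<in> space (PiM {..<N1 n} (\<tau> n))" for u and f :: "'u \<Rightarrow> real"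
  proof -
    have "u k \<in> U1" if "k < N1 n" for k
      using that \<open>u \<in> space _\<close> prob_measuresD(3)[OF \<tau>, of n k] by (auto simp: space_PiM PiE_def Pi_def)
    then show "empirical U1 (N1 n) u \<in> prob_measures U1"
      "continuous_on U1 f \<Longrightarrow> integral\<^sup>L (empirical U1 (N1 n) u) f = (\<Sum>k<N1 n. f (u k)) / real (N1 n)"
      by (auto intro!: empirical_in_prob_measures integral_empirical measurable_continuous_borel_on N)
  qed
  have emp2: "empirical U2 (N2 n) u \<in> prob_measures U2"
    "continuous_on U2 f \<Longrightarrow> integral\<^sup>L (empirical U2 (N2 n) u) f = (\<Sum>k<N2 n. f (u k)) / real (N2 n)"
    if "u \<in> space (PiM {..<N2 n} (\<sigma> n))" for u and f :: "'u2 \<Rightarrow> real"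
  proof -
    have "u k \<in> U2" if "k < N2 n" for k
      using that \<open>u \<in> space _\<close> prob_measuresD(3)[OF \<sigma>, of n k] by (auto simp: space_PiM PiE_def Pi_def)
    then show "empirical U2 (N2 n) u \<in> prob_measures U2"
      "continuous_on U2 f \<Longrightarrow> integral\<^sup>L (empirical U2 (N2 n) u) f = (\<Sum>k<N2 n. f (u k)) / real (N2 n)"
      by (auto intro!: empirical_in_prob_measures integral_empirical measurable_continuous_borel_on N)
  qed
  have "\<bar>integral\<^sup>L (?P n) (?g n) - ?\<Phi> \<tau>s \<sigma>s\<bar> \<le> e / 4 + H * measure (?P n) Bad"
  proof (rule P.expectation_near_const[OF _ _ _ _ _ Bad])
    show "?g n \<in> borel_measurable (?P n)"
      using meas[of n] by (simp cong: measurable_cong_sets add: sA sB sets_pair_measure_cong[OF sA sB])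
    show "0 \<le> ?g n x \<and> ?g n x \<le> H" if "x \<in> space (?P n)" for x
      using that H emp1(1) emp2(1) by (auto simp: space_pair_measure)
    show "0 \<le> ?\<Phi> \<tau>s \<sigma>s" "?\<Phi> \<tau>s \<sigma>s \<le> H" using H[OF \<tau>s \<sigma>s] by auto
    show "0 \<le> e / 4" using e by simp
    fix x assume x: "x \<in> space (?P n) - Bad"
    obtain u1 u2 where xu: "x = (u1, u2)" "u1 \<in> space (PiM {..<N1 n} (\<tau> n))" "u2 \<in> space (PiM {..<N2 n} (\<sigma> n))"
      using x by (auto simp: space_pair_measure)
    have "\<bar>?\<Phi> (empirical U1 (N1 n) u1) (empirical U2 (N2 n) u2) - ?\<Phi> \<tau>s \<sigma>s\<bar> < e / 4"
    proof (rule near[OF emp1(1)[OF xu(2)] emp2(1)[OF xu(3)]])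
      fix f assume f: "f \<in> F1"
      have "u1 \<notin> E1 n f" using x xu f unfolding Bad_def by blast
      then have "\<bar>integral\<^sup>L (empirical U1 (N1 n) u1) f - integral\<^sup>L (\<tau>' n) f\<bar> < \<delta> / 2"
        using xu(2) by (simp add: E1_def emp1(2)[OF xu(2) F1[OF f]] avg1[OF F1[OF f]])
      then show "\<bar>integral\<^sup>L (empirical U1 (N1 n) u1) f - integral\<^sup>L \<tau>s f\<bar> < \<delta>"
        using m(2)[OF f] by linarith
    next
      fix f assume f: "f \<in> F2"
      have "u2 \<notin> E2 n f" using x xu f unfolding Bad_def by blast
      then have "\<bar>integral\<^sup>L (empirical U2 (N2 n) u2) f - integral\<^sup>L (\<sigma>' n) f\<bar> < \<delta> / 2"
        using xu(3) by (simp add: E2_def emp2(2)[OF xu(3) F2[OF f]] avg2[OF F2[OF f]])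
      then show "\<bar>integral\<^sup>L (empirical U2 (N2 n) u2) f - integral\<^sup>L \<sigma>s f\<bar> < \<delta>"
        using m(3)[OF f] by linarith
    qed
    then show "\<bar>?g n x - ?\<Phi> \<tau>s \<sigma>s\<bar> \<le> e / 4" using xu by simp
  qed
  also have "\<dots> \<le> e / 4 + H * p n"
    using mBad H[OF \<tau>s \<sigma>s] by (intro add_left_mono mult_left_mono) auto
  finally have "\<bar>D n\<bar> < e" using \<Phi>n m(1) unfolding D_def by linarith
  moreover have "e \<le> \<bar>D n\<bar>" unfolding n_def r_def by (rule r0(2))
  ultimately show False by simp
qed

section \<open>Products of probability kernels\<close>

text \<open>The locale of product probability spaces wants a probability measure at every index.
  Filling up with point masses outside \<open>I\<close> leaves the product over \<open>I\<close>
  unchanged.\<close>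

lemma PiM_prob_extension:
  assumes "\<And>i. i \<in> I \<Longrightarrow> prob_space (M i)"
  obtains M' where "product_prob_space M'" "\<And>i. i \<in> I \<Longrightarrow> M' i = M i" "PiM I M' = PiM I M"
proof
  let ?M = "\<lambda>i. if i \<in> I then M i else return (count_space UNIV) undefined"
  interpret M': prob_space "?M i" for i using assms by (auto intro: prob_space_return)
  show "product_prob_space ?M" ..
  show "PiM I ?M = PiM I M" by (rule PiM_cong) auto
qed simp

lemma emeasure_PiM_PiE:
  assumes "finite I" and "\<And>i. i \<in> I \<Longrightarrow> prob_space (M i)" and A: "\<And>i. i \<in> I \<Longrightarrow> A i \<in> sets (M i)"
  shows "emeasure (PiM I M) (PiE I A) = (\<Prod>i\<in>I. emeasure (M i) (A i))"
proof -
  obtain M' where "product_prob_space M'" and M': "\<And>i. i \<in> I \<Longrightarrow> M' i = M i" and eq: "PiM I M' = PiM I M"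
    using PiM_prob_extension[of I M] assms(2) by blast
  interpret product_prob_space M' by fact
  show ?thesis unfolding eq[symmetric] using assms(1) A by (subst emeasure_PiM) (auto simp: M')
qed

lemma PiM_eqI_prob:
  assumes "finite I" and "\<And>i. i \<in> I \<Longrightarrow> prob_space (M i)" and sets_K: "sets K = sets (PiM I M)"
    and eq: "\<And>A. (\<And>i. i \<in> I \<Longrightarrow> A i \<in> sets (M i)) \<Longrightarrow> emeasure K (PiE I A) = (\<Prod>i\<in>I. emeasure (M i) (A i))"
  shows "K = PiM I M"
proof -
  obtain M' where "product_prob_space M'" and M': "\<And>i. i \<in> I \<Longrightarrow> M' i = M i" and eq': "PiM I M' = PiM I M"
    using PiM_prob_extension[of I M] assms(2) by blast
  interpret product_prob_space M' by fact
  have "K = PiM I M'"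
  proof (rule PiM_eqI[OF assms(1)])
    show "sets K = sets (PiM I M')" unfolding eq' by (rule sets_K)
    fix A assume "\<And>i. i \<in> I \<Longrightarrow> A i \<in> sets (M' i)"
    then have "\<And>i. i \<in> I \<Longrightarrow> A i \<in> sets (M i)" by (simp add: M')
    from eq[OF this] show "emeasure K (PiE I A) = (\<Prod>i\<in>I. emeasure (M' i) (A i))" by (simp add: M')
  qed
  then show ?thesis by (simp add: eq')
qed

lemma nn_integral_PiM_prod:
  assumes "finite I" and "\<And>i. i \<in> I \<Longrightarrow> prob_space (M i)"
    and f: "\<And>i. i \<in> I \<Longrightarrow> f i \<in> borel_measurable (M i)"
  shows "(\<integral>\<^sup>+x. (\<Prod>i\<in>I. f i (x i)) \<partial>PiM I M) = (\<Prod>i\<in>I. integral\<^sup>N (M i) (f i))"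
proof -
  obtain M' where "product_prob_space M'" and M': "\<And>i. i \<in> I \<Longrightarrow> M' i = M i" and eq: "PiM I M' = PiM I M"
    using PiM_prob_extension[of I M] assms(2) by blast
  interpret product_prob_space M' by fact
  show ?thesis unfolding eq[symmetric] using assms(1) f by (subst product_nn_integral_prod) (auto simp: M')
qed

section \<open>Kernels and iterated integrals\<close>

lemma kernelD:
  assumes "\<kappa> \<in> M \<rightarrow>\<^sub>M prob_algebra N" "x \<in> space M"
  shows "prob_space (\<kappa> x)" "sets (\<kappa> x) = sets N" "space (\<kappa> x) = space N"
  using measurable_space[OF assms] sets_eq_imp_space_eq[of "\<kappa> x" N] by (auto simp: space_prob_algebra)

text \<open>On boxes, which generate and are closed under intersection, the mass of the product is a
  finite product of measurable functions of \<open>x\<close>.\<close>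

lemma measurable_PiM_kernel:
  assumes I: "finite I" and \<kappa>: "\<And>i. i \<in> I \<Longrightarrow> \<kappa> i \<in> M \<rightarrow>\<^sub>M prob_algebra (N i)"
  shows "(\<lambda>x. PiM I (\<lambda>i. \<kappa> i x)) \<in> M \<rightarrow>\<^sub>M prob_algebra (PiM I N)"
proof (rule measurable_prob_algebra_generated[OF sets_PiM Int_stable_prod_algebra prod_algebra_sets_into_space])
  fix x assume x: "x \<in> space M"
  show "prob_space (PiM I (\<lambda>i. \<kappa> i x))" by (rule prob_space_PiM) (rule kernelD(1)[OF \<kappa> x])
  show "sets (PiM I (\<lambda>i. \<kappa> i x)) = sets (PiM I N)" by (rule sets_PiM_cong) (auto simp: kernelD(2)[OF \<kappa> x])
next
  fix A assume "A \<in> prod_algebra I N"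
  then obtain X where X: "A = PiE I X" "\<And>i. i \<in> I \<Longrightarrow> X i \<in> sets (N i)"
    unfolding prod_algebra_eq_finite[OF I] by auto
  have "(\<lambda>x. \<Prod>i\<in>I. emeasure (\<kappa> i x) (X i)) \<in> borel_measurable M"
    by (intro borel_measurable_prod_ennreal measurable_emeasure_kernel[OF measurable_prob_algebraD[OF \<kappa>]] X(2))
  moreover have "emeasure (PiM I (\<lambda>i. \<kappa> i x)) A = (\<Prod>i\<in>I. emeasure (\<kappa> i x) (X i))" if x: "x \<in> space M" for x
    unfolding X(1) by (rule emeasure_PiM_PiE[OF I]) (auto simp: kernelD[OF \<kappa> x] X(2))
  ultimately show "(\<lambda>x. emeasure (PiM I (\<lambda>i. \<kappa> i x)) A) \<in> borel_measurable M"
    by (subst measurable_cong) auto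
qed

lemma measurable_PiM_kernel_components:
  assumes I: "finite I" and \<kappa>: "\<And>i. i \<in> I \<Longrightarrow> \<kappa> i \<in> M i \<rightarrow>\<^sub>M prob_algebra (N i)"
  shows "(\<lambda>x. PiM I (\<lambda>i. \<kappa> i (x i))) \<in> PiM I M \<rightarrow>\<^sub>M prob_algebra (PiM I N)"
proof (rule measurable_PiM_kernel[OF I])
  fix i assume "i \<in> I"
  show "(\<lambda>x. \<kappa> i (x i)) \<in> PiM I M \<rightarrow>\<^sub>M prob_algebra (N i)"
    using measurable_component_singleton[OF \<open>i \<in> I\<close>] \<kappa>[OF \<open>i \<in> I\<close>] by (rule measurable_compose)
qed

text \<open>Independent inputs passed through separate kernels give independent outputs: on a box
  the integrand factors over the coordinates. The inputs will be the observations in one use and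
  randomly drawn policies in the other.\<close>

lemma bind_PiM_kernel:
  assumes I: "finite I" and M: "\<And>i. i \<in> I \<Longrightarrow> prob_space (M i)"
    and \<kappa>: "\<And>i. i \<in> I \<Longrightarrow> \<kappa> i \<in> M i \<rightarrow>\<^sub>M prob_algebra (N i)"
  shows "PiM I M \<bind> (\<lambda>x. PiM I (\<lambda>i. \<kappa> i (x i))) = PiM I (\<lambda>i. M i \<bind> \<kappa> i)"
proof (rule PiM_eqI_prob[OF I])
  have Mp: "M i \<in> space (prob_algebra (M i))" if "i \<in> I" for i
    using M[OF that] by (simp add: space_prob_algebra)
  have Pp: "PiM I M \<in> space (prob_algebra (PiM I M))"
    using prob_space_PiM[of I M] M by (simp add: space_prob_algebra)
  note k = measurable_PiM_kernel_components[OF I \<kappa>]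
  show "prob_space (M i \<bind> \<kappa> i)" if "i \<in> I" for i
    by (rule prob_space_bind'[OF Mp[OF that] \<kappa>[OF that]])
  have sb: "sets (M i \<bind> \<kappa> i) = sets (N i)" if "i \<in> I" for i
    by (rule sets_bind'[OF Mp[OF that] \<kappa>[OF that]])
  show "sets (PiM I M \<bind> (\<lambda>x. PiM I (\<lambda>i. \<kappa> i (x i)))) = sets (PiM I (\<lambda>i. M i \<bind> \<kappa> i))"
    using sets_bind'[OF Pp k] sets_PiM_cong[of I I "\<lambda>i. M i \<bind> \<kappa> i" N] sb by simp
  fix A assume "\<And>i. i \<in> I \<Longrightarrow> A i \<in> sets (M i \<bind> \<kappa> i)"
  then have A: "\<And>i. i \<in> I \<Longrightarrow> A i \<in> sets (N i)" using sb by simp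
  have "emeasure (PiM I M \<bind> (\<lambda>x. PiM I (\<lambda>i. \<kappa> i (x i)))) (PiE I A)
      = (\<integral>\<^sup>+x. emeasure (PiM I (\<lambda>i. \<kappa> i (x i))) (PiE I A) \<partial>PiM I M)"
    by (rule emeasure_bind_prob_algebra[OF Pp k]) (auto intro!: sets_PiM_I_finite I A)
  also have "\<dots> = (\<integral>\<^sup>+x. (\<Prod>i\<in>I. emeasure (\<kappa> i (x i)) (A i)) \<partial>PiM I M)"
  proof (rule nn_integral_cong)
    fix x assume "x \<in> space (PiM I M)"
    then have x: "x i \<in> space (M i)" if "i \<in> I" for i using that by (auto simp: space_PiM PiE_def Pi_def)
    show "emeasure (PiM I (\<lambda>i. \<kappa> i (x i))) (PiE I A) = (\<Prod>i\<in>I. emeasure (\<kappa> i (x i)) (A i))"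
      by (rule emeasure_PiM_PiE[OF I]) (auto simp: kernelD[OF \<kappa> x] A)
  qed
  also have "\<dots> = (\<Prod>i\<in>I. \<integral>\<^sup>+x. emeasure (\<kappa> i x) (A i) \<partial>M i)"
    by (rule nn_integral_PiM_prod[OF I M]) (auto intro!: measurable_emeasure_kernel[OF measurable_prob_algebraD[OF \<kappa>]] A)
  also have "\<dots> = (\<Prod>i\<in>I. emeasure (M i \<bind> \<kappa> i) (A i))"
    by (rule prod.cong[OF refl], rule emeasure_bind_prob_algebra[symmetric, OF Mp \<kappa> A]) auto
  finally show "emeasure (PiM I M \<bind> (\<lambda>x. PiM I (\<lambda>i. \<kappa> i (x i)))) (PiE I A)
      = (\<Prod>i\<in>I. emeasure (M i \<bind> \<kappa> i) (A i))" .
qed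

lemma nn_integral_prob_bind:
  assumes "a \<in> space (prob_algebra M)" "\<kappa> \<in> M \<rightarrow>\<^sub>M prob_algebra N" "f \<in> borel_measurable N"
  shows "(\<integral>\<^sup>+u. f u \<partial>(a \<bind> \<kappa>)) = (\<integral>\<^sup>+x. \<integral>\<^sup>+u. f u \<partial>\<kappa> x \<partial>a)"
proof (rule nn_integral_bind[OF assms(3)])
  show "\<kappa> \<in> a \<rightarrow>\<^sub>M subprob_algebra N"
    using assms(1) measurable_prob_algebraD[OF assms(2)]
    by (simp cong: measurable_cong_sets add: space_prob_algebra)
qed

lemma nn_integral_kernel_measurable:
  assumes "\<kappa> \<in> M \<rightarrow>\<^sub>M prob_algebra N" "(\<lambda>(x, u). f x u) \<in> borel_measurable (M \<Otimes>\<^sub>M N)"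
  shows "(\<lambda>x. \<integral>\<^sup>+u. f x u \<partial>\<kappa> x) \<in> borel_measurable M"
  by (rule nn_integral_measurable_subprob_algebra2[OF assms(2) measurable_prob_algebraD[OF assms(1)]])

lemma nn_integral_pair_prob:
  assumes p: "p \<in> space (prob_algebra M)" and q: "q \<in> space (prob_algebra N)"
    and f: "f \<in> borel_measurable (M \<Otimes>\<^sub>M N)"
  shows "(\<integral>\<^sup>+z. f z \<partial>(p \<Otimes>\<^sub>M q)) = (\<integral>\<^sup>+x. \<integral>\<^sup>+y. f (x, y) \<partial>q \<partial>p)"
    and "(\<integral>\<^sup>+y. \<integral>\<^sup>+x. f (x, y) \<partial>p \<partial>q) = (\<integral>\<^sup>+x. \<integral>\<^sup>+y. f (x, y) \<partial>q \<partial>p)"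
proof -
  interpret p: prob_space p using p by (simp add: space_prob_algebra)
  interpret q: prob_space q using q by (simp add: space_prob_algebra)
  interpret pq: pair_prob_space p q ..
  have s: "sets (p \<Otimes>\<^sub>M q) = sets (M \<Otimes>\<^sub>M N)"
    using p q by (intro sets_pair_measure_cong) (auto simp: space_prob_algebra)
  have f': "f \<in> borel_measurable (p \<Otimes>\<^sub>M q)" using f by (simp cong: measurable_cong_sets add: s)
  show "(\<integral>\<^sup>+z. f z \<partial>(p \<Otimes>\<^sub>M q)) = (\<integral>\<^sup>+x. \<integral>\<^sup>+y. f (x, y) \<partial>q \<partial>p)"
    using q.nn_integral_fst[OF f'] by simp
  show "(\<integral>\<^sup>+y. \<integral>\<^sup>+x. f (x, y) \<partial>p \<partial>q) = (\<integral>\<^sup>+x. \<integral>\<^sup>+y. f (x, y) \<partial>q \<partial>p)"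
    by (rule pq.Fubini[OF f'])
qed

text \<open>Two independent two-stage experiments may be run as two mixtures: Tonelli moves the
  second mixing variable past the outcome of the first kernel.\<close>

lemma nn_integral_bind_pair:
  assumes a: "a \<in> space (prob_algebra A)" and b: "b \<in> space (prob_algebra B)"
    and k: "k \<in> A \<rightarrow>\<^sub>M prob_algebra M" and l: "l \<in> B \<rightarrow>\<^sub>M prob_algebra N"
    and g[measurable]: "g \<in> borel_measurable (M \<Otimes>\<^sub>M N)"
  shows "(\<integral>\<^sup>+x. \<integral>\<^sup>+y. \<integral>\<^sup>+u. g u \<partial>(k x \<Otimes>\<^sub>M l y) \<partial>b \<partial>a) = (\<integral>\<^sup>+u. \<integral>\<^sup>+v. g (u, v) \<partial>(b \<bind> l) \<partial>(a \<bind> k))"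
proof -
  have sa: "sets a = sets A" and sb: "sets b = sets B" using a b by (auto simp: space_prob_algebra)
  have sp: "space a = space A" "space b = space B" using sa sb by (auto dest: sets_eq_imp_space_eq)
  have kx: "k x \<in> space (prob_algebra M)" if "x \<in> space A" for x using measurable_space[OF k that] .
  have ly: "l y \<in> space (prob_algebra N)" if "y \<in> space B" for y using measurable_space[OF l that] .
  have bl: "b \<bind> l \<in> space (prob_algebra N)"
    using prob_space_bind'[OF b l] sets_bind'[OF b l] by (simp add: space_prob_algebra)
  have m1: "(\<lambda>(u, y). \<integral>\<^sup>+v. g (u, v) \<partial>l y) \<in> borel_measurable (M \<Otimes>\<^sub>M B)"
  proof -
    have "(\<lambda>p. l (snd p)) \<in> M \<Otimes>\<^sub>M B \<rightarrow>\<^sub>M prob_algebra N"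
      by (rule measurable_compose[OF measurable_snd l])
    then have "(\<lambda>p. \<integral>\<^sup>+v. g (fst p, v) \<partial>l (snd p)) \<in> borel_measurable (M \<Otimes>\<^sub>M B)"
      by (rule nn_integral_kernel_measurable) measurable
    then show ?thesis by (simp add: case_prod_unfold)
  qed
  have m2: "(\<lambda>u. \<integral>\<^sup>+v. g (u, v) \<partial>(b \<bind> l)) \<in> borel_measurable M"
    by (rule nn_integral_kernel_measurable[where \<kappa>="\<lambda>_. b \<bind> l" and N=N]) (use bl in auto)
  have "(\<integral>\<^sup>+u. \<integral>\<^sup>+v. g (u, v) \<partial>(b \<bind> l) \<partial>(a \<bind> k)) = (\<integral>\<^sup>+x. \<integral>\<^sup>+u. \<integral>\<^sup>+v. g (u, v) \<partial>(b \<bind> l) \<partial>k x \<partial>a)"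
    by (rule nn_integral_prob_bind[OF a k m2])
  also have "\<dots> = (\<integral>\<^sup>+x. \<integral>\<^sup>+u. \<integral>\<^sup>+y. \<integral>\<^sup>+v. g (u, v) \<partial>l y \<partial>b \<partial>k x \<partial>a)"
  proof (intro nn_integral_cong)
    fix x u assume "x \<in> space a" "u \<in> space (k x)"
    then have "u \<in> space M" using kernelD(3)[OF k, of x] sp by simp
    then have "(\<lambda>v. g (u, v)) \<in> borel_measurable N" by measurable
    then show "(\<integral>\<^sup>+v. g (u, v) \<partial>(b \<bind> l)) = (\<integral>\<^sup>+y. \<integral>\<^sup>+v. g (u, v) \<partial>l y \<partial>b)"
      by (rule nn_integral_prob_bind[OF b l])
  qed
  also have "\<dots> = (\<integral>\<^sup>+x. \<integral>\<^sup>+y. \<integral>\<^sup>+u. \<integral>\<^sup>+v. g (u, v) \<partial>l y \<partial>k x \<partial>b \<partial>a)"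
  proof (rule nn_integral_cong)
    fix x assume "x \<in> space a"
    then have "x \<in> space A" using sp by simp
    from nn_integral_pair_prob(2)[OF kx[OF this] b m1]
    show "(\<integral>\<^sup>+u. \<integral>\<^sup>+y. \<integral>\<^sup>+v. g (u, v) \<partial>l y \<partial>b \<partial>k x) = (\<integral>\<^sup>+y. \<integral>\<^sup>+u. \<integral>\<^sup>+v. g (u, v) \<partial>l y \<partial>k x \<partial>b)"
      by simp
  qed
  also have "\<dots> = (\<integral>\<^sup>+x. \<integral>\<^sup>+y. \<integral>\<^sup>+u. g u \<partial>(k x \<Otimes>\<^sub>M l y) \<partial>b \<partial>a)"
    by (intro nn_integral_cong nn_integral_pair_prob(1)[symmetric, OF kx ly g]) (auto simp: sp)
  finally show ?thesis by simp
qed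

text \<open>Products of boxes form a generator closed under intersection, and they are the sets on
  which the density hypothesis prescribes the conditional law of the observations.\<close>

lemma pair_PiM_eqI:
  assumes I: "finite I" "finite J"
    and M: "\<And>i. i \<in> I \<Longrightarrow> prob_space (M i)" and N: "\<And>j. j \<in> J \<Longrightarrow> prob_space (N j)"
    and K: "sets K = sets (PiM I M \<Otimes>\<^sub>M PiM J N)"
    and eq: "\<And>A B. (\<And>i. i \<in> I \<Longrightarrow> A i \<in> sets (M i)) \<Longrightarrow> (\<And>j. j \<in> J \<Longrightarrow> B j \<in> sets (N j)) \<Longrightarrow>
      emeasure K (PiE I A \<times> PiE J B) = (\<Prod>i\<in>I. emeasure (M i) (A i)) * (\<Prod>j\<in>J. emeasure (N j) (B j))"
  shows "K = PiM I M \<Otimes>\<^sub>M PiM J N"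
proof -
  interpret P: prob_space "PiM I M" by (rule prob_space_PiM) (rule M)
  interpret Q: prob_space "PiM J N" by (rule prob_space_PiM) (rule N)
  interpret PQ: pair_prob_space "PiM I M" "PiM J N" ..
  let ?E = "{a \<times> b | a b. a \<in> prod_algebra I M \<and> b \<in> prod_algebra J N}"
  let ?\<Omega> = "space (PiM I M) \<times> space (PiM J N)"
  have top1: "space (PiM I M) \<in> prod_algebra I M" unfolding prod_algebra_eq_finite[OF I(1)] space_PiM by auto
  have top2: "space (PiM J N) \<in> prod_algebra J N" unfolding prod_algebra_eq_finite[OF I(2)] space_PiM by auto
  have sub1: "prod_algebra I M \<subseteq> Pow (space (PiM I M))" and sub2: "prod_algebra J N \<subseteq> Pow (space (PiM J N))"
    using prod_algebra_sets_into_space[of I M] prod_algebra_sets_into_space[of J N] by (simp_all add: space_PiM)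
  have sub: "?E \<subseteq> Pow ?\<Omega>" using sub1 sub2 by blast
  have gen: "sets (PiM I M \<Otimes>\<^sub>M PiM J N) = sigma_sets ?\<Omega> ?E"
  proof -
    have "sets (PiM I M \<Otimes>\<^sub>M PiM J N) = sets (sigma ?\<Omega> ?E)"
      by (rule sets_pair_eq[where Ca="{space (PiM I M)}" and Cb="{space (PiM J N)}"])
         (use sub1 sub2 top1 top2 in \<open>simp_all add: sets_PiM space_PiM\<close>)
    also have "\<dots> = sigma_sets ?\<Omega> ?E"
      by (rule sets_measure_of[OF sub])
    finally show ?thesis .
  qed
  show ?thesis
  proof (rule measure_eqI_generator_eq[where E="?E" and \<Omega>="?\<Omega>" and A="\<lambda>_. ?\<Omega>"])
    show "Int_stable ?E"
    proof (rule Int_stableI)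
      fix x y assume "x \<in> ?E" "y \<in> ?E"
      then obtain a b c d where *: "x = a \<times> b" "y = c \<times> d" "a \<in> prod_algebra I M" "b \<in> prod_algebra J N"
        "c \<in> prod_algebra I M" "d \<in> prod_algebra J N" by blast
      then have "x \<inter> y = (a \<inter> c) \<times> (b \<inter> d)" "a \<inter> c \<in> prod_algebra I M" "b \<inter> d \<in> prod_algebra J N"
        using Int_stable_prod_algebra[of I M] Int_stable_prod_algebra[of J N] by (auto simp: Int_stable_def)
      then show "x \<inter> y \<in> ?E" by blast
    qed
    show "?E \<subseteq> Pow ?\<Omega>" by (rule sub)
    show "sets K = sigma_sets ?\<Omega> ?E" "sets (PiM I M \<Otimes>\<^sub>M PiM J N) = sigma_sets ?\<Omega> ?E" using K gen by auto
    show "range (\<lambda>_. ?\<Omega>) \<subseteq> ?E" using top1 top2 by blast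
    fix X assume "X \<in> ?E"
    then obtain A B where AB: "X = PiE I A \<times> PiE J B" "\<And>i. i \<in> I \<Longrightarrow> A i \<in> sets (M i)" "\<And>j. j \<in> J \<Longrightarrow> B j \<in> sets (N j)"
      unfolding prod_algebra_eq_finite[OF I(1)] prod_algebra_eq_finite[OF I(2)] by blast
    have s: "PiE I A \<in> sets (PiM I M)" "PiE J B \<in> sets (PiM J N)" using AB I by (auto intro!: sets_PiM_I_finite)
    show eqX: "emeasure K X = emeasure (PiM I M \<Otimes>\<^sub>M PiM J N) X"
    proof -
      have "emeasure K (PiE I A \<times> PiE J B) = (\<Prod>i\<in>I. emeasure (M i) (A i)) * (\<Prod>j\<in>J. emeasure (N j) (B j))"
        by (rule eq) (rule AB(2), assumption, rule AB(3), assumption)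
      also have "\<dots> = emeasure (PiM I M) (PiE I A) * emeasure (PiM J N) (PiE J B)"
        by (subst (1 2) emeasure_PiM_PiE) (use I M N AB in auto)
      also have "\<dots> = emeasure (PiM I M \<Otimes>\<^sub>M PiM J N) (PiE I A \<times> PiE J B)"
        by (rule Q.emeasure_pair_measure_Times[symmetric]) (rule s)+
      finally show ?thesis unfolding AB(1) .
    qed
  next
    have "?\<Omega> = PiE I (\<lambda>i. space (M i)) \<times> PiE J (\<lambda>j. space (N j))" by (simp add: space_PiM)
    then have "emeasure K ?\<Omega> = (\<Prod>i\<in>I. emeasure (M i) (space (M i))) * (\<Prod>j\<in>J. emeasure (N j) (space (N j)))"
      using eq[of "\<lambda>i. space (M i)" "\<lambda>j. space (N j)"] by simp
    also have "\<dots> = 1" using M N by (simp add: prob_space.emeasure_space_1)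
    finally show "emeasure K ?\<Omega> \<noteq> \<infinity>" by simp
  qed simp
qed

section \<open>Policies and the laws of actions given the state\<close>

text \<open>Second countability makes the Borel sets of the product space those of the product
  \<sigma>-algebra; both sides are its traces on \<open>X \<times> Y\<close>. Policies are Borel
  measures on a product set, whereas iterated integrals work with pair measures.\<close>

lemma sets_borel_on_pair:
  fixes X :: "'a::second_countable_topology set" and Y :: "'b::second_countable_topology set"
  shows "sets (borel_on X \<Otimes>\<^sub>M borel_on Y) = sets (borel_on (X \<times> Y))"
proof
  show "sets (borel_on X \<Otimes>\<^sub>M borel_on Y) \<subseteq> sets (borel_on (X \<times> Y))"
  proof (rule sets_pair_in_sets)
    fix a b assume "a \<in> sets (borel_on X)" "b \<in> sets (borel_on Y)"
    then obtain A B where AB: "a = X \<inter> A" "b = Y \<inter> B" "A \<in> sets borel" "B \<in> sets borel"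
      by (auto simp: borel_on_def sets_restrict_space)
    have "A \<times> B \<in> sets (borel \<Otimes>\<^sub>M borel)" using AB by simp
    then have "A \<times> B \<in> sets borel" unfolding borel_prod .
    moreover have "a \<times> b = (X \<times> Y) \<inter> (A \<times> B)" using AB by auto
    ultimately show "a \<times> b \<in> sets (borel_on (X \<times> Y))"
      by (auto simp: borel_on_def sets_restrict_space)
  qed
  have f: "fst \<in> borel_on X \<Otimes>\<^sub>M borel_on Y \<rightarrow>\<^sub>M borel" and s: "snd \<in> borel_on X \<Otimes>\<^sub>M borel_on Y \<rightarrow>\<^sub>M borel"
    by (rule measurable_borel_onD[OF measurable_fst], rule measurable_borel_onD[OF measurable_snd])
  have "(\<lambda>p. (fst p, snd p)) \<in> borel_on X \<Otimes>\<^sub>M borel_on Y \<rightarrow>\<^sub>M borel \<Otimes>\<^sub>M borel"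
    using f s by (rule measurable_Pair)
  then have "(\<lambda>p. p) \<in> borel_on X \<Otimes>\<^sub>M borel_on Y \<rightarrow>\<^sub>M borel" unfolding borel_prod by simp
  then have id: "(\<lambda>p. p) \<in> borel_on X \<Otimes>\<^sub>M borel_on Y \<rightarrow>\<^sub>M borel_on (X \<times> Y)"
    by (rule measurable_borel_onI) (auto simp: space_pair_measure)
  show "sets (borel_on (X \<times> Y)) \<subseteq> sets (borel_on X \<Otimes>\<^sub>M borel_on Y)"
  proof
    fix A assume A: "A \<in> sets (borel_on (X \<times> Y))"
    then have "A \<subseteq> X \<times> Y" using sets.sets_into_space by fastforce
    then show "A \<in> sets (borel_on X \<Otimes>\<^sub>M borel_on Y)"
      using measurable_sets[OF id A] by (simp add: space_pair_measure Int_absorb2)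
  qed
qed

lemma measurable_borel_on_pairI:
  fixes X :: "'a::second_countable_topology set" and Y :: "'b::second_countable_topology set"
  assumes "f \<in> M \<rightarrow>\<^sub>M borel_on X" "g \<in> M \<rightarrow>\<^sub>M borel_on Y"
  shows "(\<lambda>x. (f x, g x)) \<in> M \<rightarrow>\<^sub>M borel_on (X \<times> Y)"
  using measurable_Pair[OF assms] by (simp cong: measurable_cong_sets add: sets_borel_on_pair)

section \<open>Policies and their Borel structure\<close>

lemma wf_team_refm:
  assumes "wf_team M T"
  shows "prob_space (refm T)" "sets (refm T) = sets (borel_on (obs_space T))" "space (refm T) = obs_space T"
    "refm T \<in> space (prob_algebra (borel_on (obs_space T)))"
  using assms prob_measuresD[of "refm T" "obs_space T"] by (auto simp: wf_team_def prob_measures_def)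

lemma
  assumes T: "wf_team M T" and \<kappa>: "\<kappa> \<in> kernels T"
  shows joint_of_in_prob_measures: "joint_of T \<kappa> \<in> prob_measures (act_space T \<times> obs_space T)"
    and nn_integral_joint_of: "h \<in> borel_measurable (borel_on (act_space T \<times> obs_space T)) \<Longrightarrow>
      (\<integral>\<^sup>+z. h z \<partial>joint_of T \<kappa>) = (\<integral>\<^sup>+y. \<integral>\<^sup>+u. h (u, y) \<partial>\<kappa> y \<partial>refm T)"
proof -
  let ?k = "\<lambda>y. distr (\<kappa> y) (borel_on (act_space T \<times> obs_space T)) (\<lambda>u. (u, y))"
  have \<kappa>m: "\<kappa> \<in> borel_on (obs_space T) \<rightarrow>\<^sub>M prob_algebra (borel_on (act_space T))"
    using \<kappa> unfolding kernels_def .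
  have k: "?k \<in> borel_on (obs_space T) \<rightarrow>\<^sub>M prob_algebra (borel_on (act_space T \<times> obs_space T))"
    by (rule measurable_distr_prob_space2[OF \<kappa>m]) (simp add: case_prod_unfold measurable_borel_on_pairI)
  note Q = wf_team_refm(4)[OF T]
  show "joint_of T \<kappa> \<in> prob_measures (act_space T \<times> obs_space T)"
    unfolding joint_of_def mem_prob_measures using prob_space_bind'[OF Q k] sets_bind'[OF Q k] by simp
  assume h: "h \<in> borel_measurable (borel_on (act_space T \<times> obs_space T))"
  have "(\<integral>\<^sup>+z. h z \<partial>joint_of T \<kappa>) = (\<integral>\<^sup>+y. \<integral>\<^sup>+z. h z \<partial>?k y \<partial>refm T)"
    unfolding joint_of_def by (rule nn_integral_prob_bind[OF Q k h])
  also have "\<dots> = (\<integral>\<^sup>+y. \<integral>\<^sup>+u. h (u, y) \<partial>\<kappa> y \<partial>refm T)"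
  proof (rule nn_integral_cong)
    fix y assume "y \<in> space (refm T)"
    then have y: "y \<in> space (borel_on (obs_space T))" using wf_team_refm(3)[OF T] by simp
    have "(\<lambda>u. (u, y)) \<in> \<kappa> y \<rightarrow>\<^sub>M borel_on (act_space T \<times> obs_space T)"
      using y by (intro measurable_borel_on_pairI)
        (auto cong: measurable_cong_sets simp: kernelD(2)[OF \<kappa>m y])
    then show "(\<integral>\<^sup>+z. h z \<partial>?k y) = (\<integral>\<^sup>+u. h (u, y) \<partial>\<kappa> y)" by (rule nn_integral_distr) (use h in simp)
  qed
  finally show "(\<integral>\<^sup>+z. h z \<partial>joint_of T \<kappa>) = (\<integral>\<^sup>+y. \<integral>\<^sup>+u. h (u, y) \<partial>\<kappa> y \<partial>refm T)" .
qed

lemma policies_subset_prob_measures: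
  "wf_team M T \<Longrightarrow> policies T \<subseteq> prob_measures (act_space T \<times> obs_space T)"
  unfolding policies_def using joint_of_in_prob_measures by blast

lemma
  shows space_borel_of: "space (borel_of X) = topspace X"
    and sets_borel_of: "sets (borel_of X) = sigma_sets (topspace X) {S. openin X S}"
proof -
  have "{S. openin X S} \<subseteq> Pow (topspace X)" by (auto dest: openin_subset)
  then show "space (borel_of X) = topspace X" "sets (borel_of X) = sigma_sets (topspace X) {S. openin X S}"
    unfolding borel_of_def by (simp_all add: space_measure_of sets_measure_of)
qed

lemma space_policy_space:
  assumes "wf_team M T"
  shows "space (policy_space T) = policies T"
proof -
  have "space (policy_space T) = topspace (subtopology (weak_topology (act_space T \<times> obs_space T)) (policies T))"
    unfolding policy_space_def by (rule space_borel_of)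
  then show ?thesis using policies_subset_prob_measures[OF assms] by (auto simp: topspace_weak_topology)
qed

lemma kernel_of:
  assumes "\<gamma> \<in> policies T"
  shows "kernel_of T \<gamma> \<in> kernels T" "joint_of T (kernel_of T \<gamma>) = \<gamma>"
proof -
  have "\<exists>\<kappa>. \<kappa> \<in> kernels T \<and> joint_of T \<kappa> = \<gamma>" using assms unfolding policies_def by blast
  from someI_ex[OF this] show "kernel_of T \<gamma> \<in> kernels T" "joint_of T (kernel_of T \<gamma>) = \<gamma>"
    unfolding kernel_of_def by auto
qed

lemma measurable_integral_policy:
  fixes f :: "'u::euclidean_space \<times> 'y::euclidean_space \<Rightarrow> real"
  assumes T: "wf_team M T" and f: "continuous_on (act_space T \<times> obs_space T) f" "bounded (f ` (act_space T \<times> obs_space T))"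
  shows "(\<lambda>\<gamma>. integral\<^sup>L \<gamma> f) \<in> borel_measurable (policy_space T)"
proof (rule borel_measurableI)
  let ?X = "act_space T \<times> obs_space T"
  fix V :: "real set" assume V: "open V"
  have "openin (weak_topology ?X) {\<mu> \<in> prob_measures ?X. integral\<^sup>L \<mu> f \<in> V}"
    unfolding weak_topology_def by (rule topology_generated_by_Basis) (use f V in blast)
  then have "openin (subtopology (weak_topology ?X) (policies T)) ({\<mu> \<in> prob_measures ?X. integral\<^sup>L \<mu> f \<in> V} \<inter> policies T)"
    by (auto simp: openin_subtopology)
  moreover have "{\<mu> \<in> prob_measures ?X. integral\<^sup>L \<mu> f \<in> V} \<inter> policies T = (\<lambda>\<gamma>. integral\<^sup>L \<gamma> f) -` V \<inter> space (policy_space T)"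
    using policies_subset_prob_measures[OF T] by (auto simp: space_policy_space[OF T])
  moreover have "sets (policy_space T) = sigma_sets (topspace (subtopology (weak_topology ?X) (policies T)))
      {S. openin (subtopology (weak_topology ?X) (policies T)) S}"
    unfolding policy_space_def by (rule sets_borel_of)
  ultimately show "(\<lambda>\<gamma>. integral\<^sup>L \<gamma> f) -` V \<inter> space (policy_space T) \<in> sets (policy_space T)"
    by (auto intro: sigma_sets.Basic)
qed

lemma sets_borel_on_generated:
  assumes "X \<in> sets borel"
  shows "sets (borel_on X) = sigma_sets X ((\<inter>) X ` {S. open S})"
  unfolding borel_on_def sets_restrict_space
  using sigma_sets_Int[of X UNIV "{S. open S}"] assms by (simp add: borel_def)

text \<open>Evaluations at relatively open sets suffice. The indicator of an open set is a pointwise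
  limit of bounded continuous functions, whose integrals depend continuously on the policy by the
  definition of the weak topology.\<close>

lemma measurable_policy_measure:
  fixes T :: "('s, 'y::euclidean_space, 'u::euclidean_space, 'v::euclidean_space) team"
  assumes T: "wf_team M T"
  shows "(\<lambda>\<gamma>. \<gamma>) \<in> policy_space T \<rightarrow>\<^sub>M prob_algebra (borel_on (act_space T \<times> obs_space T))"
proof -
  let ?X = "act_space T \<times> obs_space T"
  have "?X \<in> sets (borel \<Otimes>\<^sub>M borel)" using T by (auto simp: wf_team_def)
  then have X: "?X \<in> sets borel" unfolding borel_prod .
  have p: "\<gamma> \<in> prob_measures ?X" if "\<gamma> \<in> space (policy_space T)" for \<gamma>
    using that policies_subset_prob_measures[OF T] by (auto simp: space_policy_space[OF T])
  show ?thesis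
  proof (rule measurable_prob_algebra_generated[OF sets_borel_on_generated[OF X]])
    show "Int_stable ((\<inter>) ?X ` {S. open S})"
    proof (rule Int_stableI)
      fix a b assume "a \<in> (\<inter>) ?X ` {S. open S}" "b \<in> (\<inter>) ?X ` {S. open S}"
      then obtain A B where "a = ?X \<inter> A" "b = ?X \<inter> B" "open A" "open B" by auto
      then have "a \<inter> b = ?X \<inter> (A \<inter> B)" "open (A \<inter> B)" by auto
      then show "a \<inter> b \<in> (\<inter>) ?X ` {S. open S}" by blast
    qed
    show "(\<inter>) ?X ` {S. open S} \<subseteq> Pow ?X" by auto
    show "prob_space \<gamma>" "sets \<gamma> = sets (borel_on ?X)" if "\<gamma> \<in> space (policy_space T)" for \<gamma>
      using prob_measuresD[OF p[OF that]] by auto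
    fix A assume "A \<in> (\<inter>) ?X ` {S. open S}"
    then obtain O' where O': "A = ?X \<inter> O'" "open O'" by auto
    show "(\<lambda>\<gamma>. emeasure \<gamma> A) \<in> borel_measurable (policy_space T)"
    \<comment> \<open>For the whole space the complement is empty and \<open>infdist\<close> to it
      is 0, so the approximation used below would give 0 instead of 1.\<close>
    proof (cases "O' = UNIV")
      case True
      have "emeasure \<gamma> A = 1" if "\<gamma> \<in> space (policy_space T)" for \<gamma>
        using prob_measuresD[OF p[OF that]] O'(1) True prob_space.emeasure_space_1[of \<gamma>] by simp
      then show ?thesis by (subst measurable_cong[where g="\<lambda>_. 1"]) auto
    next
      case False
      define f where "f n x = min 1 (real n * infdist x (- O'))" for n x
      have fc: "continuous_on ?X (f n)" for n unfolding f_def by (intro continuous_intros)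
      have f01: "0 \<le> f n x \<and> f n x \<le> 1" for n x unfolding f_def by (auto simp: infdist_nonneg)
      have fm: "(\<lambda>\<gamma>. integral\<^sup>L \<gamma> (f n)) \<in> borel_measurable (policy_space T)" for n
        by (rule measurable_integral_policy[OF T fc]) (use f01 in \<open>auto simp: bounded_iff intro!: exI[of _ 1]\<close>)
      have lim: "(\<lambda>n. f n x) \<longlonglongrightarrow> indicator O' x" for x
      proof (cases "x \<in> O'")
        case True
        have "infdist x (- O') \<noteq> 0"
          using True False O'(2) in_closed_iff_infdist_zero[of "- O'" x] by auto
        then have pos: "0 < infdist x (- O')" using infdist_nonneg[of x "- O'"] by simp
        obtain m where m: "1 < real m * infdist x (- O')" using reals_Archimedean3[OF pos] by blast
        have "f n x = 1" if "m \<le> n" for n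
        proof -
          have "real m * infdist x (- O') \<le> real n * infdist x (- O')"
            using that pos by (intro mult_right_mono) auto
          then show ?thesis using m unfolding f_def by simp
        qed
        then show ?thesis using True
          by (intro tendsto_eventually) (auto simp: eventually_sequentially)
      next
        case False
        then show ?thesis by (simp add: f_def)
      qed
      have conv: "(\<lambda>n. integral\<^sup>L \<gamma> (f n)) \<longlonglongrightarrow> measure \<gamma> A" if g: "\<gamma> \<in> space (policy_space T)" for \<gamma>
      proof -
        interpret prob_space \<gamma> using prob_measuresD[OF p[OF g]] by simp
        have bm: "h \<in> borel_measurable \<gamma>" if "h \<in> borel_measurable (borel_on ?X)" for h :: "'u \<times> 'y \<Rightarrow> real"
          using that by (simp cong: measurable_cong_sets add: prob_measuresD(2)[OF p[OF g]])
        have A: "A \<in> sets \<gamma>"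
          using O' unfolding prob_measuresD(2)[OF p[OF g]] by (auto simp: borel_on_def sets_restrict_space)
        have "(\<lambda>n. integral\<^sup>L \<gamma> (f n)) \<longlonglongrightarrow> integral\<^sup>L \<gamma> (indicator O')"
        proof (rule integral_dominated_convergence[where w="\<lambda>_. 1"])
          show "f n \<in> borel_measurable \<gamma>" for n by (rule bm[OF measurable_continuous_borel_on[OF fc]])
          have "(indicator O' :: 'u \<times> 'y \<Rightarrow> real) \<in> borel_measurable (borel_on ?X)"
            unfolding borel_on_def using O'(2) by (intro measurable_restrict_space1) auto
          then show "(indicator O' :: 'u \<times> 'y \<Rightarrow> real) \<in> borel_measurable \<gamma>" by (rule bm)
        qed (use lim f01 in auto)
        also have "integral\<^sup>L \<gamma> (indicator O') = integral\<^sup>L \<gamma> (indicator A)"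
          by (rule Bochner_Integration.integral_cong)
             (use O'(1) prob_measuresD(3)[OF p[OF g]] in \<open>auto simp: indicator_def\<close>)
        also have "\<dots> = measure \<gamma> A" using A by simp
        finally show ?thesis .
      qed
      have "(\<lambda>\<gamma>. measure \<gamma> A) \<in> borel_measurable (policy_space T)"
        by (rule borel_measurable_LIMSEQ_real[OF conv fm])
      moreover have "emeasure \<gamma> A = ennreal (measure \<gamma> A)" if "\<gamma> \<in> space (policy_space T)" for \<gamma>
        using prob_measuresD(1)[OF p[OF that]] by (simp add: finite_measure.emeasure_eq_measure prob_space.finite_measure)
      ultimately show ?thesis by (subst measurable_cong[where g="\<lambda>\<gamma>. ennreal (measure \<gamma> A)"]) auto
    qed
  qed
qed

section \<open>The law of an action given the state\<close>

definition normalized_density ::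
  "('s, 'y::euclidean_space, 'u::euclidean_space, 'v) team \<Rightarrow> 'w::topological_space set \<Rightarrow> ('y \<Rightarrow> 'w \<Rightarrow> real) \<Rightarrow> bool" where
  "normalized_density T W D \<longleftrightarrow>
     (\<lambda>(y, w). D y w) \<in> borel_measurable (borel_on (obs_space T) \<Otimes>\<^sub>M borel_on W) \<and>
     (\<forall>w\<in>W. (\<integral>\<^sup>+y. ennreal (D y w) \<partial>refm T) = 1)"

definition obs_law :: "('s, 'y::euclidean_space, 'u::euclidean_space, 'v) team \<Rightarrow> ('y \<Rightarrow> 'w \<Rightarrow> real) \<Rightarrow> 'w \<Rightarrow> 'y measure" where
  "obs_law T D w = density (refm T) (\<lambda>y. ennreal (D y w))"

text \<open>Reweighting the joint measure by the density and projecting to the action requires no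
  version of the kernel. That makes the action law a measurable function of the policy, which cannot
  be read off from the choice made in \<open>kernel_of\<close>.\<close>

definition action_kernel ::
  "('s, 'y::euclidean_space, 'u::euclidean_space, 'v) team \<Rightarrow> ('y \<Rightarrow> 'w \<Rightarrow> real) \<Rightarrow> ('u \<times> 'y) measure \<Rightarrow> 'w \<Rightarrow> 'u measure" where
  "action_kernel T D \<gamma> w = distr (density \<gamma> (\<lambda>(u, y). ennreal (D y w))) (borel_on (act_space T)) fst"

lemma measurable_density_section:
  assumes D: "normalized_density T W D" and w: "w \<in> W"
  shows "(\<lambda>y. ennreal (D y w)) \<in> borel_measurable (borel_on (obs_space T))"
proof -
  have "(\<lambda>(y, w). D y w) \<in> borel_measurable (borel_on (obs_space T) \<Otimes>\<^sub>M borel_on W)"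
    using D unfolding normalized_density_def by blast
  moreover have "(\<lambda>y. (y, w)) \<in> borel_on (obs_space T) \<rightarrow>\<^sub>M borel_on (obs_space T) \<Otimes>\<^sub>M borel_on W"
    using w by (intro measurable_Pair) auto
  ultimately have "(\<lambda>y. case (y, w) of (y, w) \<Rightarrow> D y w) \<in> borel_measurable (borel_on (obs_space T))"
    by (rule measurable_compose[rotated])
  then show ?thesis by simp
qed

lemma obs_law_prob:
  assumes T: "wf_team M T" and D: "normalized_density T W D" and w: "w \<in> W"
  shows "obs_law T D w \<in> space (prob_algebra (borel_on (obs_space T)))"
proof -
  have m: "(\<lambda>y. ennreal (D y w)) \<in> borel_measurable (refm T)"
    using measurable_density_section[OF D w] by (simp cong: measurable_cong_sets add: wf_team_refm(2)[OF T])
  have "emeasure (obs_law T D w) (space (obs_law T D w)) = 1"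
    unfolding obs_law_def using D w by (simp add: emeasure_density[OF m] normalized_density_def cong: nn_integral_cong)
  then show ?thesis using wf_team_refm(2)[OF T]
    by (auto simp: space_prob_algebra obs_law_def intro: prob_spaceI)
qed

text \<open>Disintegrating the policy along \<open>refm\<close>, the mass of \<open>A\<close> is the
  integral of \<open>D y w\<close> times the mass that the kernel gives to \<open>A\<close>. The
  chosen version of the kernel thus matters only up to null sets of \<open>refm\<close>.\<close>

lemma
  assumes T: "wf_team M T" and D: "normalized_density T W D" and w: "w \<in> W" and \<gamma>: "\<gamma> \<in> policies T"
  shows emeasure_action_kernel: "A \<in> sets (borel_on (act_space T)) \<Longrightarrow>
      emeasure (action_kernel T D \<gamma> w) A = (\<integral>\<^sup>+z. ennreal (D (snd z) w) * indicator A (fst z) \<partial>\<gamma>)"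
    and action_kernel_eq_bind: "action_kernel T D \<gamma> w = obs_law T D w \<bind> kernel_of T \<gamma>"
    and action_kernel_prob: "action_kernel T D \<gamma> w \<in> space (prob_algebra (borel_on (act_space T)))"
proof -
  let ?U = "borel_on (act_space T)" and ?Y = "borel_on (obs_space T)"
  define \<kappa> where "\<kappa> = kernel_of T \<gamma>"
  have \<kappa>: "\<kappa> \<in> kernels T" "joint_of T \<kappa> = \<gamma>" unfolding \<kappa>_def using kernel_of[OF \<gamma>] by auto
  have \<kappa>m: "\<kappa> \<in> ?Y \<rightarrow>\<^sub>M prob_algebra ?U" using \<kappa>(1) unfolding kernels_def .
  have \<gamma>s: "sets \<gamma> = sets (?U \<Otimes>\<^sub>M ?Y)"
    using \<gamma> policies_subset_prob_measures[OF T] prob_measuresD(2) by (auto simp: sets_borel_on_pair)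
  have Dm: "(\<lambda>y. ennreal (D y w)) \<in> borel_measurable ?Y" by (rule measurable_density_section[OF D w])
  have dm: "(\<lambda>z. ennreal (D (snd z) w)) \<in> borel_measurable (?U \<Otimes>\<^sub>M ?Y)"
    by (rule measurable_compose[OF measurable_snd Dm])
  have dm': "(\<lambda>(u, y). ennreal (D y w)) \<in> borel_measurable \<gamma>"
    using dm by (simp cong: measurable_cong_sets add: \<gamma>s case_prod_unfold)
  have fm: "fst \<in> density \<gamma> (\<lambda>(u, y). ennreal (D y w)) \<rightarrow>\<^sub>M ?U"
    by (simp cong: measurable_cong_sets add: \<gamma>s)
  have em: "emeasure (action_kernel T D \<gamma> w) A = (\<integral>\<^sup>+z. ennreal (D (snd z) w) * indicator A (fst z) \<partial>\<gamma>)"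
    if A: "A \<in> sets ?U" for A
  proof -
    have sA: "fst -` A \<inter> space \<gamma> \<in> sets \<gamma>"
      using measurable_sets[OF fm A] by simp
    show ?thesis
      unfolding action_kernel_def by (subst emeasure_distr[OF fm A], simp, subst emeasure_density[OF dm' sA])
        (auto intro!: nn_integral_cong simp: indicator_def)
  qed
  then show "A \<in> sets ?U \<Longrightarrow>
      emeasure (action_kernel T D \<gamma> w) A = (\<integral>\<^sup>+z. ennreal (D (snd z) w) * indicator A (fst z) \<partial>\<gamma>)" .
  note Q = obs_law_prob[OF T D w]
  have eq: "action_kernel T D \<gamma> w = obs_law T D w \<bind> \<kappa>"
  proof (rule measure_eqI)
    show "sets (action_kernel T D \<gamma> w) = sets (obs_law T D w \<bind> \<kappa>)"
      unfolding sets_bind'[OF Q \<kappa>m] by (simp add: action_kernel_def)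
    fix A assume "A \<in> sets (action_kernel T D \<gamma> w)"
    then have A: "A \<in> sets ?U" by (simp add: action_kernel_def)
    have km: "(\<lambda>y. emeasure (\<kappa> y) A) \<in> borel_measurable ?Y"
      by (rule measurable_emeasure_kernel[OF measurable_prob_algebraD[OF \<kappa>m] A])
    have hm: "(\<lambda>z. ennreal (D (snd z) w) * indicator A (fst z)) \<in> borel_measurable (borel_on (act_space T \<times> obs_space T))"
    proof -
      have "(\<lambda>z. ennreal (D (snd z) w) * indicator A (fst z)) \<in> borel_measurable (?U \<Otimes>\<^sub>M ?Y)"
        by (intro borel_measurable_times_ennreal dm measurable_compose[OF measurable_fst] borel_measurable_indicator A)
      then show ?thesis by (simp cong: measurable_cong_sets add: sets_borel_on_pair)
    qed
    have "emeasure (action_kernel T D \<gamma> w) A = (\<integral>\<^sup>+y. \<integral>\<^sup>+u. ennreal (D y w) * indicator A u \<partial>\<kappa> y \<partial>refm T)"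
      using nn_integral_joint_of[OF T \<kappa>(1) hm] unfolding \<kappa>(2) by (simp add: em[OF A])
    also have "\<dots> = (\<integral>\<^sup>+y. ennreal (D y w) * emeasure (\<kappa> y) A \<partial>refm T)"
    proof (rule nn_integral_cong)
      fix y assume "y \<in> space (refm T)"
      then have "A \<in> sets (\<kappa> y)" using A wf_team_refm(3)[OF T] kernelD(2)[OF \<kappa>m, of y] by simp
      then show "(\<integral>\<^sup>+u. ennreal (D y w) * indicator A u \<partial>\<kappa> y) = ennreal (D y w) * emeasure (\<kappa> y) A"
        by (rule nn_integral_cmult_indicator)
    qed
    also have "\<dots> = (\<integral>\<^sup>+y. emeasure (\<kappa> y) A \<partial>obs_law T D w)"
      unfolding obs_law_def using Dm km
      by (intro nn_integral_density[symmetric]) (simp_all cong: measurable_cong_sets add: wf_team_refm(2)[OF T])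
    also have "\<dots> = emeasure (obs_law T D w \<bind> \<kappa>) A"
      by (rule emeasure_bind_prob_algebra[OF Q \<kappa>m A, symmetric])
    finally show "emeasure (action_kernel T D \<gamma> w) A = emeasure (obs_law T D w \<bind> \<kappa>) A" .
  qed
  then show "action_kernel T D \<gamma> w = obs_law T D w \<bind> kernel_of T \<gamma>" unfolding \<kappa>_def .
  show "action_kernel T D \<gamma> w \<in> space (prob_algebra ?U)"
    unfolding eq using prob_space_bind'[OF Q \<kappa>m] sets_bind'[OF Q \<kappa>m] by (simp add: space_prob_algebra)
qed

text \<open>The mass of a set of actions is the integral of a jointly measurable function against
  \<open>\<gamma>\<close>, and \<open>measurable_policy_measure\<close> makes
  \<open>\<gamma>\<close> a kernel over the policy space.\<close>

lemma measurable_action_kernel: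
  fixes T :: "('s, 'y::euclidean_space, 'u::euclidean_space, 'v::euclidean_space) team"
    and W :: "'w::topological_space set"
  assumes T: "wf_team M T" and D: "normalized_density T W D"
  shows "(\<lambda>(\<gamma>, w). action_kernel T D \<gamma> w) \<in> policy_space T \<Otimes>\<^sub>M borel_on W \<rightarrow>\<^sub>M prob_algebra (borel_on (act_space T))"
proof -
  let ?U = "borel_on (act_space T)" and ?Y = "borel_on (obs_space T)"
  let ?P = "policy_space T \<Otimes>\<^sub>M borel_on W"
  have sp: "fst p \<in> policies T" "snd p \<in> W" if "p \<in> space ?P" for p
    using that by (auto simp: space_pair_measure space_policy_space[OF T])
  have ap: "action_kernel T D (fst p) (snd p) \<in> space (prob_algebra ?U)" if "p \<in> space ?P" for p
    by (rule action_kernel_prob[OF T D]) (use sp[OF that] in auto)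
  have "(\<lambda>p. action_kernel T D (fst p) (snd p)) \<in> ?P \<rightarrow>\<^sub>M prob_algebra ?U"
  proof (rule measurable_prob_algebraI[OF _ measurable_subprob_algebra])
    fix p assume p: "p \<in> space ?P"
    show "prob_space (action_kernel T D (fst p) (snd p))" using ap[OF p] by (simp add: space_prob_algebra)
    then show "subprob_space (action_kernel T D (fst p) (snd p))" by (rule prob_space_imp_subprob_space)
    show "sets (action_kernel T D (fst p) (snd p)) = sets ?U" using ap[OF p] by (simp add: space_prob_algebra)
  next
    fix A assume A[measurable]: "A \<in> sets ?U"
    have pm: "(\<lambda>p. fst p) \<in> ?P \<rightarrow>\<^sub>M prob_algebra (?U \<Otimes>\<^sub>M ?Y)"
    proof -
      have "prob_algebra (?U \<Otimes>\<^sub>M ?Y) = prob_algebra (borel_on (act_space T \<times> obs_space T))"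
        unfolding prob_algebra_def subprob_algebra_cong[OF sets_borel_on_pair] ..
      then show ?thesis using measurable_compose[OF measurable_fst measurable_policy_measure[OF T]] by simp
    qed
    have Dm: "(\<lambda>(y, w). D y w) \<in> borel_measurable (?Y \<Otimes>\<^sub>M borel_on W)"
      using D unfolding normalized_density_def by blast
    have "(\<lambda>q. case (snd (snd q), snd (fst q)) of (y, w) \<Rightarrow> D y w) \<in> borel_measurable (?P \<Otimes>\<^sub>M (?U \<Otimes>\<^sub>M ?Y))"
      by (rule measurable_compose[OF _ Dm]) measurable
    then have [measurable]: "(\<lambda>q. D (snd (snd q)) (snd (fst q))) \<in> borel_measurable (?P \<Otimes>\<^sub>M (?U \<Otimes>\<^sub>M ?Y))" by simp
    have "(\<lambda>q. ennreal (D (snd (snd q)) (snd (fst q))) * indicator A (fst (snd q))) \<in> borel_measurable (?P \<Otimes>\<^sub>M (?U \<Otimes>\<^sub>M ?Y))"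
      by measurable
    then have "(\<lambda>p. \<integral>\<^sup>+z. ennreal (D (snd z) (snd p)) * indicator A (fst z) \<partial>fst p) \<in> borel_measurable ?P"
      by (intro nn_integral_kernel_measurable[OF pm]) (simp add: case_prod_unfold)
    then show "(\<lambda>p. emeasure (action_kernel T D (fst p) (snd p)) A) \<in> borel_measurable ?P"
      by (subst measurable_cong[OF emeasure_action_kernel[OF T D sp(2) sp(1) A]]) auto
  qed
  then show ?thesis by (simp add: case_prod_unfold)
qed

section \<open>Expected costs as integrals over the state\<close>

lemma static_game_state_law:
  assumes "static_game G"
  shows "state_law G \<in> space (prob_algebra (borel_on (state_space G)))"
  using assms unfolding static_game_def state_law_def
  by (auto simp: space_prob_algebra intro: prob_space.prob_space_distr)

lemma static_gameD:
  assumes "static_game G"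
  shows "wf_team (base G) (team1 G)" "wf_team (base G) (team2 G)"
    "prob_space (state_law G)" "sets (state_law G) = sets (borel_on (state_space G))" "space (state_law G) = state_space G"
  using assms static_game_state_law[OF assms] sets_eq_imp_space_eq[of "state_law G" "borel_on (state_space G)"]
  by (auto simp: static_game_def space_prob_algebra)

definition density_mass :: "('s, 'y::euclidean_space, 'u::euclidean_space, 'v) team \<Rightarrow> ('y \<Rightarrow> 'w \<Rightarrow> real) \<Rightarrow> 'w \<Rightarrow> ennreal" where
  "density_mass T f w = (\<integral>\<^sup>+y. ennreal (f y w) \<partial>refm T)"

text \<open>The densities of the observations are normalised only for almost every state; changing
  them to the constant \<open>1\<close> for the other states makes the action laws probability measures
  throughout.\<close>

definition normalize_density :: "('s, 'y::euclidean_space, 'u::euclidean_space, 'v) team \<Rightarrow> ('y \<Rightarrow> 'w \<Rightarrow> real) \<Rightarrow> 'y \<Rightarrow> 'w \<Rightarrow> real" where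
  "normalize_density T f y w = (if density_mass T f w = 1 then f y w else 1)"

lemma normalized_normalize_density:
  fixes W :: "'w::polish_space set"
  assumes T: "wf_team M T" and f: "bounded_density W (obs_space T) f"
  shows "normalized_density T W (normalize_density T f)"
proof -
  let ?Y = "borel_on (obs_space T)"
  have fm: "(\<lambda>(y, w). f y w) \<in> borel_measurable (?Y \<Otimes>\<^sub>M borel_on W)"
    using f unfolding bounded_density_def by (simp cong: measurable_cong_sets add: sets_borel_on_pair)
  have fm': "(\<lambda>p. f (snd p) (fst p)) \<in> borel_measurable (borel_on W \<Otimes>\<^sub>M ?Y)"
    using measurable_compose[OF measurable_Pair[OF measurable_snd measurable_fst] fm] by simp
  have "(\<lambda>w. density_mass T f w) \<in> borel_measurable (borel_on W)" unfolding density_mass_def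
    by (rule nn_integral_kernel_measurable[where \<kappa>="\<lambda>_. refm T" and N="?Y"])
       (use wf_team_refm(4)[OF T] fm' in \<open>auto simp: case_prod_unfold\<close>)
  then have [measurable]: "(\<lambda>p. density_mass T f (snd p)) \<in> borel_measurable (?Y \<Otimes>\<^sub>M borel_on W)"
    by (rule measurable_compose[OF measurable_snd])
  have [measurable]: "(\<lambda>p. f (fst p) (snd p)) \<in> borel_measurable (?Y \<Otimes>\<^sub>M borel_on W)"
    using fm by (simp add: case_prod_unfold)
  have "(\<lambda>p. normalize_density T f (fst p) (snd p)) \<in> borel_measurable (?Y \<Otimes>\<^sub>M borel_on W)"
    unfolding normalize_density_def by measurable
  moreover have "(\<integral>\<^sup>+y. ennreal (normalize_density T f y w) \<partial>refm T) = 1" for w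
    using prob_space.emeasure_space_1[OF wf_team_refm(1)[OF T]]
    by (cases "density_mass T f w = 1") (auto simp: normalize_density_def density_mass_def)
  ultimately show ?thesis unfolding normalized_density_def by (simp add: case_prod_unfold)
qed

definition cond_product_law where
  "cond_product_law G D1 D2 N1 N2 w =
     PiM {..<N1} (\<lambda>_::nat. obs_law (team1 G) D1 w) \<Otimes>\<^sub>M PiM {..<N2} (\<lambda>_::nat. obs_law (team2 G) D2 w)"

text \<open>The hypothesis prescribes products of masses, so the total masses of the two densities
  appear only combined; comparing different team sizes separates them. Afterwards the conditional
  law is the product of the observation laws because both agree on boxes.\<close>

lemma obs_densities_normalized:
  fixes G :: "('s, 'w::polish_space, 'y1::euclidean_space, 'u1::euclidean_space, 'v1::euclidean_space,
    'y2::euclidean_space, 'u2::euclidean_space, 'v2::euclidean_space) game"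
  assumes G: "static_game G" and f: "obs_densities G f1 f2"
  defines "D1 \<equiv> normalize_density (team1 G) f1" and "D2 \<equiv> normalize_density (team2 G) f2"
  shows "normalized_density (team1 G) (state_space G) D1" "normalized_density (team2 G) (state_space G) D2"
    and "0 < N1 \<Longrightarrow> 0 < N2 \<Longrightarrow>
      \<exists>K. cond_obs_law G N1 N2 K \<and> (AE w in state_law G. K w = cond_product_law G D1 D2 N1 N2 w)"
proof -
  let ?T1 = "team1 G" and ?T2 = "team2 G"
  note T = static_gameD(1,2)[OF G]
  show N: "normalized_density ?T1 (state_space G) D1" "normalized_density ?T2 (state_space G) D2"
    unfolding D1_def D2_def using f by (auto intro!: normalized_normalize_density[OF T(1)] normalized_normalize_density[OF T(2)] simp: obs_densities_def)
  define rect where "rect N1 N2 K w \<longleftrightarrow> (\<forall>B1 B2.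
            (\<forall>k<N1. B1 k \<in> sets (borel_on (obs_space ?T1))) \<longrightarrow>
            (\<forall>k<N2. B2 k \<in> sets (borel_on (obs_space ?T2))) \<longrightarrow>
            emeasure (K w) (PiE {..<N1} B1 \<times> PiE {..<N2} B2) =
              (\<Prod>k<N1. \<integral>\<^sup>+y\<in>B1 k. ennreal (f1 y w) \<partial>refm ?T1) *
              (\<Prod>k<N2. \<integral>\<^sup>+y\<in>B2 k. ennreal (f2 y w) \<partial>refm ?T2))" for N1 N2 w and K :: "'w \<Rightarrow> ((nat \<Rightarrow> 'y1) \<times> (nat \<Rightarrow> 'y2)) measure"
  have ex: "\<exists>K. cond_obs_law G N1 N2 K \<and> (AE w in state_law G. rect N1 N2 K w)" if "0 < N1" "0 < N2" for N1 N2
    using f that unfolding obs_densities_def rect_def by blast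
  have mass: "density_mass ?T1 f1 w ^ N1 * density_mass ?T2 f2 w ^ N2 = 1"
    if K: "cond_obs_law G N1 N2 K" and r: "rect N1 N2 K w" and w: "w \<in> state_space G" for N1 N2 K w
  proof -
    have Km: "K \<in> borel_on (state_space G) \<rightarrow>\<^sub>M prob_algebra (obs_profile_space G N1 N2)"
      using K unfolding cond_obs_law_def by blast
    have w': "w \<in> space (borel_on (state_space G))" using w by simp
    have "space (K w) = PiE {..<N1} (\<lambda>_. obs_space ?T1) \<times> PiE {..<N2} (\<lambda>_. obs_space ?T2)"
      using kernelD(3)[OF Km w'] by (simp add: obs_profile_space_def space_pair_measure space_PiM)
    then have "1 = emeasure (K w) (PiE {..<N1} (\<lambda>_. obs_space ?T1) \<times> PiE {..<N2} (\<lambda>_. obs_space ?T2))"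
      using prob_space.emeasure_space_1[OF kernelD(1)[OF Km w']] by simp
    also have "\<dots> = (\<Prod>k<N1. \<integral>\<^sup>+y\<in>obs_space ?T1. ennreal (f1 y w) \<partial>refm ?T1) *
              (\<Prod>k<N2. \<integral>\<^sup>+y\<in>obs_space ?T2. ennreal (f2 y w) \<partial>refm ?T2)"
    proof -
      have "obs_space ?T1 \<in> sets (borel_on (obs_space ?T1))" "obs_space ?T2 \<in> sets (borel_on (obs_space ?T2))"
        using sets.top[of "borel_on (obs_space ?T1)"] sets.top[of "borel_on (obs_space ?T2)"] by simp_all
      then show ?thesis
        using r[unfolded rect_def, THEN spec[of _ "\<lambda>_. obs_space ?T1"], THEN spec[of _ "\<lambda>_. obs_space ?T2"]] by simp
    qed
    also have "(\<integral>\<^sup>+y\<in>obs_space ?T1. ennreal (f1 y w) \<partial>refm ?T1) = density_mass ?T1 f1 w"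
      unfolding density_mass_def by (rule nn_integral_cong) (simp add: wf_team_refm(3)[OF T(1)])
    also have "(\<integral>\<^sup>+y\<in>obs_space ?T2. ennreal (f2 y w) \<partial>refm ?T2) = density_mass ?T2 f2 w"
      unfolding density_mass_def by (rule nn_integral_cong) (simp add: wf_team_refm(3)[OF T(2)])
    finally show ?thesis by simp
  qed
  \<comment> \<open>Sizes 1, 1 and 2, 1: if \<open>a\<close> and \<open>b\<close> are the total
    masses, then \<open>a * b = 1\<close> and \<open>a^2 * b = 1\<close>, hence \<open>a = 1\<close>
    and \<open>b = 1\<close>.\<close>
  obtain K K' where K: "cond_obs_law G 1 1 K" "AE w in state_law G. rect 1 1 K w"
    and K': "cond_obs_law G 2 1 K'" "AE w in state_law G. rect 2 1 K' w"
    using ex[of 1 1] ex[of 2 1] by auto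
  have mass1: "AE w in state_law G. density_mass ?T1 f1 w = 1 \<and> density_mass ?T2 f2 w = 1"
    using K(2) K'(2) AE_space
  proof eventually_elim
    case (elim w)
    then have w: "w \<in> state_space G" using static_gameD(5)[OF G] by simp
    have 1: "density_mass ?T1 f1 w * density_mass ?T2 f2 w = 1" using mass[OF K(1) elim(1) w] by simp
    have 2: "density_mass ?T1 f1 w * (density_mass ?T1 f1 w * density_mass ?T2 f2 w) = 1"
      using mass[OF K'(1) elim(2) w] by (simp add: power2_eq_square mult.assoc)
    have "density_mass ?T1 f1 w = 1" using 2 unfolding 1 by simp
    then show ?case using 1 by simp
  qed
  assume N12: "0 < N1" "0 < N2"
  obtain L where L: "cond_obs_law G N1 N2 L" "AE w in state_law G. rect N1 N2 L w"
    using ex[OF N12] by blast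
  have "AE w in state_law G. L w = cond_product_law G D1 D2 N1 N2 w"
    using mass1 L(2) AE_space
  proof eventually_elim
    case (elim w)
    then have w: "w \<in> state_space G" using static_gameD(5)[OF G] by simp
    have Lm: "L \<in> borel_on (state_space G) \<rightarrow>\<^sub>M prob_algebra (obs_profile_space G N1 N2)"
      using L unfolding cond_obs_law_def by blast
    note o1 = obs_law_prob[OF T(1) N(1) w] and o2 = obs_law_prob[OF T(2) N(2) w]
    have s1: "sets (obs_law ?T1 D1 w) = sets (borel_on (obs_space ?T1))" and s2: "sets (obs_law ?T2 D2 w) = sets (borel_on (obs_space ?T2))"
      using o1 o2 by (auto simp: space_prob_algebra)
    have e1: "emeasure (obs_law ?T1 D1 w) B = (\<integral>\<^sup>+y\<in>B. ennreal (f1 y w) \<partial>refm ?T1)"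
      if "B \<in> sets (borel_on (obs_space ?T1))" for B
      unfolding obs_law_def using that measurable_density_section[OF N(1) w] elim(1)
      by (subst emeasure_density) (simp_all cong: measurable_cong_sets add: wf_team_refm(2)[OF T(1)] D1_def normalize_density_def)
    have e2: "emeasure (obs_law ?T2 D2 w) B = (\<integral>\<^sup>+y\<in>B. ennreal (f2 y w) \<partial>refm ?T2)"
      if "B \<in> sets (borel_on (obs_space ?T2))" for B
      unfolding obs_law_def using that measurable_density_section[OF N(2) w] elim(1)
      by (subst emeasure_density) (simp_all cong: measurable_cong_sets add: wf_team_refm(2)[OF T(2)] D2_def normalize_density_def)
    show ?case unfolding cond_product_law_def
    proof (rule pair_PiM_eqI)
      show "prob_space (obs_law ?T1 D1 w)" "prob_space (obs_law ?T2 D2 w)"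
        using o1 o2 by (auto simp: space_prob_algebra)
      show "sets (L w) = sets (PiM {..<N1} (\<lambda>_. obs_law ?T1 D1 w) \<Otimes>\<^sub>M PiM {..<N2} (\<lambda>_. obs_law ?T2 D2 w))"
        using kernelD(2)[OF Lm, of w] w unfolding obs_profile_space_def
        by (simp add: sets_PiM_cong[OF refl s1] sets_PiM_cong[OF refl s2] cong: sets_pair_measure_cong)
      fix A B assume "\<And>i. i \<in> {..<N1} \<Longrightarrow> A i \<in> sets (obs_law ?T1 D1 w)" "\<And>j. j \<in> {..<N2} \<Longrightarrow> B j \<in> sets (obs_law ?T2 D2 w)"
      then have AB: "\<And>i. i < N1 \<Longrightarrow> A i \<in> sets (borel_on (obs_space ?T1))" "\<And>j. j < N2 \<Longrightarrow> B j \<in> sets (borel_on (obs_space ?T2))"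
        using s1 s2 by auto
      show "emeasure (L w) (PiE {..<N1} A \<times> PiE {..<N2} B)
          = (\<Prod>i<N1. emeasure (obs_law ?T1 D1 w) (A i)) * (\<Prod>j<N2. emeasure (obs_law ?T2 D2 w) (B j))"
        using elim(2)[unfolded rect_def, THEN spec[of _ A], THEN spec[of _ B]] AB by (simp add: e1 e2)
    qed auto
  qed
  then show "\<exists>K. cond_obs_law G N1 N2 K \<and> (AE w in state_law G. K w = cond_product_law G D1 D2 N1 N2 w)"
    using L(1) by blast
qed

text \<open>The joint law and the law obtained by drawing the state and then the observations from
  \<open>K\<close> agree on rectangles, which is where \<open>cond_obs_law\<close> specifies them,
  and rectangles determine both.\<close>

lemma nn_integral_joint_law:
  assumes G: "static_game G" and K: "cond_obs_law G N1 N2 K"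
    and h: "h \<in> borel_measurable (borel_on (state_space G) \<Otimes>\<^sub>M obs_profile_space G N1 N2)"
  shows "(\<integral>\<^sup>+z. h z \<partial>joint_law G N1 N2) = (\<integral>\<^sup>+w. \<integral>\<^sup>+y. h (w, y) \<partial>K w \<partial>state_law G)"
proof -
  let ?S = "borel_on (state_space G)" and ?O = "obs_profile_space G N1 N2"
  note \<mu> = static_game_state_law[OF G]
  have Km: "K \<in> ?S \<rightarrow>\<^sub>M prob_algebra ?O" using K unfolding cond_obs_law_def by blast
  define k where "k w = distr (K w) (?S \<Otimes>\<^sub>M ?O) (Pair w)" for w
  have k: "k \<in> ?S \<rightarrow>\<^sub>M prob_algebra (?S \<Otimes>\<^sub>M ?O)"
    unfolding k_def[abs_def] by (rule measurable_distr_prob_space2[OF Km]) simp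
  have sets_joint: "sets (joint_law G N1 N2) = sets (?S \<Otimes>\<^sub>M ?O)" by (simp add: joint_law_def)
  have "joint_law G N1 N2 = state_law G \<bind> k"
  proof (rule measure_eqI_generator_eq[OF Int_stable_pair_measure_generator[of ?S ?O], where \<Omega>="space ?S \<times> space ?O" and A="\<lambda>_. space ?S \<times> space ?O"])
    show "{a \<times> b | a b. a \<in> sets ?S \<and> b \<in> sets ?O} \<subseteq> Pow (space ?S \<times> space ?O)" by (rule pair_measure_closed)
    show "sets (joint_law G N1 N2) = sigma_sets (space ?S \<times> space ?O) {a \<times> b | a b. a \<in> sets ?S \<and> b \<in> sets ?O}"
      unfolding sets_joint by (rule sets_pair_measure)
    show "sets (state_law G \<bind> k) = sigma_sets (space ?S \<times> space ?O) {a \<times> b | a b. a \<in> sets ?S \<and> b \<in> sets ?O}"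
      unfolding sets_bind'[OF \<mu> k] by (rule sets_pair_measure)
    show "range (\<lambda>_. space ?S \<times> space ?O) \<subseteq> {a \<times> b | a b. a \<in> sets ?S \<and> b \<in> sets ?O}" by blast
    fix X assume "X \<in> {a \<times> b | a b. a \<in> sets ?S \<and> b \<in> sets ?O}"
    then obtain A B where X: "X = A \<times> B" and AB: "A \<in> sets ?S" "B \<in> sets ?O" by blast
    have "emeasure (state_law G \<bind> k) X = (\<integral>\<^sup>+w. emeasure (k w) (A \<times> B) \<partial>state_law G)"
      unfolding X by (rule emeasure_bind_prob_algebra[OF \<mu> k]) (use AB in auto)
    also have "\<dots> = (\<integral>\<^sup>+w\<in>A. emeasure (K w) B \<partial>state_law G)"
    proof (rule nn_integral_cong)
      fix w assume "w \<in> space (state_law G)"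
      then have w: "w \<in> space ?S" using static_gameD(5)[OF G] by simp
      have "Pair w \<in> K w \<rightarrow>\<^sub>M ?S \<Otimes>\<^sub>M ?O" using w by (simp cong: measurable_cong_sets add: kernelD(2)[OF Km w])
      then have "emeasure (k w) (A \<times> B) = emeasure (K w) (Pair w -` (A \<times> B) \<inter> space (K w))"
        unfolding k_def using AB by (intro emeasure_distr) auto
      also have "Pair w -` (A \<times> B) \<inter> space (K w) = (if w \<in> A then B else {})"
        using sets.sets_into_space[OF AB(2)] kernelD(3)[OF Km w] by auto
      finally show "emeasure (k w) (A \<times> B) = emeasure (K w) B * indicator A w" by simp
    qed
    also have "\<dots> = emeasure (joint_law G N1 N2) X"
      unfolding X using K AB unfolding cond_obs_law_def by simp
    finally show "emeasure (joint_law G N1 N2) X = emeasure (state_law G \<bind> k) X" by simp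
  next
    have "prob_space (state_law G \<bind> k)" by (rule prob_space_bind'[OF \<mu> k])
    have "(\<lambda>x. (state G x, obs_profile G N1 N2 x)) \<in> base G \<rightarrow>\<^sub>M ?S \<Otimes>\<^sub>M ?O"
      using G unfolding static_game_def wf_team_def obs_profile_def obs_profile_space_def
      by (intro measurable_Pair measurable_restrict) auto
    then have "prob_space (joint_law G N1 N2)"
      using G unfolding joint_law_def static_game_def by (intro prob_space.prob_space_distr) auto
    then show "emeasure (joint_law G N1 N2) (space ?S \<times> space ?O) \<noteq> \<infinity>"
      by (simp add: finite_measure.emeasure_finite prob_space.finite_measure)
  qed simp
  then have "(\<integral>\<^sup>+z. h z \<partial>joint_law G N1 N2) = (\<integral>\<^sup>+w. \<integral>\<^sup>+z. h z \<partial>k w \<partial>state_law G)"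
    using nn_integral_prob_bind[OF \<mu> k h] by simp
  also have "\<dots> = (\<integral>\<^sup>+w. \<integral>\<^sup>+y. h (w, y) \<partial>K w \<partial>state_law G)"
  proof (rule nn_integral_cong)
    fix w assume "w \<in> space (state_law G)"
    then have w: "w \<in> space ?S" using static_gameD(5)[OF G] by simp
    have "Pair w \<in> K w \<rightarrow>\<^sub>M ?S \<Otimes>\<^sub>M ?O" using w by (simp cong: measurable_cong_sets add: kernelD(2)[OF Km w])
    then show "(\<integral>\<^sup>+z. h z \<partial>k w) = (\<integral>\<^sup>+y. h (w, y) \<partial>K w)"
      unfolding k_def by (rule nn_integral_distr) (use h in simp)
  qed
  finally show ?thesis .
qed

section \<open>Laws of action profiles given the state\<close>

definition profile_kernel ::
  "('s, 'y::euclidean_space, 'u::euclidean_space, 'v) team \<Rightarrow> ('y \<Rightarrow> 'w \<Rightarrow> real) \<Rightarrow> nat \<Rightarrow> (nat \<Rightarrow> ('u \<times> 'y) measure) \<Rightarrow> 'w \<Rightarrow> (nat \<Rightarrow> 'u) measure" where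
  "profile_kernel T D N \<gamma> w = PiM {..<N} (\<lambda>k. action_kernel T D (\<gamma> k) w)"

text \<open>In general not a product measure, even given the state: the randomisation
  \<open>P\<close> may correlate the policies of the team.\<close>

definition mixture ::
  "('s, 'y::euclidean_space, 'u::euclidean_space, 'v) team \<Rightarrow> ('y \<Rightarrow> 'w \<Rightarrow> real) \<Rightarrow> nat \<Rightarrow> (nat \<Rightarrow> ('u \<times> 'y) measure) measure \<Rightarrow> 'w \<Rightarrow> (nat \<Rightarrow> 'u) measure" where
  "mixture T D N P w = P \<bind> (\<lambda>\<gamma>. profile_kernel T D N \<gamma> w)"

abbreviation action_profiles ::
  "('s, 'y::euclidean_space, 'u::euclidean_space, 'v) team \<Rightarrow> nat \<Rightarrow> (nat \<Rightarrow> 'u) measure" where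
  "action_profiles T N \<equiv> PiM {..<N} (\<lambda>_. borel_on (act_space T))"

context
  fixes T :: "('s, 'y::euclidean_space, 'u::euclidean_space, 'v::euclidean_space) team"
    and M :: "'s measure" and W :: "'w::topological_space set" and D :: "'y \<Rightarrow> 'w \<Rightarrow> real"
  assumes T: "wf_team M T" and D: "normalized_density T W D"
begin

lemma measurable_profile_kernel:
  "(\<lambda>(\<gamma>, w). profile_kernel T D N \<gamma> w) \<in> profile_space T {..<N} \<Otimes>\<^sub>M borel_on W \<rightarrow>\<^sub>M prob_algebra (action_profiles T N)"
proof -
  have "(\<lambda>p. PiM {..<N} (\<lambda>k. action_kernel T D (fst p k) (snd p)))
      \<in> profile_space T {..<N} \<Otimes>\<^sub>M borel_on W \<rightarrow>\<^sub>M prob_algebra (action_profiles T N)"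
  proof (rule measurable_PiM_kernel)
    fix k :: nat assume k: "k \<in> {..<N}"
    have "(\<lambda>p. (fst p k, snd p)) \<in> profile_space T {..<N} \<Otimes>\<^sub>M borel_on W \<rightarrow>\<^sub>M policy_space T \<Otimes>\<^sub>M borel_on W"
      unfolding profile_space_def using k by (intro measurable_Pair) measurable
    from measurable_compose[OF this measurable_action_kernel[OF T D]]
    show "(\<lambda>p. action_kernel T D (fst p k) (snd p)) \<in> profile_space T {..<N} \<Otimes>\<^sub>M borel_on W \<rightarrow>\<^sub>M prob_algebra (borel_on (act_space T))"
      by simp
  qed simp
  then show ?thesis unfolding profile_kernel_def by (simp add: case_prod_unfold)
qed

lemma measurable_profile_kernel_section:
  assumes w: "w \<in> W"
  shows "(\<lambda>\<gamma>. profile_kernel T D N \<gamma> w) \<in> profile_space T {..<N} \<rightarrow>\<^sub>M prob_algebra (action_profiles T N)"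
proof -
  have "(\<lambda>\<gamma>. (\<gamma>, w)) \<in> profile_space T {..<N} \<rightarrow>\<^sub>M profile_space T {..<N} \<Otimes>\<^sub>M borel_on W"
    using w by (intro measurable_Pair) auto
  from measurable_compose[OF this measurable_profile_kernel] show ?thesis by simp
qed

lemma measurable_action_kernel_section:
  assumes w: "w \<in> W"
  shows "(\<lambda>\<gamma>. action_kernel T D \<gamma> w) \<in> policy_space T \<rightarrow>\<^sub>M prob_algebra (borel_on (act_space T))"
proof -
  have "(\<lambda>\<gamma>. (\<gamma>, w)) \<in> policy_space T \<rightarrow>\<^sub>M policy_space T \<Otimes>\<^sub>M borel_on W"
    using w by (intro measurable_Pair) auto
  from measurable_compose[OF this measurable_action_kernel[OF T D]] show ?thesis by simp
qed

lemma profile_kernel_prob: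
  assumes "w \<in> W" "\<gamma> \<in> space (profile_space T {..<N})"
  shows "profile_kernel T D N \<gamma> w \<in> space (prob_algebra (action_profiles T N))"
  using measurable_space[OF measurable_profile_kernel_section[OF assms(1)] assms(2)] .

lemma measurable_mixture:
  assumes "P \<in> randomized T {..<N}"
  shows "mixture T D N P \<in> borel_on W \<rightarrow>\<^sub>M prob_algebra (action_profiles T N)"
  unfolding mixture_def[abs_def]
proof (rule measurable_bind_prob_space2)
  show "(\<lambda>w. P) \<in> borel_on W \<rightarrow>\<^sub>M prob_algebra (profile_space T {..<N})"
    using assms unfolding randomized_def by simp
  have "(\<lambda>p. (snd p, fst p)) \<in> borel_on W \<Otimes>\<^sub>M profile_space T {..<N} \<rightarrow>\<^sub>M profile_space T {..<N} \<Otimes>\<^sub>M borel_on W"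
    by measurable
  from measurable_compose[OF this measurable_profile_kernel]
  show "(\<lambda>(w, \<gamma>). profile_kernel T D N \<gamma> w) \<in> borel_on W \<Otimes>\<^sub>M profile_space T {..<N} \<rightarrow>\<^sub>M prob_algebra (action_profiles T N)"
    by (simp add: case_prod_unfold)
qed

text \<open>Private randomisation enters here: independent draws of the policies make the actions
  independent given the state, with the mixed action law in every coordinate.\<close>

lemma mixture_PiM:
  assumes R: "R \<in> space (prob_algebra (policy_space T))" and w: "w \<in> W"
  shows "mixture T D N (PiM {..<N} (\<lambda>_. R)) w = PiM {..<N} (\<lambda>_. R \<bind> (\<lambda>\<gamma>. action_kernel T D \<gamma> w))"
  unfolding mixture_def profile_kernel_def
proof (rule bind_PiM_kernel)
  show "prob_space R" using R by (simp add: space_prob_algebra)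
  show "(\<lambda>\<gamma>. action_kernel T D \<gamma> w) \<in> R \<rightarrow>\<^sub>M prob_algebra (borel_on (act_space T))"
    using measurable_action_kernel_section[OF w] R by (simp cong: measurable_cong_sets add: space_prob_algebra)
qed simp

lemma measurable_action_law:
  assumes \<gamma>: "\<gamma> \<in> space (profile_space T {..<N})"
  shows "action_law T N \<gamma> \<in> PiM {..<N} (\<lambda>_. borel_on (obs_space T)) \<rightarrow>\<^sub>M prob_algebra (action_profiles T N)"
  unfolding action_law_def[abs_def]
proof (rule measurable_PiM_kernel_components)
  fix k assume "k \<in> {..<N}"
  then have "\<gamma> k \<in> policies T" using \<gamma> by (auto simp: profile_space_def space_PiM space_policy_space[OF T])
  from kernel_of(1)[OF this] show "kernel_of T (\<gamma> k) \<in> borel_on (obs_space T) \<rightarrow>\<^sub>M prob_algebra (borel_on (act_space T))"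
    unfolding kernels_def .
qed simp

lemma obs_law_PiM_prob:
  assumes w: "w \<in> W"
  shows "PiM {..<N} (\<lambda>_. obs_law T D w) \<in> space (prob_algebra (PiM {..<N} (\<lambda>_. borel_on (obs_space T))))"
  using obs_law_prob[OF T D w] prob_space_PiM[of "{..<N}" "\<lambda>_. obs_law T D w"]
    sets_PiM_cong[of "{..<N}" "{..<N}" "\<lambda>_. obs_law T D w" "\<lambda>_. borel_on (obs_space T)"]
  by (simp add: space_prob_algebra)

text \<open>Observations that are independent given the state turn the chosen kernels into the
  action laws of the policies; on the right-hand side the choice of versions has
  disappeared.\<close>

lemma obs_law_PiM_bind_action_law:
  assumes \<gamma>: "\<gamma> \<in> space (profile_space T {..<N})" and w: "w \<in> W"
  shows "PiM {..<N} (\<lambda>_. obs_law T D w) \<bind> action_law T N \<gamma> = profile_kernel T D N \<gamma> w"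
proof -
  have pol: "\<gamma> k \<in> policies T" if "k < N" for k
    using \<gamma> that by (auto simp: profile_space_def space_PiM space_policy_space[OF T])
  have o: "prob_space (obs_law T D w)" "sets (obs_law T D w) = sets (borel_on (obs_space T))"
    using obs_law_prob[OF T D w] by (auto simp: space_prob_algebra)
  have "PiM {..<N} (\<lambda>_. obs_law T D w) \<bind> action_law T N \<gamma> = PiM {..<N} (\<lambda>k. obs_law T D w \<bind> kernel_of T (\<gamma> k))"
    unfolding action_law_def[abs_def]
  proof (rule bind_PiM_kernel)
    fix k assume "k \<in> {..<N}"
    then show "kernel_of T (\<gamma> k) \<in> obs_law T D w \<rightarrow>\<^sub>M prob_algebra (borel_on (act_space T))"
      using kernel_of(1)[OF pol, of k] unfolding kernels_def by (simp cong: measurable_cong_sets add: o)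
  qed (use o in auto)
  also have "\<dots> = profile_kernel T D N \<gamma> w" unfolding profile_kernel_def
    by (rule PiM_cong[OF refl]) (simp add: action_kernel_eq_bind[OF T D w pol])
  finally show ?thesis .
qed

end

section \<open>Reduction of expected costs to laws of actions\<close>

definition cost_measurable where
  "cost_measurable G N1 N2 g \<longleftrightarrow> (\<lambda>(w, u). g w u) \<in>
     borel_measurable (borel_on (state_space G) \<Otimes>\<^sub>M (action_profiles (team1 G) N1 \<Otimes>\<^sub>M action_profiles (team2 G) N2))"

lemma
  assumes "cost_measurable G N1 N2 g"
  shows cost_measurable_pair: "(\<lambda>p. ennreal (g (fst p) (snd p))) \<in>
     borel_measurable (borel_on (state_space G) \<Otimes>\<^sub>M (action_profiles (team1 G) N1 \<Otimes>\<^sub>M action_profiles (team2 G) N2))"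
  and cost_measurable_section: "w \<in> state_space G \<Longrightarrow> (\<lambda>u. ennreal (g w u)) \<in>
     borel_measurable (action_profiles (team1 G) N1 \<Otimes>\<^sub>M action_profiles (team2 G) N2)"
proof -
  have "(\<lambda>p. g (fst p) (snd p)) \<in>
     borel_measurable (borel_on (state_space G) \<Otimes>\<^sub>M (action_profiles (team1 G) N1 \<Otimes>\<^sub>M action_profiles (team2 G) N2))"
    using assms unfolding cost_measurable_def by (simp add: case_prod_unfold)
  then show m: "(\<lambda>p. ennreal (g (fst p) (snd p))) \<in>
     borel_measurable (borel_on (state_space G) \<Otimes>\<^sub>M (action_profiles (team1 G) N1 \<Otimes>\<^sub>M action_profiles (team2 G) N2))"
    by measurable
  assume w: "w \<in> state_space G"
  have "Pair w \<in> action_profiles (team1 G) N1 \<Otimes>\<^sub>M action_profiles (team2 G) N2 \<rightarrow>\<^sub>M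
      borel_on (state_space G) \<Otimes>\<^sub>M (action_profiles (team1 G) N1 \<Otimes>\<^sub>M action_profiles (team2 G) N2)"
    by (rule measurable_Pair1') (use w in simp)
  from measurable_compose[OF this m] show "(\<lambda>u. ennreal (g w u)) \<in>
     borel_measurable (action_profiles (team1 G) N1 \<Otimes>\<^sub>M action_profiles (team2 G) N2)" by simp
qed

text \<open>The observations are integrated out for fixed profiles, conditionally on the state. This
  comes before any integration over policies, since it is the resulting action laws that are known
  to be measurable in the policy.\<close>

lemma pure_cost_eq:
  fixes G :: "('s, 'w::polish_space, 'y1::euclidean_space, 'u1::euclidean_space, 'v1::euclidean_space,
    'y2::euclidean_space, 'u2::euclidean_space, 'v2::euclidean_space) game"
  assumes G: "static_game G" and D1: "normalized_density (team1 G) (state_space G) D1"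
    and D2: "normalized_density (team2 G) (state_space G) D2"
    and K: "cond_obs_law G N1 N2 K" "AE w in state_law G. K w = cond_product_law G D1 D2 N1 N2 w"
    and g: "cost_measurable G N1 N2 g"
    and \<gamma>1: "\<gamma>1 \<in> space (profile_space (team1 G) {..<N1})" and \<gamma>2: "\<gamma>2 \<in> space (profile_space (team2 G) {..<N2})"
  shows "(\<integral>\<^sup>+(w, y1, y2).
        (\<integral>\<^sup>+u. ennreal (g w u) \<partial>(action_law (team1 G) N1 \<gamma>1 y1 \<Otimes>\<^sub>M action_law (team2 G) N2 \<gamma>2 y2)) \<partial>joint_law G N1 N2)
    = (\<integral>\<^sup>+w. \<integral>\<^sup>+u. ennreal (g w u) \<partial>(profile_kernel (team1 G) D1 N1 \<gamma>1 w \<Otimes>\<^sub>M profile_kernel (team2 G) D2 N2 \<gamma>2 w) \<partial>state_law G)"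
proof -
  let ?S = "borel_on (state_space G)" and ?O = "obs_profile_space G N1 N2"
  let ?Y1 = "PiM {..<N1} (\<lambda>_. borel_on (obs_space (team1 G)))" and ?Y2 = "PiM {..<N2} (\<lambda>_. borel_on (obs_space (team2 G)))"
  let ?U1 = "action_profiles (team1 G) N1" and ?U2 = "action_profiles (team2 G) N2"
  note T = static_gameD(1,2)[OF G]
  note a1 = measurable_action_law[OF T(1) D1 \<gamma>1] and a2 = measurable_action_law[OF T(2) D2 \<gamma>2]
  define h where "h z = (\<integral>\<^sup>+u. ennreal (g (fst z) u)
      \<partial>(action_law (team1 G) N1 \<gamma>1 (fst (snd z)) \<Otimes>\<^sub>M action_law (team2 G) N2 \<gamma>2 (snd (snd z))))" for z
  have km: "(\<lambda>z. action_law (team1 G) N1 \<gamma>1 (fst (snd z)) \<Otimes>\<^sub>M action_law (team2 G) N2 \<gamma>2 (snd (snd z)))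
      \<in> ?S \<Otimes>\<^sub>M ?O \<rightarrow>\<^sub>M prob_algebra (?U1 \<Otimes>\<^sub>M ?U2)"
    unfolding obs_profile_space_def
    by (intro measurable_pair_prob measurable_compose[OF _ a1] measurable_compose[OF _ a2]) measurable
  have h: "h \<in> borel_measurable (?S \<Otimes>\<^sub>M ?O)"
    unfolding h_def[abs_def]
  proof (rule nn_integral_kernel_measurable[OF km])
    have "(\<lambda>q. (fst (fst q), snd q)) \<in> (?S \<Otimes>\<^sub>M ?O) \<Otimes>\<^sub>M (?U1 \<Otimes>\<^sub>M ?U2) \<rightarrow>\<^sub>M ?S \<Otimes>\<^sub>M (?U1 \<Otimes>\<^sub>M ?U2)" by measurable
    from measurable_compose[OF this cost_measurable_pair[OF g]]
    show "(\<lambda>(z, u). ennreal (g (fst z) u)) \<in> borel_measurable ((?S \<Otimes>\<^sub>M ?O) \<Otimes>\<^sub>M (?U1 \<Otimes>\<^sub>M ?U2))"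
      by (simp add: case_prod_unfold)
  qed
  have "(\<integral>\<^sup>+(w, y1, y2).
        (\<integral>\<^sup>+u. ennreal (g w u) \<partial>(action_law (team1 G) N1 \<gamma>1 y1 \<Otimes>\<^sub>M action_law (team2 G) N2 \<gamma>2 y2)) \<partial>joint_law G N1 N2)
      = (\<integral>\<^sup>+z. h z \<partial>joint_law G N1 N2)"
    by (simp add: h_def case_prod_unfold)
  also have "\<dots> = (\<integral>\<^sup>+w. \<integral>\<^sup>+y. h (w, y) \<partial>K w \<partial>state_law G)"
    by (rule nn_integral_joint_law[OF G K(1) h])
  also have "\<dots> = (\<integral>\<^sup>+w. \<integral>\<^sup>+y. h (w, y) \<partial>cond_product_law G D1 D2 N1 N2 w \<partial>state_law G)"
    by (rule nn_integral_cong_AE) (use K(2) in eventually_elim, simp)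
  also have "\<dots> = (\<integral>\<^sup>+w. \<integral>\<^sup>+u. ennreal (g w u) \<partial>(profile_kernel (team1 G) D1 N1 \<gamma>1 w \<Otimes>\<^sub>M profile_kernel (team2 G) D2 N2 \<gamma>2 w) \<partial>state_law G)"
  proof (rule nn_integral_cong)
    fix w assume "w \<in> space (state_law G)"
    then have w: "w \<in> state_space G" using static_gameD(5)[OF G] by simp
    note o1 = obs_law_PiM_prob[OF T(1) D1 w, of N1] and o2 = obs_law_PiM_prob[OF T(2) D2 w, of N2]
    note gw = cost_measurable_section[OF g w]
    have "Pair w \<in> ?Y1 \<Otimes>\<^sub>M ?Y2 \<rightarrow>\<^sub>M ?S \<Otimes>\<^sub>M ?O"
      unfolding obs_profile_space_def by (rule measurable_Pair1') (use w in simp)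
    from measurable_compose[OF this h] have hw: "(\<lambda>y. h (w, y)) \<in> borel_measurable (?Y1 \<Otimes>\<^sub>M ?Y2)" .
    have "(\<integral>\<^sup>+y. h (w, y) \<partial>cond_product_law G D1 D2 N1 N2 w)
        = (\<integral>\<^sup>+y1. \<integral>\<^sup>+y2. h (w, (y1, y2)) \<partial>PiM {..<N2} (\<lambda>_. obs_law (team2 G) D2 w) \<partial>PiM {..<N1} (\<lambda>_. obs_law (team1 G) D1 w))"
      unfolding cond_product_law_def by (rule nn_integral_pair_prob(1)[OF o1 o2 hw])
    also have "\<dots> = (\<integral>\<^sup>+u. \<integral>\<^sup>+v. ennreal (g w (u, v)) \<partial>(PiM {..<N2} (\<lambda>_. obs_law (team2 G) D2 w) \<bind> action_law (team2 G) N2 \<gamma>2)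
        \<partial>(PiM {..<N1} (\<lambda>_. obs_law (team1 G) D1 w) \<bind> action_law (team1 G) N1 \<gamma>1))"
      unfolding h_def fst_conv snd_conv by (rule nn_integral_bind_pair[OF o1 o2 a1 a2 gw])
    also have "\<dots> = (\<integral>\<^sup>+u. \<integral>\<^sup>+v. ennreal (g w (u, v)) \<partial>profile_kernel (team2 G) D2 N2 \<gamma>2 w \<partial>profile_kernel (team1 G) D1 N1 \<gamma>1 w)"
      unfolding obs_law_PiM_bind_action_law[OF T(1) D1 \<gamma>1 w] obs_law_PiM_bind_action_law[OF T(2) D2 \<gamma>2 w] ..
    also have "\<dots> = (\<integral>\<^sup>+u. ennreal (g w u) \<partial>(profile_kernel (team1 G) D1 N1 \<gamma>1 w \<Otimes>\<^sub>M profile_kernel (team2 G) D2 N2 \<gamma>2 w))"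
      by (rule nn_integral_pair_prob(1)[symmetric, OF profile_kernel_prob[OF T(1) D1 w \<gamma>1] profile_kernel_prob[OF T(2) D2 w \<gamma>2] gw])
    finally show "(\<integral>\<^sup>+y. h (w, y) \<partial>cond_product_law G D1 D2 N1 N2 w)
        = (\<integral>\<^sup>+u. ennreal (g w u) \<partial>(profile_kernel (team1 G) D1 N1 \<gamma>1 w \<Otimes>\<^sub>M profile_kernel (team2 G) D2 N2 \<gamma>2 w))" .
  qed
  finally show ?thesis .
qed

text \<open>Once the integrand is jointly measurable in profiles and state, Tonelli moves the state
  to the outside, so that all later estimates can be made state by state.\<close>

theorem expected_cost_eq:
  fixes G :: "('s, 'w::polish_space, 'y1::euclidean_space, 'u1::euclidean_space, 'v1::euclidean_space,
    'y2::euclidean_space, 'u2::euclidean_space, 'v2::euclidean_space) game"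
  assumes G: "static_game G" and D1: "normalized_density (team1 G) (state_space G) D1"
    and D2: "normalized_density (team2 G) (state_space G) D2"
    and K: "cond_obs_law G N1 N2 K" "AE w in state_law G. K w = cond_product_law G D1 D2 N1 N2 w"
    and g: "cost_measurable G N1 N2 g"
    and P1: "P1 \<in> randomized (team1 G) {..<N1}" and P2: "P2 \<in> randomized (team2 G) {..<N2}"
  shows "expected_cost G N1 N2 g P1 P2
    = (\<integral>\<^sup>+w. \<integral>\<^sup>+u1. \<integral>\<^sup>+u2. ennreal (g w (u1, u2)) \<partial>mixture (team2 G) D2 N2 P2 w \<partial>mixture (team1 G) D1 N1 P1 w \<partial>state_law G)"
proof -
  let ?S = "borel_on (state_space G)"
  let ?A1 = "profile_space (team1 G) {..<N1}" and ?A2 = "profile_space (team2 G) {..<N2}"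
  let ?U1 = "action_profiles (team1 G) N1" and ?U2 = "action_profiles (team2 G) N2"
  let ?k1 = "profile_kernel (team1 G) D1 N1" and ?k2 = "profile_kernel (team2 G) D2 N2"
  note T = static_gameD(1,2)[OF G]
  note \<mu> = static_game_state_law[OF G]
  have p1: "P1 \<in> space (prob_algebra ?A1)" and p2: "P2 \<in> space (prob_algebra ?A2)"
    using P1 P2 unfolding randomized_def by auto
  have sp: "space P1 = space ?A1" "space P2 = space ?A2"
    using p1 p2 by (auto simp: space_prob_algebra dest: sets_eq_imp_space_eq)
  define X where "X z = (\<integral>\<^sup>+u. ennreal (g (snd z) u) \<partial>(?k1 (fst (fst z)) (snd z) \<Otimes>\<^sub>M ?k2 (snd (fst z)) (snd z)))" for z
  have X: "X \<in> borel_measurable ((?A1 \<Otimes>\<^sub>M ?A2) \<Otimes>\<^sub>M ?S)"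
    unfolding X_def[abs_def]
  proof (rule nn_integral_kernel_measurable)
    have "(\<lambda>z. (fst (fst z), snd z)) \<in> (?A1 \<Otimes>\<^sub>M ?A2) \<Otimes>\<^sub>M ?S \<rightarrow>\<^sub>M ?A1 \<Otimes>\<^sub>M ?S" by measurable
    from measurable_compose[OF this measurable_profile_kernel[OF T(1) D1]]
    have 1: "(\<lambda>z. ?k1 (fst (fst z)) (snd z)) \<in> (?A1 \<Otimes>\<^sub>M ?A2) \<Otimes>\<^sub>M ?S \<rightarrow>\<^sub>M prob_algebra ?U1" by simp
    have "(\<lambda>z. (snd (fst z), snd z)) \<in> (?A1 \<Otimes>\<^sub>M ?A2) \<Otimes>\<^sub>M ?S \<rightarrow>\<^sub>M ?A2 \<Otimes>\<^sub>M ?S" by measurable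
    from measurable_compose[OF this measurable_profile_kernel[OF T(2) D2]]
    have 2: "(\<lambda>z. ?k2 (snd (fst z)) (snd z)) \<in> (?A1 \<Otimes>\<^sub>M ?A2) \<Otimes>\<^sub>M ?S \<rightarrow>\<^sub>M prob_algebra ?U2" by simp
    show "(\<lambda>z. ?k1 (fst (fst z)) (snd z) \<Otimes>\<^sub>M ?k2 (snd (fst z)) (snd z)) \<in> (?A1 \<Otimes>\<^sub>M ?A2) \<Otimes>\<^sub>M ?S \<rightarrow>\<^sub>M prob_algebra (?U1 \<Otimes>\<^sub>M ?U2)"
      using 1 2 by (rule measurable_pair_prob)
    have "(\<lambda>q. (snd (fst q), snd q)) \<in> ((?A1 \<Otimes>\<^sub>M ?A2) \<Otimes>\<^sub>M ?S) \<Otimes>\<^sub>M (?U1 \<Otimes>\<^sub>M ?U2) \<rightarrow>\<^sub>M ?S \<Otimes>\<^sub>M (?U1 \<Otimes>\<^sub>M ?U2)" by measurable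
    from measurable_compose[OF this cost_measurable_pair[OF g]]
    show "(\<lambda>(z, u). ennreal (g (snd z) u)) \<in> borel_measurable (((?A1 \<Otimes>\<^sub>M ?A2) \<Otimes>\<^sub>M ?S) \<Otimes>\<^sub>M (?U1 \<Otimes>\<^sub>M ?U2))"
      by (simp add: case_prod_unfold)
  qed
  have Xr: "(\<lambda>q. X ((fst (fst q), snd q), snd (fst q))) \<in> borel_measurable ((?A1 \<Otimes>\<^sub>M ?S) \<Otimes>\<^sub>M ?A2)"
    by (rule measurable_compose[OF _ X]) measurable
  have X12: "(\<lambda>p. \<integral>\<^sup>+\<gamma>2. X ((fst p, \<gamma>2), snd p) \<partial>P2) \<in> borel_measurable (?A1 \<Otimes>\<^sub>M ?S)"
    by (rule nn_integral_kernel_measurable[where \<kappa>="\<lambda>_. P2" and N="?A2"])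
       (use p2 Xr in \<open>simp_all add: case_prod_unfold\<close>)
  have "expected_cost G N1 N2 g P1 P2 = (\<integral>\<^sup>+\<gamma>1. \<integral>\<^sup>+\<gamma>2. \<integral>\<^sup>+w. X ((\<gamma>1, \<gamma>2), w) \<partial>state_law G \<partial>P2 \<partial>P1)"
    unfolding expected_cost_def X_def fst_conv snd_conv
    by (intro nn_integral_cong pure_cost_eq[OF G D1 D2 K g]) (simp_all add: sp)
  also have "\<dots> = (\<integral>\<^sup>+\<gamma>1. \<integral>\<^sup>+w. \<integral>\<^sup>+\<gamma>2. X ((\<gamma>1, \<gamma>2), w) \<partial>P2 \<partial>state_law G \<partial>P1)"
  proof (rule nn_integral_cong)
    fix \<gamma>1 assume "\<gamma>1 \<in> space P1"
    then have "(\<lambda>q. X ((\<gamma>1, snd q), fst q)) \<in> borel_measurable (?S \<Otimes>\<^sub>M ?A2)"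
      using sp by (intro measurable_compose[OF _ X]) simp
    from nn_integral_pair_prob(2)[OF \<mu> p2 this]
    show "(\<integral>\<^sup>+\<gamma>2. \<integral>\<^sup>+w. X ((\<gamma>1, \<gamma>2), w) \<partial>state_law G \<partial>P2) = (\<integral>\<^sup>+w. \<integral>\<^sup>+\<gamma>2. X ((\<gamma>1, \<gamma>2), w) \<partial>P2 \<partial>state_law G)"
      by simp
  qed
  also have "\<dots> = (\<integral>\<^sup>+w. \<integral>\<^sup>+\<gamma>1. \<integral>\<^sup>+\<gamma>2. X ((\<gamma>1, \<gamma>2), w) \<partial>P2 \<partial>P1 \<partial>state_law G)"
    using nn_integral_pair_prob(2)[OF p1 \<mu> X12] by simp
  also have "\<dots> = (\<integral>\<^sup>+w. \<integral>\<^sup>+u1. \<integral>\<^sup>+u2. ennreal (g w (u1, u2)) \<partial>mixture (team2 G) D2 N2 P2 w \<partial>mixture (team1 G) D1 N1 P1 w \<partial>state_law G)"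
  proof (rule nn_integral_cong)
    fix w assume "w \<in> space (state_law G)"
    then have w: "w \<in> state_space G" using static_gameD(5)[OF G] by simp
    show "(\<integral>\<^sup>+\<gamma>1. \<integral>\<^sup>+\<gamma>2. X ((\<gamma>1, \<gamma>2), w) \<partial>P2 \<partial>P1)
        = (\<integral>\<^sup>+u1. \<integral>\<^sup>+u2. ennreal (g w (u1, u2)) \<partial>mixture (team2 G) D2 N2 P2 w \<partial>mixture (team1 G) D1 N1 P1 w)"
      unfolding X_def fst_conv snd_conv mixture_def
      by (rule nn_integral_bind_pair[OF p1 p2 measurable_profile_kernel_section[OF T(1) D1 w]
            measurable_profile_kernel_section[OF T(2) D2 w] cost_measurable_section[OF g w]])
  qed
  finally show ?thesis .
qed

section \<open>Randomised profiles and empirical costs\<close>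

lemma sets_profile_space_PiM:
  assumes "R \<in> space (prob_algebra (policy_space T))"
  shows "sets (PiM I (\<lambda>_. R)) = sets (profile_space T I)"
  unfolding profile_space_def by (rule sets_PiM_cong) (use assms in \<open>auto simp: space_prob_algebra\<close>)

lemma PiM_randomized:
  assumes "R \<in> space (prob_algebra (policy_space T))"
  shows "PiM I (\<lambda>_. R) \<in> randomized T I"
  using assms sets_profile_space_PiM[OF assms, of I] prob_space_PiM[of I "\<lambda>_. R"]
  by (auto simp: randomized_def space_prob_algebra)

lemma marginal_randomized:
  assumes "P \<in> randomized T UNIV"
  shows "marginal T N P \<in> randomized T {..<N}"
proof -
  have P: "prob_space P" "sets P = sets (profile_space T UNIV)"
    using assms by (auto simp: randomized_def space_prob_algebra)
  have "(\<lambda>\<gamma>. restrict \<gamma> {..<N}) \<in> P \<rightarrow>\<^sub>M profile_space T {..<N}"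
    using measurable_restrict_subset[of "{..<N}" UNIV "\<lambda>_. policy_space T"]
    by (simp cong: measurable_cong_sets add: P(2) profile_space_def)
  then show ?thesis using P(1)
    by (auto simp: randomized_def space_prob_algebra marginal_def intro: prob_space.prob_space_distr)
qed

lemma marginal_PiM:
  assumes R: "R \<in> space (prob_algebra (policy_space T))"
  shows "marginal T N (PiM UNIV (\<lambda>_. R)) = PiM {..<N} (\<lambda>_. R)"
proof -
  interpret prob_space R using R by (simp add: space_prob_algebra)
  interpret product_prob_space "\<lambda>_::nat. R" UNIV ..
  have "marginal T N (PiM UNIV (\<lambda>_. R)) = distr (PiM UNIV (\<lambda>_. R)) (PiM {..<N} (\<lambda>_. R)) (\<lambda>\<gamma>. restrict \<gamma> {..<N})"
    unfolding marginal_def by (rule distr_cong) (simp_all add: sets_profile_space_PiM[OF R])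
  also have "\<dots> = PiM {..<N} (\<lambda>_. R)" by (rule distr_PiM_restrict_finite) auto
  finally show ?thesis .
qed

text \<open>Taking the whole policy space beyond \<open>N\<close> turns the condition on all
  coordinates into one on the first \<open>N\<close>. The partial products are then constant from
  \<open>N\<close> on, so their limit is the finite product.\<close>

lemma private_symmetric_marginal:
  assumes "P \<in> private_symmetric T"
  obtains R where "R \<in> space (prob_algebra (policy_space T))" "\<And>N. marginal T N P = PiM {..<N} (\<lambda>_. R)"
proof -
  obtain R where P: "P \<in> randomized T UNIV" and R: "R \<in> space (prob_algebra (policy_space T))"
    and lim: "\<And>A. (\<And>k. A k \<in> sets (policy_space T)) \<Longrightarrow>
      (\<lambda>n. \<Prod>k<n. measure R (A k)) \<longlonglongrightarrow> measure P {\<gamma> \<in> space P. \<forall>k. \<gamma> k \<in> A k}"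
    using assms unfolding private_symmetric_def by blast
  interpret R: prob_space R using R by (simp add: space_prob_algebra)
  interpret P: prob_space P using P by (simp add: randomized_def space_prob_algebra)
  have sR: "sets R = sets (policy_space T)" "space R = space (policy_space T)"
    using R by (auto simp: space_prob_algebra dest: sets_eq_imp_space_eq)
  have sP: "sets P = sets (profile_space T UNIV)" "space P = space (profile_space T UNIV)"
    using P by (auto simp: randomized_def space_prob_algebra dest: sets_eq_imp_space_eq)
  have "marginal T N P = PiM {..<N} (\<lambda>_. R)" for N
  proof (rule PiM_eqI_prob)
    show "sets (marginal T N P) = sets (PiM {..<N} (\<lambda>_. R))"
      by (simp add: marginal_def sets_profile_space_PiM[OF R])
    fix A assume "\<And>i. i \<in> {..<N} \<Longrightarrow> A i \<in> sets R"
    then have A: "\<And>i. i < N \<Longrightarrow> A i \<in> sets (policy_space T)" using sR by simp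
    define A' where "A' k = (if k < N then A k else space (policy_space T))" for k
    have A': "A' k \<in> sets (policy_space T)" for k using A by (simp add: A'_def)
    have "(\<Prod>k<n. measure R (A' k)) = (\<Prod>k<N. measure R (A k))" if "N \<le> n" for n
    proof -
      have "(\<Prod>k<n. measure R (A' k)) = (\<Prod>k<N. measure R (A' k))"
        by (rule prod.mono_neutral_right) (use that R.prob_space sR(2) in \<open>auto simp: A'_def\<close>)
      then show ?thesis by (simp add: A'_def)
    qed
    then have "(\<lambda>n. \<Prod>k<n. measure R (A' k)) \<longlonglongrightarrow> (\<Prod>k<N. measure R (A k))"
      by (intro tendsto_eventually) (auto simp: eventually_sequentially)
    from LIMSEQ_unique[OF lim[OF A'] this]
    have m: "measure P {\<gamma> \<in> space P. \<forall>k. \<gamma> k \<in> A' k} = (\<Prod>k<N. measure R (A k))" .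
    have meas: "(\<lambda>\<gamma>. restrict \<gamma> {..<N}) \<in> P \<rightarrow>\<^sub>M profile_space T {..<N}"
      using measurable_restrict_subset[of "{..<N}" UNIV "\<lambda>_. policy_space T"]
      by (simp cong: measurable_cong_sets add: sP(1) profile_space_def)
    have "PiE {..<N} A \<in> sets (profile_space T {..<N})"
      unfolding profile_space_def using A by (intro sets_PiM_I_finite) auto
    then have "emeasure (marginal T N P) (PiE {..<N} A) = emeasure P ((\<lambda>\<gamma>. restrict \<gamma> {..<N}) -` PiE {..<N} A \<inter> space P)"
      unfolding marginal_def by (rule emeasure_distr[OF meas])
    also have "(\<lambda>\<gamma>. restrict \<gamma> {..<N}) -` PiE {..<N} A \<inter> space P = {\<gamma> \<in> space P. \<forall>k. \<gamma> k \<in> A' k}"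
      unfolding sP(2) by (auto simp: A'_def profile_space_def space_PiM PiE_def Pi_def restrict_def extensional_def split: if_splits)
    also have "emeasure P \<dots> = (\<Prod>k<N. emeasure R (A k))"
      unfolding P.emeasure_eq_measure m R.emeasure_eq_measure by (simp add: prod_ennreal)
    finally show "emeasure (marginal T N P) (PiE {..<N} A) = (\<Prod>k<N. emeasure R (A k))" .
  qed (auto intro: R.prob_space_axioms)
  then show thesis using that R by blast
qed

lemma borel_cost_section:
  fixes W :: "'w::polish_space set" and U :: "'u::euclidean_space set"
    and V1 :: "'v1::euclidean_space set" and V2 :: "'v2::euclidean_space set"
  assumes c: "borel_cost W U V1 V2 c" and "w \<in> W" "v1 \<in> V1" "v2 \<in> V2"
  shows "(\<lambda>u. c w u v1 v2) \<in> borel_measurable (borel_on U)"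
proof -
  have "(\<lambda>u. (w, u, v1, v2)) \<in> borel_on U \<rightarrow>\<^sub>M borel_on (W \<times> U \<times> V1 \<times> V2)"
    by (intro measurable_borel_on_pairI measurable_const) (use assms in auto)
  moreover have "(\<lambda>(w, u, v1, v2). c w u v1 v2) \<in> borel_measurable (borel_on (W \<times> U \<times> V1 \<times> V2))"
    using c unfolding borel_cost_def by blast
  ultimately have "(\<lambda>u. case (w, u, v1, v2) of (w, u, v1, v2) \<Rightarrow> c w u v1 v2) \<in> borel_measurable (borel_on U)"
    by (rule measurable_compose)
  then show ?thesis by simp
qed

lemma mean_field_cost_empirical:
  fixes W :: "'w::polish_space set" and U :: "'u::euclidean_space set"
    and V1 :: "'v1::euclidean_space set" and V2 :: "'v2::euclidean_space set"
  assumes c: "borel_cost W U V1 V2 c" and w: "w \<in> W"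
    and \<Xi>1: "continuous_map (weak_topology U) (top_of_set V1) \<Xi>1" and \<Xi>2: "continuous_map (weak_topology U2) (top_of_set V2) \<Xi>2"
    and N: "0 < N1" and u: "\<And>k. k < N1 \<Longrightarrow> u k \<in> U" and \<sigma>: "\<sigma> \<in> prob_measures U2"
  shows "mean_field_cost \<Xi>1 \<Xi>2 (c w) (empirical U N1 u) \<sigma>
    = (\<Sum>k<N1. c w (u k) (\<Xi>1 (empirical U N1 u)) (\<Xi>2 \<sigma>)) / real N1"
  unfolding mean_field_cost_def
  by (intro integral_empirical N u borel_cost_section[OF c w] weakly_continuous_range[OF \<Xi>1]
      weakly_continuous_range[OF \<Xi>2] empirical_in_prob_measures \<sigma>)

text \<open>At empirical measures the cost is a finite sum over coordinates, so measurability
  reduces to that of the cost function and of the statistics as functions of the action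
  profile.\<close>

lemma measurable_empirical_cost:
  fixes W :: "'w::polish_space set" and U1 :: "'u1::euclidean_space set" and U2 :: "'u2::euclidean_space set"
    and V1 :: "'v1::euclidean_space set" and V2 :: "'v2::euclidean_space set"
  assumes c: "borel_cost W U1 V1 V2 c"
    and \<Xi>1: "continuous_map (weak_topology U1) (top_of_set V1) \<Xi>1" and \<Xi>2: "continuous_map (weak_topology U2) (top_of_set V2) \<Xi>2"
    and N: "0 < N1" "0 < N2"
  shows "(\<lambda>(w, u1, u2). mean_field_cost \<Xi>1 \<Xi>2 (c w) (empirical U1 N1 u1) (empirical U2 N2 u2))
    \<in> borel_measurable (borel_on W \<Otimes>\<^sub>M (PiM {..<N1} (\<lambda>_. borel_on U1) \<Otimes>\<^sub>M PiM {..<N2} (\<lambda>_. borel_on U2)))"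
proof -
  let ?A = "PiM {..<N1} (\<lambda>_. borel_on U1)" and ?B = "PiM {..<N2} (\<lambda>_. borel_on U2)"
  let ?M = "borel_on W \<Otimes>\<^sub>M (?A \<Otimes>\<^sub>M ?B)"
  have cm: "(\<lambda>(w, u, v1, v2). c w u v1 v2) \<in> borel_measurable (borel_on (W \<times> U1 \<times> V1 \<times> V2))"
    using c unfolding borel_cost_def by blast
  have e1: "empirical U1 N1 u \<in> prob_measures U1" if "u \<in> space ?A" for u
    by (rule empirical_in_prob_measures[OF N(1)]) (use that in \<open>auto simp: space_PiM PiE_def Pi_def\<close>)
  have e2: "empirical U2 N2 u \<in> prob_measures U2" if "u \<in> space ?B" for u
    by (rule empirical_in_prob_measures[OF N(2)]) (use that in \<open>auto simp: space_PiM PiE_def Pi_def\<close>)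
  have s1: "(\<lambda>u. \<Xi>1 (empirical U1 N1 u)) \<in> ?A \<rightarrow>\<^sub>M borel_on V1"
    by (rule measurable_borel_onI[OF measurable_stat_empirical[OF \<Xi>1 N(1)] weakly_continuous_range[OF \<Xi>1 e1]])
  have s2: "(\<lambda>u. \<Xi>2 (empirical U2 N2 u)) \<in> ?B \<rightarrow>\<^sub>M borel_on V2"
    by (rule measurable_borel_onI[OF measurable_stat_empirical[OF \<Xi>2 N(2)] weakly_continuous_range[OF \<Xi>2 e2]])
  have summand: "(\<lambda>p. c (fst p) (fst (snd p) k) (\<Xi>1 (empirical U1 N1 (fst (snd p)))) (\<Xi>2 (empirical U2 N2 (snd (snd p)))))
      \<in> borel_measurable ?M" if k: "k < N1" for k
  proof -
    have "(\<lambda>u. u k) \<in> ?A \<rightarrow>\<^sub>M borel_on U1" using k by (intro measurable_component_singleton) auto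
    then have "(\<lambda>p. (fst p, fst (snd p) k, \<Xi>1 (empirical U1 N1 (fst (snd p))), \<Xi>2 (empirical U2 N2 (snd (snd p)))))
        \<in> ?M \<rightarrow>\<^sub>M borel_on (W \<times> U1 \<times> V1 \<times> V2)"
      by (intro measurable_borel_on_pairI measurable_compose[OF _ s1] measurable_compose[OF _ s2])
        (rule measurable_fst measurable_compose[OF measurable_snd] measurable_compose[OF measurable_fst] measurable_snd | assumption)+
    from measurable_compose[OF this cm] show ?thesis by simp
  qed
  have "(\<lambda>p. (\<Sum>k<N1. c (fst p) (fst (snd p) k) (\<Xi>1 (empirical U1 N1 (fst (snd p)))) (\<Xi>2 (empirical U2 N2 (snd (snd p))))) / real N1)
      \<in> borel_measurable ?M"
    by (intro borel_measurable_divide borel_measurable_sum summand) auto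
  moreover have "mean_field_cost \<Xi>1 \<Xi>2 (c (fst p)) (empirical U1 N1 (fst (snd p))) (empirical U2 N2 (snd (snd p)))
      = (\<Sum>k<N1. c (fst p) (fst (snd p) k) (\<Xi>1 (empirical U1 N1 (fst (snd p)))) (\<Xi>2 (empirical U2 N2 (snd (snd p))))) / real N1"
    if "p \<in> space ?M" for p
  proof (rule mean_field_cost_empirical[OF c _ \<Xi>1 \<Xi>2 N(1)])
    show "fst p \<in> W" using that by (auto simp: space_pair_measure)
    show "fst (snd p) k \<in> U1" if "k < N1" for k
      using that \<open>p \<in> space ?M\<close> by (auto simp: space_pair_measure space_PiM PiE_def Pi_def)
    show "empirical U2 N2 (snd (snd p)) \<in> prob_measures U2"
      by (rule e2) (use that in \<open>auto simp: space_pair_measure\<close>)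
  qed
  ultimately show ?thesis by (subst measurable_cong[where g="\<lambda>p. _ p"]) (auto simp: case_prod_unfold)
qed

section \<open>Deviations in large games\<close>

text \<open>The game as one team sees it when its opponents draw their actions independently from
  \<open>\<sigma> w\<close> given the state. Team 1 of the locale is the deviating one, whichever
  team of the game it stands for.\<close>

locale mean_field_limit =
  fixes \<mu> :: "'w::polish_space measure" and W :: "'w set"
    and U1 :: "'u1::euclidean_space set" and U2 :: "'u2::euclidean_space set"
    and V1 :: "'v1::euclidean_space set" and V2 :: "'v2::euclidean_space set"
    and \<Xi>1 :: "'u1 measure \<Rightarrow> 'v1" and \<Xi>2 :: "'u2 measure \<Rightarrow> 'v2"
    and c :: "'w \<Rightarrow> 'u1 \<Rightarrow> 'v1 \<Rightarrow> 'v2 \<Rightarrow> real" and h :: "'w \<Rightarrow> real"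
    and N1 N2 :: "nat \<Rightarrow> nat" and \<sigma> :: "'w \<Rightarrow> 'u2 measure"
  assumes \<mu>: "\<mu> \<in> space (prob_algebra (borel_on W))"
    and U1: "compact U1" and U2: "compact U2"
    and \<Xi>1: "continuous_map (weak_topology U1) (top_of_set V1) \<Xi>1"
    and \<Xi>2: "continuous_map (weak_topology U2) (top_of_set V2) \<Xi>2"
    and c: "borel_cost W U1 V1 V2 c" "continuous_cost W U1 V1 V2 c"
    and h: "integrable \<mu> h"
    and h_bound: "\<And>w u \<tau> \<rho>. w \<in> W \<Longrightarrow> u \<in> U1 \<Longrightarrow> \<tau> \<in> prob_measures U1 \<Longrightarrow> \<rho> \<in> prob_measures U2 \<Longrightarrow>
      c w u (\<Xi>1 \<tau>) (\<Xi>2 \<rho>) \<le> h w"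
    and N_pos: "\<And>n. 0 < N1 n" "\<And>n. 0 < N2 n"
    and N_lim: "filterlim N1 at_top sequentially" "filterlim N2 at_top sequentially"
    and \<sigma>: "\<sigma> \<in> borel_on W \<rightarrow>\<^sub>M prob_algebra (borel_on U2)"
begin

definition \<Phi> :: "'w \<Rightarrow> 'u1 measure \<Rightarrow> 'u2 measure \<Rightarrow> real" where
  "\<Phi> w = mean_field_cost \<Xi>1 \<Xi>2 (c w)"

definition sample_cost :: "nat \<Rightarrow> 'w \<Rightarrow> (nat \<Rightarrow> 'u1) \<Rightarrow> (nat \<Rightarrow> 'u2) \<Rightarrow> real" where
  "sample_cost n w u1 u2 = \<Phi> w (empirical U1 (N1 n) u1) (empirical U2 (N2 n) u2)"

definition mean_cost :: "nat \<Rightarrow> (nat \<Rightarrow> 'u1 measure) \<Rightarrow> 'w \<Rightarrow> real" where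
  "mean_cost n \<tau> w = (\<integral>(u1, u2). sample_cost n w u1 u2 \<partial>(PiM {..<N1 n} \<tau> \<Otimes>\<^sub>M PiM {..<N2 n} (\<lambda>_. \<sigma> w)))"

definition cost_given_actions :: "nat \<Rightarrow> 'w \<Rightarrow> (nat \<Rightarrow> 'u1) \<Rightarrow> ennreal" where
  "cost_given_actions n w u1 = (\<integral>\<^sup>+u2. ennreal (sample_cost n w u1 u2) \<partial>PiM {..<N2 n} (\<lambda>_. \<sigma> w))"

lemma \<mu>_facts: "prob_space \<mu>" "sets \<mu> = sets (borel_on W)" "space \<mu> = W"
  using \<mu> prob_measuresD[of \<mu> W] by (simp_all add: prob_measures_def)

lemma \<sigma>_prob: "w \<in> W \<Longrightarrow> \<sigma> w \<in> prob_measures U2"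
  using measurable_space[OF \<sigma>, of w] by (simp add: prob_measures_def)

lemma \<Phi>_bounds:
  assumes w: "w \<in> W" and \<tau>: "\<tau> \<in> prob_measures U1" and \<rho>: "\<rho> \<in> prob_measures U2"
  shows "0 \<le> \<Phi> w \<tau> \<rho> \<and> \<Phi> w \<tau> \<rho> \<le> h w"
proof -
  interpret \<tau>: prob_space \<tau> using prob_measuresD(1)[OF \<tau>] .
  have v: "\<Xi>1 \<tau> \<in> V1" "\<Xi>2 \<rho> \<in> V2" using weakly_continuous_range[OF \<Xi>1 \<tau>] weakly_continuous_range[OF \<Xi>2 \<rho>] .
  have pos: "0 \<le> c w u (\<Xi>1 \<tau>) (\<Xi>2 \<rho>)" if "u \<in> U1" for u
    using c(1) w v that unfolding borel_cost_def by blast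
  have le: "c w u (\<Xi>1 \<tau>) (\<Xi>2 \<rho>) \<le> h w" if "u \<in> U1" for u using h_bound[OF w that \<tau> \<rho>] .
  have "(\<lambda>u. c w u (\<Xi>1 \<tau>) (\<Xi>2 \<rho>)) \<in> borel_measurable \<tau>"
    using borel_cost_section[OF c(1) w v] by (simp cong: measurable_cong_sets add: prob_measuresD(2)[OF \<tau>])
  then have "integrable \<tau> (\<lambda>u. c w u (\<Xi>1 \<tau>) (\<Xi>2 \<rho>))"
    by (intro \<tau>.integrable_const_bound[where B="h w"]) (use pos le prob_measuresD(3)[OF \<tau>] in auto)
  moreover have "AE u in \<tau>. c w u (\<Xi>1 \<tau>) (\<Xi>2 \<rho>) \<le> h w"
    using le prob_measuresD(3)[OF \<tau>] by (intro AE_I2) simp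
  ultimately have "\<Phi> w \<tau> \<rho> \<le> h w" unfolding \<Phi>_def mean_field_cost_def by (rule \<tau>.integral_le_const)
  moreover have "0 \<le> \<Phi> w \<tau> \<rho>" unfolding \<Phi>_def mean_field_cost_def
    by (rule Bochner_Integration.integral_nonneg) (use pos prob_measuresD(3)[OF \<tau>] in auto)
  ultimately show ?thesis by simp
qed

lemma measurable_sample_cost:
  "(\<lambda>(w, u1, u2). sample_cost n w u1 u2)
    \<in> borel_measurable (borel_on W \<Otimes>\<^sub>M (PiM {..<N1 n} (\<lambda>_. borel_on U1) \<Otimes>\<^sub>M PiM {..<N2 n} (\<lambda>_. borel_on U2)))"
  using measurable_empirical_cost[OF c(1) \<Xi>1 \<Xi>2 N_pos(1)[of n] N_pos(2)[of n]]
  unfolding sample_cost_def \<Phi>_def .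

lemma measurable_sample_cost_section:
  assumes w: "w \<in> W"
  shows "(\<lambda>(u1, u2). sample_cost n w u1 u2)
    \<in> borel_measurable (PiM {..<N1 n} (\<lambda>_. borel_on U1) \<Otimes>\<^sub>M PiM {..<N2 n} (\<lambda>_. borel_on U2))"
proof -
  have "Pair w \<in> PiM {..<N1 n} (\<lambda>_. borel_on U1) \<Otimes>\<^sub>M PiM {..<N2 n} (\<lambda>_. borel_on U2) \<rightarrow>\<^sub>M
      borel_on W \<Otimes>\<^sub>M (PiM {..<N1 n} (\<lambda>_. borel_on U1) \<Otimes>\<^sub>M PiM {..<N2 n} (\<lambda>_. borel_on U2))"
    by (rule measurable_Pair1') (use w in simp)
  from measurable_compose[OF this measurable_sample_cost] show ?thesis by (simp add: case_prod_unfold)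
qed

lemma PiM_in_prob_algebra:
  assumes "\<And>k. k < N \<Longrightarrow> \<tau> k \<in> prob_measures U"
  shows "PiM {..<N} \<tau> \<in> space (prob_algebra (PiM {..<N::nat} (\<lambda>_. borel_on U)))"
  using assms prob_space_PiM[of "{..<N}" \<tau>] sets_PiM_cong[of "{..<N}" "{..<N}" \<tau> "\<lambda>_. borel_on U"]
  by (auto simp: space_prob_algebra mem_prob_measures)

lemma sample_cost_bounds:
  assumes w: "w \<in> W" and "u1 \<in> space (PiM {..<N1 n} (\<lambda>_. borel_on U1))" "u2 \<in> space (PiM {..<N2 n} (\<lambda>_. borel_on U2))"
  shows "0 \<le> sample_cost n w u1 u2 \<and> sample_cost n w u1 u2 \<le> h w"
  unfolding sample_cost_def
  by (intro \<Phi>_bounds w empirical_in_prob_measures N_pos) (use assms in \<open>auto simp: space_PiM PiE_def Pi_def\<close>)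

text \<open>The bound by \<open>h w\<close> makes the sample cost integrable, so the extended
  integral that defines expected costs and the real integral used in limit theorems agree.\<close>

lemma mean_cost_nn_integral:
  assumes w: "w \<in> W" and \<tau>: "\<And>k. k < N1 n \<Longrightarrow> \<tau> k \<in> prob_measures U1"
  shows "(\<integral>\<^sup>+u1. cost_given_actions n w u1 \<partial>PiM {..<N1 n} \<tau>) = ennreal (mean_cost n \<tau> w)"
    and "0 \<le> mean_cost n \<tau> w" "mean_cost n \<tau> w \<le> h w"
proof -
  let ?A = "PiM {..<N1 n} (\<lambda>_. borel_on U1)" and ?B = "PiM {..<N2 n} (\<lambda>_. borel_on U2)"
  let ?P = "PiM {..<N1 n} \<tau> \<Otimes>\<^sub>M PiM {..<N2 n} (\<lambda>_. \<sigma> w)"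
  let ?g = "\<lambda>p. sample_cost n w (fst p) (snd p)"
  have a: "PiM {..<N1 n} \<tau> \<in> space (prob_algebra ?A)" by (rule PiM_in_prob_algebra[OF \<tau>])
  have b: "PiM {..<N2 n} (\<lambda>_. \<sigma> w) \<in> space (prob_algebra ?B)" by (rule PiM_in_prob_algebra[OF \<sigma>_prob[OF w]])
  have sP: "sets ?P = sets (?A \<Otimes>\<^sub>M ?B)" using a b by (intro sets_pair_measure_cong) (auto simp: space_prob_algebra)
  interpret P: prob_space ?P by (rule prob_space_pair) (use a b in \<open>auto simp: space_prob_algebra\<close>)
  have spP: "space ?P = space ?A \<times> space ?B" using sets_eq_imp_space_eq[OF sP] by (simp add: space_pair_measure)
  have gm: "?g \<in> borel_measurable (?A \<Otimes>\<^sub>M ?B)" using measurable_sample_cost_section[OF w] by (simp add: case_prod_unfold)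
  then have gm': "?g \<in> borel_measurable ?P" by (simp only: measurable_cong_sets[OF sP refl])
  have bd: "0 \<le> ?g p \<and> ?g p \<le> h w" if "p \<in> space ?P" for p
    using sample_cost_bounds[OF w] that unfolding spP by auto
  have ig: "integrable ?P ?g"
    by (rule P.integrable_const_bound[where B="h w", OF _ gm']) (use bd in auto)
  have eq: "mean_cost n \<tau> w = integral\<^sup>L ?P ?g" unfolding mean_cost_def by (simp add: case_prod_unfold)
  have "(\<lambda>p. ennreal (?g p)) \<in> borel_measurable (?A \<Otimes>\<^sub>M ?B)" using gm by measurable
  from nn_integral_pair_prob(1)[OF a b this]
  have "(\<integral>\<^sup>+u1. cost_given_actions n w u1 \<partial>PiM {..<N1 n} \<tau>) = (\<integral>\<^sup>+p. ennreal (?g p) \<partial>?P)"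
    unfolding cost_given_actions_def by simp
  also have "\<dots> = ennreal (mean_cost n \<tau> w)" unfolding eq
    by (rule nn_integral_eq_integral[OF ig]) (use bd in auto)
  finally show "(\<integral>\<^sup>+u1. cost_given_actions n w u1 \<partial>PiM {..<N1 n} \<tau>) = ennreal (mean_cost n \<tau> w)" .
  show "0 \<le> mean_cost n \<tau> w" unfolding eq by (rule Bochner_Integration.integral_nonneg) (use bd in auto)
  show "mean_cost n \<tau> w \<le> h w" unfolding eq
    by (rule P.integral_le_const[OF ig]) (use bd in auto)
qed

lemma measurable_cost_given_actions:
  "(\<lambda>(w, u1). cost_given_actions n w u1) \<in> borel_measurable (borel_on W \<Otimes>\<^sub>M PiM {..<N1 n} (\<lambda>_. borel_on U1))"
proof -
  let ?A = "PiM {..<N1 n} (\<lambda>_. borel_on U1)" and ?B = "PiM {..<N2 n} (\<lambda>_. borel_on U2)"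
  have "(\<lambda>p. PiM {..<N2 n} (\<lambda>_. \<sigma> (fst p))) \<in> borel_on W \<Otimes>\<^sub>M ?A \<rightarrow>\<^sub>M prob_algebra ?B"
    by (rule measurable_PiM_kernel) (auto intro: measurable_compose[OF measurable_fst \<sigma>])
  moreover have "(\<lambda>q. sample_cost n (fst (fst q)) (snd (fst q)) (snd q)) \<in> borel_measurable ((borel_on W \<Otimes>\<^sub>M ?A) \<Otimes>\<^sub>M ?B)"
  proof -
    have "(\<lambda>q. (fst (fst q), snd (fst q), snd q)) \<in> (borel_on W \<Otimes>\<^sub>M ?A) \<Otimes>\<^sub>M ?B \<rightarrow>\<^sub>M borel_on W \<Otimes>\<^sub>M (?A \<Otimes>\<^sub>M ?B)"
      by measurable
    from measurable_compose[OF this measurable_sample_cost] show ?thesis by simp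
  qed
  then have "(\<lambda>(p, u2). ennreal (sample_cost n (fst p) (snd p) u2)) \<in> borel_measurable ((borel_on W \<Otimes>\<^sub>M ?A) \<Otimes>\<^sub>M ?B)"
    unfolding case_prod_unfold by measurable
  ultimately have "(\<lambda>p. cost_given_actions n (fst p) (snd p)) \<in> borel_measurable (borel_on W \<Otimes>\<^sub>M ?A)"
    unfolding cost_given_actions_def by (rule nn_integral_kernel_measurable)
  then show ?thesis by (simp add: case_prod_unfold)
qed

lemma measurable_mean_cost:
  assumes \<tau>: "\<And>k. \<tau> k \<in> borel_on W \<rightarrow>\<^sub>M prob_algebra (borel_on U1)"
  shows "(\<lambda>w. mean_cost n (\<lambda>k. \<tau> k w) w) \<in> borel_measurable (borel_on W)"
proof -
  have "(\<lambda>w. PiM {..<N1 n} (\<lambda>k. \<tau> k w)) \<in> borel_on W \<rightarrow>\<^sub>M prob_algebra (PiM {..<N1 n} (\<lambda>_. borel_on U1))"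
    by (rule measurable_PiM_kernel) (auto intro: \<tau>)
  then have "(\<lambda>w. \<integral>\<^sup>+u1. cost_given_actions n w u1 \<partial>PiM {..<N1 n} (\<lambda>k. \<tau> k w)) \<in> borel_measurable (borel_on W)"
    using measurable_cost_given_actions by (rule nn_integral_kernel_measurable)
  then have "(\<lambda>w. enn2real (\<integral>\<^sup>+u1. cost_given_actions n w u1 \<partial>PiM {..<N1 n} (\<lambda>k. \<tau> k w))) \<in> borel_measurable (borel_on W)"
    by (rule borel_measurable_enn2real)
  moreover have "enn2real (\<integral>\<^sup>+u1. cost_given_actions n w u1 \<partial>PiM {..<N1 n} (\<lambda>k. \<tau> k w)) = mean_cost n (\<lambda>k. \<tau> k w) w"
    if "w \<in> space (borel_on W)" for w
    using mean_cost_nn_integral[of w n "\<lambda>k. \<tau> k w"] that measurable_space[OF \<tau>] by (simp add: prob_measures_def)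
  ultimately show ?thesis by (subst measurable_cong) (auto simp flip: \<open>\<And>w. _ \<Longrightarrow> _\<close>)
qed

text \<open>The opponents' laws are the same for all indices, so their average is
  \<open>\<sigma> w\<close>; at a fixed state \<open>h w\<close> is the constant bound that the law
  of large numbers asks for.\<close>

lemma mean_cost_pointwise_limit:
  assumes w: "w \<in> W" and \<tau>: "\<And>n k. \<tau> n k \<in> prob_measures U1" and \<tau>': "\<And>n. \<tau>' n \<in> prob_measures U1"
    and avg: "\<And>n f. continuous_on U1 f \<Longrightarrow> integral\<^sup>L (\<tau>' n) f = (\<Sum>k<N1 n. integral\<^sup>L (\<tau> n k) f) / real (N1 n)"
  shows "(\<lambda>n. mean_cost n (\<tau> n) w - \<Phi> w (\<tau>' n) (\<sigma> w)) \<longlonglongrightarrow> 0"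
  unfolding mean_cost_def sample_cost_def \<Phi>_def
proof (rule expected_mean_field_cost_tendsto[OF U1 U2 \<Xi>1 \<Xi>2, where \<sigma>="\<lambda>_ _. \<sigma> w" and \<sigma>'="\<lambda>_. \<sigma> w" and H="h w"])
  show "continuous_on (U1 \<times> V1 \<times> V2) (\<lambda>(u, v1, v2). c w u v1 v2)"
    using c(2) w unfolding continuous_cost_def by blast
  show "0 \<le> mean_field_cost \<Xi>1 \<Xi>2 (c w) \<tau> \<rho> \<and> mean_field_cost \<Xi>1 \<Xi>2 (c w) \<tau> \<rho> \<le> h w"
    if "\<tau> \<in> prob_measures U1" "\<rho> \<in> prob_measures U2" for \<tau> \<rho>
    using \<Phi>_bounds[OF w that] unfolding \<Phi>_def .
  show "(\<lambda>(u1, u2). mean_field_cost \<Xi>1 \<Xi>2 (c w) (empirical U1 (N1 n) u1) (empirical U2 (N2 n) u2))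
      \<in> borel_measurable (PiM {..<N1 n} (\<lambda>_. borel_on U1) \<Otimes>\<^sub>M PiM {..<N2 n} (\<lambda>_. borel_on U2))" for n
    using measurable_sample_cost_section[OF w, of n] unfolding sample_cost_def \<Phi>_def .
  show "integral\<^sup>L (\<sigma> w) f = (\<Sum>k<N2 n. integral\<^sup>L (\<sigma> w) f) / real (N2 n)" for n f
    using N_pos(2)[of n] by simp
qed (use N_pos N_lim \<tau> \<tau>' avg \<sigma>_prob[OF w] in auto)

text \<open>When the whole team draws from \<open>\<kappa> w\<close>, the mean costs are measurable
  in the state and converge to this value. The limit bypasses the question of how the statistics,
  which are only weakly continuous, depend measurably on measures.\<close>

lemma measurable_\<Phi>:
  assumes \<kappa>: "\<kappa> \<in> borel_on W \<rightarrow>\<^sub>M prob_algebra (borel_on U1)"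
  shows "(\<lambda>w. \<Phi> w (\<kappa> w) (\<sigma> w)) \<in> borel_measurable (borel_on W)"
proof (rule borel_measurable_LIMSEQ_real)
  show "(\<lambda>w. mean_cost n (\<lambda>_. \<kappa> w) w) \<in> borel_measurable (borel_on W)" for n
    by (rule measurable_mean_cost[OF \<kappa>])
  fix w assume "w \<in> space (borel_on W)"
  then have w: "w \<in> W" and \<kappa>w: "\<kappa> w \<in> prob_measures U1"
    using measurable_space[OF \<kappa>] by (auto simp: prob_measures_def)
  have "(\<lambda>n. mean_cost n (\<lambda>_. \<kappa> w) w - \<Phi> w (\<kappa> w) (\<sigma> w)) \<longlonglongrightarrow> 0"
    by (rule mean_cost_pointwise_limit[OF w]) (use \<kappa>w N_pos in auto)
  then show "(\<lambda>n. mean_cost n (\<lambda>_. \<kappa> w) w) \<longlonglongrightarrow> \<Phi> w (\<kappa> w) (\<sigma> w)" by (simp add: LIM_zero_iff)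
qed

definition limit_cost :: "('w \<Rightarrow> 'u1 measure) \<Rightarrow> real" where
  "limit_cost \<kappa> = (\<integral>w. \<Phi> w (\<kappa> w) (\<sigma> w) \<partial>\<mu>)"

definition total_cost :: "nat \<Rightarrow> (nat \<Rightarrow> 'w \<Rightarrow> 'u1 measure) \<Rightarrow> real" where
  "total_cost n \<tau> = (\<integral>w. mean_cost n (\<lambda>k. \<tau> k w) w \<partial>\<mu>)"

lemma kernel_prob_measures:
  "\<kappa> \<in> borel_on W \<rightarrow>\<^sub>M prob_algebra (borel_on U1) \<Longrightarrow> w \<in> W \<Longrightarrow> \<kappa> w \<in> prob_measures U1"
  using measurable_space[of \<kappa> "borel_on W" "prob_algebra (borel_on U1)" w] by (simp add: prob_measures_def)

lemma borel_measurable_\<mu>: "f \<in> borel_measurable (borel_on W) \<Longrightarrow> f \<in> borel_measurable \<mu>"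
  by (simp only: measurable_cong_sets[OF \<mu>_facts(2) refl])

lemma integrable_mean_cost:
  assumes \<tau>: "\<And>k. \<tau> k \<in> borel_on W \<rightarrow>\<^sub>M prob_algebra (borel_on U1)"
  shows "integrable \<mu> (\<lambda>w. mean_cost n (\<lambda>k. \<tau> k w) w)"
proof (rule Bochner_Integration.integrable_bound[OF h])
  show "AE w in \<mu>. norm (mean_cost n (\<lambda>k. \<tau> k w) w) \<le> norm (h w)"
  proof (rule AE_I2)
    fix w assume "w \<in> space \<mu>"
    then have w: "w \<in> W" using \<mu>_facts(3) by simp
    show "norm (mean_cost n (\<lambda>k. \<tau> k w) w) \<le> norm (h w)"
      using mean_cost_nn_integral(2,3)[OF w, of n "\<lambda>k. \<tau> k w"] kernel_prob_measures[OF \<tau> w] by simp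
  qed
qed (rule borel_measurable_\<mu>[OF measurable_mean_cost[OF \<tau>]])

lemma nn_integral_total_cost:
  assumes \<tau>: "\<And>k. \<tau> k \<in> borel_on W \<rightarrow>\<^sub>M prob_algebra (borel_on U1)"
  shows "(\<integral>\<^sup>+w. \<integral>\<^sup>+u1. cost_given_actions n w u1 \<partial>PiM {..<N1 n} (\<lambda>k. \<tau> k w) \<partial>\<mu>) = ennreal (total_cost n \<tau>)"
    and "0 \<le> total_cost n \<tau>"
proof -
  have "(\<integral>\<^sup>+w. \<integral>\<^sup>+u1. cost_given_actions n w u1 \<partial>PiM {..<N1 n} (\<lambda>k. \<tau> k w) \<partial>\<mu>) = (\<integral>\<^sup>+w. ennreal (mean_cost n (\<lambda>k. \<tau> k w) w) \<partial>\<mu>)"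
    by (intro nn_integral_cong mean_cost_nn_integral(1) kernel_prob_measures \<tau>) (simp_all add: \<mu>_facts(3))
  also have "\<dots> = ennreal (total_cost n \<tau>)" unfolding total_cost_def
    by (rule nn_integral_eq_integral[OF integrable_mean_cost[OF \<tau>]])
       (auto intro!: AE_I2 mean_cost_nn_integral(2) kernel_prob_measures \<tau> simp: \<mu>_facts(3))
  finally show "(\<integral>\<^sup>+w. \<integral>\<^sup>+u1. cost_given_actions n w u1 \<partial>PiM {..<N1 n} (\<lambda>k. \<tau> k w) \<partial>\<mu>) = ennreal (total_cost n \<tau>)" .
  show "0 \<le> total_cost n \<tau>" unfolding total_cost_def
    by (rule Bochner_Integration.integral_nonneg)
       (auto intro!: mean_cost_nn_integral(2) kernel_prob_measures \<tau> simp: \<mu>_facts(3))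
qed

text \<open>The law of large numbers holds at each state separately, with no rate uniform in the
  state; dominated convergence with the envelope \<open>h\<close> carries it to the
  integral.\<close>

lemma total_cost_limit:
  assumes \<tau>: "\<And>n k. \<tau> n k \<in> borel_on W \<rightarrow>\<^sub>M prob_algebra (borel_on U1)"
    and \<tau>': "\<And>n. \<tau>' n \<in> borel_on W \<rightarrow>\<^sub>M prob_algebra (borel_on U1)"
    and avg: "\<And>n f w. w \<in> W \<Longrightarrow> continuous_on U1 f \<Longrightarrow>
      integral\<^sup>L (\<tau>' n w) f = (\<Sum>k<N1 n. integral\<^sup>L (\<tau> n k w) f) / real (N1 n)"
  shows "(\<lambda>n. total_cost n (\<tau> n) - limit_cost (\<tau>' n)) \<longlonglongrightarrow> 0"
proof -
  let ?d = "\<lambda>n w. mean_cost n (\<lambda>k. \<tau> n k w) w - \<Phi> w (\<tau>' n w) (\<sigma> w)"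
  have i\<Phi>: "integrable \<mu> (\<lambda>w. \<Phi> w (\<tau>' n w) (\<sigma> w))" for n
  proof (rule Bochner_Integration.integrable_bound[OF h])
    show "AE w in \<mu>. norm (\<Phi> w (\<tau>' n w) (\<sigma> w)) \<le> norm (h w)"
    proof (rule AE_I2)
      fix w assume "w \<in> space \<mu>"
      then have w: "w \<in> W" using \<mu>_facts(3) by simp
      show "norm (\<Phi> w (\<tau>' n w) (\<sigma> w)) \<le> norm (h w)"
        using \<Phi>_bounds[OF w kernel_prob_measures[OF \<tau>'[of n] w] \<sigma>_prob[OF w]] by simp
    qed
  qed (rule borel_measurable_\<mu>[OF measurable_\<Phi>[OF \<tau>']])
  have "(\<lambda>n. integral\<^sup>L \<mu> (?d n)) \<longlonglongrightarrow> integral\<^sup>L \<mu> (\<lambda>_. 0)"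
  proof (rule integral_dominated_convergence[OF _ _ h])
    show "?d n \<in> borel_measurable \<mu>" for n
      by (intro borel_measurable_diff borel_measurable_\<mu> measurable_mean_cost measurable_\<Phi> \<tau> \<tau>')
    show "AE w in \<mu>. (\<lambda>n. ?d n w) \<longlonglongrightarrow> 0"
    proof (rule AE_I2)
      fix w assume "w \<in> space \<mu>"
      then have w: "w \<in> W" using \<mu>_facts(3) by simp
      show "(\<lambda>n. ?d n w) \<longlonglongrightarrow> 0"
        by (rule mean_cost_pointwise_limit[OF w, where \<tau>="\<lambda>n k. \<tau> n k w"])
           (auto intro: kernel_prob_measures \<tau> \<tau>' w avg)
    qed
    \<comment> \<open>Both terms lie in \<open>[0, h w]\<close>, so \<open>h\<close> itself
      dominates their difference.\<close>
    show "AE w in \<mu>. norm (?d n w) \<le> h w" for n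
    proof (rule AE_I2)
      fix w assume "w \<in> space \<mu>"
      then have w: "w \<in> W" using \<mu>_facts(3) by simp
      show "norm (?d n w) \<le> h w"
        using \<Phi>_bounds[OF w kernel_prob_measures[OF \<tau>'[of n] w] \<sigma>_prob[OF w]]
          mean_cost_nn_integral(2,3)[OF w, of n "\<lambda>k. \<tau> n k w"] kernel_prob_measures[OF \<tau> w, of n]
        by (simp add: abs_le_iff)
    qed
  qed simp
  moreover have "integral\<^sup>L \<mu> (?d n) = total_cost n (\<tau> n) - limit_cost (\<tau>' n)" for n
    unfolding total_cost_def limit_cost_def
    by (rule Bochner_Integration.integral_diff[OF integrable_mean_cost[OF \<tau>] i\<Phi>])
  ultimately show ?thesis by simp
qed

end

section \<open>Policies of the deviating team\<close>

lemma measurable_bind_action_kernel: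
  fixes T :: "('s, 'y::euclidean_space, 'u::euclidean_space, 'v::euclidean_space) team"
    and W :: "'w::topological_space set"
  assumes T: "wf_team M T" and D: "normalized_density T W D" and R: "R \<in> space (prob_algebra (policy_space T))"
  shows "(\<lambda>w. R \<bind> (\<lambda>\<gamma>. action_kernel T D \<gamma> w)) \<in> borel_on W \<rightarrow>\<^sub>M prob_algebra (borel_on (act_space T))"
proof (rule measurable_bind_prob_space2)
  show "(\<lambda>w. R) \<in> borel_on W \<rightarrow>\<^sub>M prob_algebra (policy_space T)" using R by simp
  have "(\<lambda>p. (snd p, fst p)) \<in> borel_on W \<Otimes>\<^sub>M policy_space T \<rightarrow>\<^sub>M policy_space T \<Otimes>\<^sub>M borel_on W" by measurable
  from measurable_compose[OF this measurable_action_kernel[OF T D]]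
  show "(\<lambda>(w, \<gamma>). action_kernel T D \<gamma> w) \<in> borel_on W \<Otimes>\<^sub>M policy_space T \<rightarrow>\<^sub>M prob_algebra (borel_on (act_space T))"
    by (simp add: case_prod_unfold)
qed

locale mean_field_team = mean_field_limit \<mu> W U1 U2 V1 V2 \<Xi>1 \<Xi>2 c h N1 N2 \<sigma>
  for \<mu> :: "'w::polish_space measure" and W :: "'w set"
    and U1 :: "'u1::euclidean_space set" and U2 :: "'u2::euclidean_space set"
    and V1 :: "'v1::euclidean_space set" and V2 :: "'v2::euclidean_space set"
    and \<Xi>1 :: "'u1 measure \<Rightarrow> 'v1" and \<Xi>2 :: "'u2 measure \<Rightarrow> 'v2"
    and c :: "'w \<Rightarrow> 'u1 \<Rightarrow> 'v1 \<Rightarrow> 'v2 \<Rightarrow> real" and h :: "'w \<Rightarrow> real"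
    and N1 N2 :: "nat \<Rightarrow> nat" and \<sigma> :: "'w \<Rightarrow> 'u2 measure" +
  fixes M :: "'s measure" and T :: "('s, 'y::euclidean_space, 'u1, 'v1) team" and D :: "'y \<Rightarrow> 'w \<Rightarrow> real"
  assumes T: "wf_team M T" and D: "normalized_density T W D" and act_space: "act_space T = U1"
begin

definition mean_action_law :: "('u1 \<times> 'y) measure measure \<Rightarrow> 'w \<Rightarrow> 'u1 measure" where
  "mean_action_law R w = R \<bind> (\<lambda>\<gamma>. action_kernel T D \<gamma> w)"

definition randomized_cost :: "nat \<Rightarrow> (nat \<Rightarrow> ('u1 \<times> 'y) measure) measure \<Rightarrow> ennreal" where
  "randomized_cost n P = (\<integral>\<^sup>+w. \<integral>\<^sup>+u1. cost_given_actions n w u1 \<partial>mixture T D (N1 n) P w \<partial>\<mu>)"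

definition pure_cost :: "nat \<Rightarrow> (nat \<Rightarrow> ('u1 \<times> 'y) measure) \<Rightarrow> ennreal" where
  "pure_cost n \<gamma> = (\<integral>\<^sup>+w. \<integral>\<^sup>+u1. cost_given_actions n w u1 \<partial>profile_kernel T D (N1 n) \<gamma> w \<partial>\<mu>)"

lemma measurable_mean_action_law:
  assumes R: "R \<in> space (prob_algebra (policy_space T))"
  shows "mean_action_law R \<in> borel_on W \<rightarrow>\<^sub>M prob_algebra (borel_on U1)"
  unfolding mean_action_law_def[abs_def]
  using measurable_bind_action_kernel[OF T D R] by (simp add: act_space)

lemma randomized_cost_PiM:
  assumes R: "R \<in> space (prob_algebra (policy_space T))"
  shows "randomized_cost n (PiM {..<N1 n} (\<lambda>_. R)) = ennreal (total_cost n (\<lambda>_. mean_action_law R))"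
proof -
  have "randomized_cost n (PiM {..<N1 n} (\<lambda>_. R))
      = (\<integral>\<^sup>+w. \<integral>\<^sup>+u1. cost_given_actions n w u1 \<partial>PiM {..<N1 n} (\<lambda>_. mean_action_law R w) \<partial>\<mu>)"
    unfolding randomized_cost_def
    by (rule nn_integral_cong) (simp add: mixture_PiM[OF T D R] mean_action_law_def \<mu>_facts(3))
  also have "\<dots> = ennreal (total_cost n (\<lambda>_. mean_action_law R))"
    by (rule nn_integral_total_cost(1)[OF measurable_mean_action_law[OF R]])
  finally show ?thesis .
qed

lemma total_cost_PiM_limit:
  assumes R: "R \<in> space (prob_algebra (policy_space T))"
  shows "(\<lambda>n. total_cost n (\<lambda>_. mean_action_law R)) \<longlonglongrightarrow> limit_cost (mean_action_law R)"
proof -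
  have "(\<lambda>n. total_cost n (\<lambda>_. mean_action_law R) - limit_cost (mean_action_law R)) \<longlonglongrightarrow> 0"
    by (rule total_cost_limit) (use measurable_mean_action_law[OF R] N_pos in auto)
  then show ?thesis by (simp add: LIM_zero_iff)
qed

text \<open>If everybody draws from one fixed \<open>R\<close>, the action laws do not change with
  \<open>n\<close>, the costs converge, and the limsup that defines the infinite game becomes the
  real number \<open>limit_cost\<close>.\<close>

lemma limsup_randomized_cost_PiM:
  assumes R: "R \<in> space (prob_algebra (policy_space T))"
  shows "limsup (\<lambda>n. randomized_cost n (PiM {..<N1 n} (\<lambda>_. R))) = ennreal (limit_cost (mean_action_law R))"
    and "0 \<le> limit_cost (mean_action_law R)"
proof -
  have "(\<lambda>n. ennreal (total_cost n (\<lambda>_. mean_action_law R))) \<longlonglongrightarrow> ennreal (limit_cost (mean_action_law R))"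
    using total_cost_PiM_limit[OF R] by (rule tendsto_ennrealI)
  then show "limsup (\<lambda>n. randomized_cost n (PiM {..<N1 n} (\<lambda>_. R))) = ennreal (limit_cost (mean_action_law R))"
    unfolding randomized_cost_PiM[OF R] by (intro lim_imp_Limsup) auto
  show "0 \<le> limit_cost (mean_action_law R)"
    by (rule LIMSEQ_le_const[OF total_cost_PiM_limit[OF R]])
       (auto intro: nn_integral_total_cost(2) measurable_mean_action_law[OF R])
qed

lemma measurable_pure_integrand:
  "(\<lambda>(\<gamma>, w). \<integral>\<^sup>+u1. cost_given_actions n w u1 \<partial>profile_kernel T D (N1 n) \<gamma> w)
    \<in> borel_measurable (profile_space T {..<N1 n} \<Otimes>\<^sub>M borel_on W)"
proof -
  let ?P = "profile_space T {..<N1 n} \<Otimes>\<^sub>M borel_on W" and ?A = "PiM {..<N1 n} (\<lambda>_. borel_on U1)"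
  have "(\<lambda>p. profile_kernel T D (N1 n) (fst p) (snd p)) \<in> ?P \<rightarrow>\<^sub>M prob_algebra ?A"
    using measurable_profile_kernel[OF T D, of "N1 n"] by (simp add: case_prod_unfold act_space)
  moreover have "(\<lambda>(p, u1). cost_given_actions n (snd p) u1) \<in> borel_measurable (?P \<Otimes>\<^sub>M ?A)"
  proof -
    have "(\<lambda>q. (snd (fst q), snd q)) \<in> ?P \<Otimes>\<^sub>M ?A \<rightarrow>\<^sub>M borel_on W \<Otimes>\<^sub>M ?A" by measurable
    from measurable_compose[OF this measurable_cost_given_actions] show ?thesis by (simp add: case_prod_unfold)
  qed
  ultimately have "(\<lambda>p. \<integral>\<^sup>+u1. cost_given_actions n (snd p) u1 \<partial>profile_kernel T D (N1 n) (fst p) (snd p)) \<in> borel_measurable ?P"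
    by (rule nn_integral_kernel_measurable)
  then show ?thesis by (simp add: case_prod_unfold)
qed

text \<open>Tonelli, with the joint measurability in profile and state, exchanges the average over
  the states with the average over the drawn profiles.\<close>

lemma randomized_cost_eq_pure:
  assumes P: "P \<in> randomized T {..<N1 n}"
  shows "randomized_cost n P = (\<integral>\<^sup>+\<gamma>. pure_cost n \<gamma> \<partial>P)"
    and "pure_cost n \<in> borel_measurable (profile_space T {..<N1 n})"
proof -
  let ?A = "PiM {..<N1 n} (\<lambda>_. borel_on U1)"
  have p: "P \<in> space (prob_algebra (profile_space T {..<N1 n}))" using P unfolding randomized_def .
  have "randomized_cost n P = (\<integral>\<^sup>+w. \<integral>\<^sup>+\<gamma>. \<integral>\<^sup>+u1. cost_given_actions n w u1 \<partial>profile_kernel T D (N1 n) \<gamma> w \<partial>P \<partial>\<mu>)"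
    unfolding randomized_cost_def mixture_def
  proof (rule nn_integral_cong)
    fix w assume "w \<in> space \<mu>"
    then have w: "w \<in> W" using \<mu>_facts(3) by simp
    have "Pair w \<in> ?A \<rightarrow>\<^sub>M borel_on W \<Otimes>\<^sub>M ?A" by (rule measurable_Pair1') (use w in simp)
    from measurable_compose[OF this measurable_cost_given_actions]
    have "cost_given_actions n w \<in> borel_measurable (action_profiles T (N1 n))" by (simp add: act_space)
    from nn_integral_prob_bind[OF p measurable_profile_kernel_section[OF T D w] this]
    show "(\<integral>\<^sup>+u1. cost_given_actions n w u1 \<partial>(P \<bind> (\<lambda>\<gamma>. profile_kernel T D (N1 n) \<gamma> w)))
        = (\<integral>\<^sup>+\<gamma>. \<integral>\<^sup>+u1. cost_given_actions n w u1 \<partial>profile_kernel T D (N1 n) \<gamma> w \<partial>P)" .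
  qed
  also have "\<dots> = (\<integral>\<^sup>+\<gamma>. pure_cost n \<gamma> \<partial>P)"
    unfolding pure_cost_def using nn_integral_pair_prob(2)[OF p \<mu> measurable_pure_integrand] by simp
  finally show "randomized_cost n P = (\<integral>\<^sup>+\<gamma>. pure_cost n \<gamma> \<partial>P)" .
  show "pure_cost n \<in> borel_measurable (profile_space T {..<N1 n})"
    unfolding pure_cost_def[abs_def]
    by (rule nn_integral_kernel_measurable[where \<kappa>="\<lambda>_. \<mu>" and N="borel_on W"])
       (use \<mu> measurable_pure_integrand in auto)
qed

text \<open>If no pure profile were profitable, integrating the inequality over \<open>P\<close>
  would show that \<open>P\<close> is not profitable either.\<close>

lemma pure_deviation_exists:
  assumes P: "P \<in> randomized T {..<N1 n}" and less: "\<not> a \<le> randomized_cost n P + e"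
  shows "\<exists>\<gamma>\<in>space (profile_space T {..<N1 n}). \<not> a \<le> pure_cost n \<gamma> + e"
proof (rule ccontr)
  assume "\<not> ?thesis"
  then have le: "a \<le> pure_cost n \<gamma> + e" if "\<gamma> \<in> space (profile_space T {..<N1 n})" for \<gamma> using that by blast
  have p: "prob_space P" "sets P = sets (profile_space T {..<N1 n})" "space P = space (profile_space T {..<N1 n})"
    using P by (auto simp: randomized_def space_prob_algebra dest: sets_eq_imp_space_eq)
  interpret prob_space P by fact
  have m: "pure_cost n \<in> borel_measurable P"
    using randomized_cost_eq_pure(2)[OF P] by (simp only: measurable_cong_sets[OF p(2) refl])
  have "a = (\<integral>\<^sup>+\<gamma>. a \<partial>P)" by (simp add: emeasure_space_1)
  also have "\<dots> \<le> (\<integral>\<^sup>+\<gamma>. pure_cost n \<gamma> + e \<partial>P)"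
    by (rule nn_integral_mono) (use le p(3) in simp)
  also have "\<dots> = randomized_cost n P + e"
    unfolding randomized_cost_eq_pure(1)[OF P] by (subst nn_integral_add[OF m]) (simp_all add: emeasure_space_1)
  finally show False using less by simp
qed

definition uniform_policy :: "nat \<Rightarrow> (nat \<Rightarrow> ('u1 \<times> 'y) measure) \<Rightarrow> ('u1 \<times> 'y) measure measure" where
  "uniform_policy N \<gamma> = distr (uniform_count_measure {..<N}) (policy_space T) \<gamma>"

text \<open>Mixing is linear: the action law of a uniformly drawn policy is the average of the
  action laws of the profile. This is what matches the draw with the profile in the law of large
  numbers.\<close>

lemma
  assumes N: "0 < N" and \<gamma>: "\<And>k. k < N \<Longrightarrow> \<gamma> k \<in> policies T"
  shows uniform_policy_prob: "uniform_policy N \<gamma> \<in> space (prob_algebra (policy_space T))"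
    and integral_uniform_policy: "w \<in> W \<Longrightarrow> continuous_on U1 f \<Longrightarrow>
      integral\<^sup>L (mean_action_law (uniform_policy N \<gamma>) w) f = (\<Sum>k<N. integral\<^sup>L (action_kernel T D (\<gamma> k) w) f) / real N"
proof -
  have \<gamma>m: "\<gamma> \<in> uniform_count_measure {..<N} \<rightarrow>\<^sub>M policy_space T"
    using \<gamma> by (auto simp: measurable_def space_uniform_count_measure sets_uniform_count_measure space_policy_space[OF T])
  have "prob_space (uniform_count_measure {..<N})" using N by (intro prob_space_uniform_count_measure) auto
  then show R: "uniform_policy N \<gamma> \<in> space (prob_algebra (policy_space T))"
    unfolding uniform_policy_def using \<gamma>m by (auto simp: space_prob_algebra intro: prob_space.prob_space_distr)
  assume w: "w \<in> W" and f: "continuous_on U1 f"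
  obtain B where B: "\<forall>u\<in>U1. norm (f u) \<le> B"
    using compact_imp_bounded[OF compact_continuous_image[OF f U1]] by (auto simp: bounded_iff)
  have fm: "f \<in> borel_measurable (borel_on U1)" using f by (rule measurable_continuous_borel_on)
  let ?\<kappa> = "\<lambda>\<gamma>. action_kernel T D \<gamma> w"
  have \<kappa>: "?\<kappa> \<in> policy_space T \<rightarrow>\<^sub>M prob_algebra (borel_on U1)"
    using measurable_action_kernel_section[OF T D w] by (simp add: act_space)
  have fin: "finite_measure (uniform_policy N \<gamma>)"
    using R by (simp add: space_prob_algebra prob_space.finite_measure)
  have \<kappa>R: "?\<kappa> \<in> uniform_policy N \<gamma> \<rightarrow>\<^sub>M subprob_algebra (borel_on U1)"
    using measurable_prob_algebraD[OF \<kappa>] by (simp add: uniform_policy_def)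
  have "integral\<^sup>L (mean_action_law (uniform_policy N \<gamma>) w) f = (\<integral>\<gamma>'. integral\<^sup>L (?\<kappa> \<gamma>') f \<partial>uniform_policy N \<gamma>)"
    unfolding mean_action_law_def
  proof (rule integral_bind[OF fm _ \<kappa>R fin, where B=B and B'=1])
    show "AE \<gamma>' in uniform_policy N \<gamma>. emeasure (?\<kappa> \<gamma>') (space (?\<kappa> \<gamma>')) \<le> ennreal 1"
    proof (rule AE_I2)
      fix \<gamma>' assume "\<gamma>' \<in> space (uniform_policy N \<gamma>)"
      then have "\<gamma>' \<in> space (policy_space T)" by (simp add: uniform_policy_def)
      then show "emeasure (?\<kappa> \<gamma>') (space (?\<kappa> \<gamma>')) \<le> ennreal 1"
        using prob_space.emeasure_space_1[OF kernelD(1)[OF \<kappa>]] by simp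
    qed
  qed (use B in auto)
  also have "\<dots> = (\<integral>k. integral\<^sup>L (?\<kappa> (\<gamma> k)) f \<partial>uniform_count_measure {..<N})"
    unfolding uniform_policy_def
    by (rule integral_distr[OF \<gamma>m measurable_compose[OF measurable_prob_algebraD[OF \<kappa>] integral_measurable_subprob_algebra[OF fm]]])
  also have "\<dots> = (\<Sum>k<N. integral\<^sup>L (?\<kappa> (\<gamma> k)) f) / real N"
    by (simp add: integral_uniform_count_measure)
  finally show "integral\<^sup>L (mean_action_law (uniform_policy N \<gamma>) w) f = (\<Sum>k<N. integral\<^sup>L (action_kernel T D (\<gamma> k) w) f) / real N" .
qed

text \<open>A profitable deviation of a large finite team can be assumed pure. If instead every
  decision maker draws its policy uniformly from the deviating profile, then the costs change by
  little, by the law of large numbers, and the deviation becomes available in the infinite game.\<close>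

theorem eventually_no_profitable_deviation:
  assumes R: "R \<in> space (prob_algebra (policy_space T))" and e: "0 < e"
    and opt: "\<And>R'. R' \<in> space (prob_algebra (policy_space T)) \<Longrightarrow>
      limsup (\<lambda>n. randomized_cost n (PiM {..<N1 n} (\<lambda>_. R))) \<le> limsup (\<lambda>n. randomized_cost n (PiM {..<N1 n} (\<lambda>_. R')))"
  shows "eventually (\<lambda>n. \<forall>P\<in>randomized T {..<N1 n}.
      randomized_cost n (PiM {..<N1 n} (\<lambda>_. R)) \<le> randomized_cost n P + ennreal e) sequentially"
proof -
  let ?opt = "\<lambda>n. randomized_cost n (PiM {..<N1 n} (\<lambda>_. R))"
  \<comment> \<open>The equilibrium property in terms of limit costs. It will be used with a
    different \<open>R'\<close> at each team size, so the competitors need not converge.\<close>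
  have opt': "limit_cost (mean_action_law R) \<le> limit_cost (mean_action_law R')"
    if "R' \<in> space (prob_algebra (policy_space T))" for R'
    using opt[OF that] limsup_randomized_cost_PiM(2)[OF that]
    unfolding limsup_randomized_cost_PiM(1)[OF R] limsup_randomized_cost_PiM(1)[OF that] by (simp add: ennreal_le_iff)
  \<comment> \<open>Stated as an implication so that a profile can be chosen for every
    \<open>n\<close>; where there is no profitable deviation any profile does, and one exists
    because the product of \<open>R\<close> is a probability measure.\<close>
  have "\<exists>\<gamma>\<in>space (profile_space T {..<N1 n}). (\<exists>P\<in>randomized T {..<N1 n}. \<not> ?opt n \<le> randomized_cost n P + ennreal e)
      \<longrightarrow> \<not> ?opt n \<le> pure_cost n \<gamma> + ennreal e" for n
  proof (cases "\<exists>P\<in>randomized T {..<N1 n}. \<not> ?opt n \<le> randomized_cost n P + ennreal e")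
    case True
    then obtain P where "P \<in> randomized T {..<N1 n}" "\<not> ?opt n \<le> randomized_cost n P + ennreal e" by blast
    from pure_deviation_exists[OF this] show ?thesis by blast
  next
    case False
    have "PiM {..<N1 n} (\<lambda>_. R) \<in> space (prob_algebra (profile_space T {..<N1 n}))"
      using PiM_randomized[OF R] unfolding randomized_def .
    then have "space (profile_space T {..<N1 n}) \<noteq> {}"
      using prob_space.not_empty by (fastforce simp: space_prob_algebra dest: sets_eq_imp_space_eq)
    then show ?thesis using False by blast
  qed
  then obtain \<gamma> where \<gamma>: "\<And>n. \<gamma> n \<in> space (profile_space T {..<N1 n})"
    and bad: "\<And>n P. P \<in> randomized T {..<N1 n} \<Longrightarrow> \<not> ?opt n \<le> randomized_cost n P + ennreal e \<Longrightarrow> \<not> ?opt n \<le> pure_cost n (\<gamma> n) + ennreal e"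
    by metis
  have pol: "\<gamma> n k \<in> policies T" if "k < N1 n" for n k
    using \<gamma>[of n] that by (auto simp: profile_space_def space_PiM space_policy_space[OF T])
  \<comment> \<open>Indices beyond the team repeat the policy with index 0, which keeps
    \<open>\<tau> n k\<close> a probability kernel for all \<open>k\<close>; only the first
    \<open>N1 n\<close> of them enter the costs.\<close>
  define \<tau> where "\<tau> n k = action_kernel T D (\<gamma> n (if k < N1 n then k else 0))" for n k
  define R' where "R' n = uniform_policy (N1 n) (\<gamma> n)" for n
  have R': "R' n \<in> space (prob_algebra (policy_space T))" for n
    unfolding R'_def by (rule uniform_policy_prob[OF N_pos(1) pol])
  have \<tau>: "\<tau> n k \<in> borel_on W \<rightarrow>\<^sub>M prob_algebra (borel_on U1)" for n k
  proof -
    have "\<gamma> n (if k < N1 n then k else 0) \<in> space (policy_space T)"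
      using pol[of _ n] N_pos(1)[of n] by (simp add: space_policy_space[OF T])
    then have "Pair (\<gamma> n (if k < N1 n then k else 0)) \<in> borel_on W \<rightarrow>\<^sub>M policy_space T \<Otimes>\<^sub>M borel_on W"
      by (rule measurable_Pair1')
    from measurable_compose[OF this measurable_action_kernel[OF T D]] show ?thesis
      by (simp add: \<tau>_def act_space)
  qed
  have pure: "pure_cost n (\<gamma> n) = ennreal (total_cost n (\<tau> n))" for n
  proof -
    have "profile_kernel T D (N1 n) (\<gamma> n) w = PiM {..<N1 n} (\<lambda>k. \<tau> n k w)" for w
      unfolding profile_kernel_def by (rule PiM_cong) (auto simp: \<tau>_def)
    then show ?thesis unfolding pure_cost_def using nn_integral_total_cost(1)[OF \<tau>, of n] by simp
  qed
  have "(\<lambda>n. total_cost n (\<tau> n) - limit_cost (mean_action_law (R' n))) \<longlonglongrightarrow> 0"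
  proof (rule total_cost_limit[OF \<tau> measurable_mean_action_law[OF R']])
    fix n f w assume "w \<in> W" "continuous_on U1 (f :: 'u1 \<Rightarrow> real)"
    then show "integral\<^sup>L (mean_action_law (R' n) w) f = (\<Sum>k<N1 n. integral\<^sup>L (\<tau> n k w) f) / real (N1 n)"
      unfolding R'_def by (subst integral_uniform_policy[OF N_pos(1) pol]) (simp_all add: \<tau>_def)
  qed
  from tendstoD[OF this half_gt_zero[OF e]]
  have ev1: "eventually (\<lambda>n. \<bar>total_cost n (\<tau> n) - limit_cost (mean_action_law (R' n))\<bar> < e / 2) sequentially"
    by (simp add: dist_real_def)
  from tendstoD[OF total_cost_PiM_limit[OF R] half_gt_zero[OF e]]
  have ev2: "eventually (\<lambda>n. \<bar>total_cost n (\<lambda>_. mean_action_law R) - limit_cost (mean_action_law R)\<bar> < e / 2) sequentially"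
    by (simp add: dist_real_def)
  from ev1 ev2 show ?thesis
  proof eventually_elim
    case (elim n)
    \<comment> \<open>Half of \<open>e\<close> leads from the equilibrium to its limit cost, which
      is at most that of the uniform draw, and the other half from there back to the deviating
      profile.\<close>
    have "total_cost n (\<lambda>_. mean_action_law R) \<le> total_cost n (\<tau> n) + e"
      using elim opt'[OF R'[of n]] by linarith
    then have "ennreal (total_cost n (\<lambda>_. mean_action_law R)) \<le> ennreal (total_cost n (\<tau> n)) + ennreal e"
      using nn_integral_total_cost(2)[OF \<tau>, of n] e by (simp add: ennreal_leI flip: ennreal_plus)
    then have "?opt n \<le> pure_cost n (\<gamma> n) + ennreal e"
      unfolding pure randomized_cost_PiM[OF R] .
    \<comment> \<open>One chosen profile per \<open>n\<close> controls all deviations at once: a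
      profitable \<open>P\<close> would have made the chosen profile profitable.\<close>
    then show ?case using bad by blast
  qed
qed

end

section \<open>Approximate equilibria of the finite games\<close>

text \<open>For the second team the roles are exchanged, and its own statistic has to come
  first.\<close>

lemma borel_cost_swap:
  fixes W :: "'w::polish_space set" and U :: "'u::euclidean_space set"
    and V1 :: "'v1::euclidean_space set" and V2 :: "'v2::euclidean_space set"
  assumes "borel_cost W U V1 V2 c"
  shows "borel_cost W U V2 V1 (\<lambda>w u v2 v1. c w u v1 v2)"
proof -
  let ?f = "\<lambda>p. (fst p, fst (snd p), snd (snd (snd p)), fst (snd (snd p)))"
  have "continuous_on (W \<times> U \<times> V2 \<times> V1) ?f" by (intro continuous_intros)
  then have "?f \<in> borel_on (W \<times> U \<times> V2 \<times> V1) \<rightarrow>\<^sub>M borel_on (W \<times> U \<times> V1 \<times> V2)"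
    by (intro measurable_borel_onI measurable_continuous_borel_on) auto
  moreover have "(\<lambda>(w, u, v1, v2). c w u v1 v2) \<in> borel_measurable (borel_on (W \<times> U \<times> V1 \<times> V2))"
    using assms unfolding borel_cost_def by blast
  ultimately have "(\<lambda>p. case ?f p of (w, u, v1, v2) \<Rightarrow> c w u v1 v2) \<in> borel_measurable (borel_on (W \<times> U \<times> V2 \<times> V1))"
    by (rule measurable_compose)
  then show ?thesis using assms unfolding borel_cost_def by (simp add: case_prod_unfold)
qed

lemma continuous_cost_swap:
  assumes "continuous_cost W U V1 V2 c"
  shows "continuous_cost W U V2 V1 (\<lambda>w u v2 v1. c w u v1 v2)"
  unfolding continuous_cost_def
proof
  fix w assume "w \<in> W"
  then have "continuous_on (U \<times> V1 \<times> V2) (\<lambda>(u, v1, v2). c w u v1 v2)"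
    using assms unfolding continuous_cost_def by blast
  moreover have "continuous_on (U \<times> V2 \<times> V1) (\<lambda>p. (fst p, snd (snd p), fst (snd p)))"
    by (intro continuous_intros)
  moreover have "(\<lambda>p. (fst p, snd (snd p), fst (snd p))) ` (U \<times> V2 \<times> V1) \<subseteq> U \<times> V1 \<times> V2" by auto
  ultimately have "continuous_on (U \<times> V2 \<times> V1) (\<lambda>p. case (fst p, snd (snd p), fst (snd p)) of (u, v1, v2) \<Rightarrow> c w u v1 v2)"
    by (rule continuous_on_compose2)
  then show "continuous_on (U \<times> V2 \<times> V1) (\<lambda>(u, v2, v1). c w u v1 v2)" by (simp add: case_prod_unfold)
qed

lemma
  fixes G :: "('s, 'w::polish_space, 'y1::euclidean_space, 'u1::euclidean_space, 'v1::euclidean_space,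
    'y2::euclidean_space, 'u2::euclidean_space, 'v2::euclidean_space) game"
  assumes G: "static_game G" and N: "0 < N1" "0 < N2" and w: "w \<in> state_space G"
    and u1: "u1 \<in> space (action_profiles (team1 G) N1)" and u2: "u2 \<in> space (action_profiles (team2 G) N2)"
  shows avg_cost1_eq: "avg_cost1 G N1 N2 w (u1, u2) = mean_field_cost (stat (team1 G)) (stat (team2 G)) (cost1 G w)
      (empirical (act_space (team1 G)) N1 u1) (empirical (act_space (team2 G)) N2 u2)"
    and avg_cost2_eq: "avg_cost2 G N1 N2 w (u1, u2) = mean_field_cost (stat (team2 G)) (stat (team1 G)) (\<lambda>u v2 v1. cost2 G w u v1 v2)
      (empirical (act_space (team2 G)) N2 u2) (empirical (act_space (team1 G)) N1 u1)"
proof -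
  have "\<And>k. k < N1 \<Longrightarrow> u1 k \<in> act_space (team1 G)" "\<And>k. k < N2 \<Longrightarrow> u2 k \<in> act_space (team2 G)"
    using u1 u2 by (auto simp: space_PiM PiE_def Pi_def)
  note u = this and e = empirical_in_prob_measures[OF N(1) this(1)] empirical_in_prob_measures[OF N(2) this(2)]
  have s: "continuous_map (weak_topology (act_space (team1 G))) (top_of_set (stat_space (team1 G))) (stat (team1 G))"
    "continuous_map (weak_topology (act_space (team2 G))) (top_of_set (stat_space (team2 G))) (stat (team2 G))"
    and c1: "borel_cost (state_space G) (act_space (team1 G)) (stat_space (team1 G)) (stat_space (team2 G)) (cost1 G)"
    and c2: "borel_cost (state_space G) (act_space (team2 G)) (stat_space (team1 G)) (stat_space (team2 G)) (cost2 G)"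
    using G by (auto simp: static_game_def wf_team_def)
  show "avg_cost1 G N1 N2 w (u1, u2) = mean_field_cost (stat (team1 G)) (stat (team2 G)) (cost1 G w)
      (empirical (act_space (team1 G)) N1 u1) (empirical (act_space (team2 G)) N2 u2)"
    using mean_field_cost_empirical[OF c1 w s N(1) u(1) e(2)] by (simp add: avg_cost1_def stats_def)
  show "avg_cost2 G N1 N2 w (u1, u2) = mean_field_cost (stat (team2 G)) (stat (team1 G)) (\<lambda>u v2 v1. cost2 G w u v1 v2)
      (empirical (act_space (team2 G)) N2 u2) (empirical (act_space (team1 G)) N1 u1)"
    using mean_field_cost_empirical[OF borel_cost_swap[OF c2] w s(2,1) N(2) u(2) e(1)] by (simp add: avg_cost2_def stats_def)
qed

lemma
  fixes G :: "('s, 'w::polish_space, 'y1::euclidean_space, 'u1::euclidean_space, 'v1::euclidean_space,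
    'y2::euclidean_space, 'u2::euclidean_space, 'v2::euclidean_space) game"
  assumes G: "static_game G" and N: "0 < N1" "0 < N2"
  shows cost_measurable_avg_cost1: "cost_measurable G N1 N2 (avg_cost1 G N1 N2)"
    and cost_measurable_avg_cost2: "cost_measurable G N1 N2 (avg_cost2 G N1 N2)"
proof -
  let ?S = "borel_on (state_space G)" and ?A = "action_profiles (team1 G) N1" and ?B = "action_profiles (team2 G) N2"
  have s: "continuous_map (weak_topology (act_space (team1 G))) (top_of_set (stat_space (team1 G))) (stat (team1 G))"
    "continuous_map (weak_topology (act_space (team2 G))) (top_of_set (stat_space (team2 G))) (stat (team2 G))"
    and c1: "borel_cost (state_space G) (act_space (team1 G)) (stat_space (team1 G)) (stat_space (team2 G)) (cost1 G)"
    and c2: "borel_cost (state_space G) (act_space (team2 G)) (stat_space (team1 G)) (stat_space (team2 G)) (cost2 G)"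
    using G by (auto simp: static_game_def wf_team_def)
  show "cost_measurable G N1 N2 (avg_cost1 G N1 N2)" unfolding cost_measurable_def
  proof (subst measurable_cong)
    show "(case p of (w, u) \<Rightarrow> avg_cost1 G N1 N2 w u) = (case p of (w, u1, u2) \<Rightarrow> mean_field_cost (stat (team1 G)) (stat (team2 G)) (cost1 G w)
      (empirical (act_space (team1 G)) N1 u1) (empirical (act_space (team2 G)) N2 u2))"
      if "p \<in> space (?S \<Otimes>\<^sub>M (?A \<Otimes>\<^sub>M ?B))" for p
      using that avg_cost1_eq[OF G N] unfolding space_pair_measure by auto
  qed (rule measurable_empirical_cost[OF c1 s N])
  have "(\<lambda>p. (fst p, snd (snd p), fst (snd p))) \<in> ?S \<Otimes>\<^sub>M (?A \<Otimes>\<^sub>M ?B) \<rightarrow>\<^sub>M ?S \<Otimes>\<^sub>M (?B \<Otimes>\<^sub>M ?A)" by measurable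
  from measurable_compose[OF this measurable_empirical_cost[OF borel_cost_swap[OF c2] s(2,1) N(2,1)]]
  have m2: "(\<lambda>p. case p of (w, u1, u2) \<Rightarrow> mean_field_cost (stat (team2 G)) (stat (team1 G)) (\<lambda>u v2 v1. cost2 G w u v1 v2)
      (empirical (act_space (team2 G)) N2 u2) (empirical (act_space (team1 G)) N1 u1)) \<in> borel_measurable (?S \<Otimes>\<^sub>M (?A \<Otimes>\<^sub>M ?B))"
    by (simp add: case_prod_unfold)
  show "cost_measurable G N1 N2 (avg_cost2 G N1 N2)" unfolding cost_measurable_def
  proof (subst measurable_cong)
    show "(case p of (w, u) \<Rightarrow> avg_cost2 G N1 N2 w u) = (case p of (w, u1, u2) \<Rightarrow> mean_field_cost (stat (team2 G)) (stat (team1 G)) (\<lambda>u v2 v1. cost2 G w u v1 v2)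
      (empirical (act_space (team2 G)) N2 u2) (empirical (act_space (team1 G)) N1 u1))"
      if "p \<in> space (?S \<Otimes>\<^sub>M (?A \<Otimes>\<^sub>M ?B))" for p
      using that avg_cost2_eq[OF G N] unfolding space_pair_measure by auto
  qed (rule m2)
qed

text \<open>Finiteness of \<open>a\<close> makes the truncated difference a real number, so
  \<open>enn2real\<close> loses nothing. The slack \<open>r\<close> is room for the regret of the
  other team.\<close>

lemma le_INF_plus_regret:
  fixes a :: ennreal
  assumes "a < top" "0 \<le> r"
  shows "a \<le> (INF x\<in>X. f x) + ennreal (enn2real (a - (INF x\<in>X. f x)) + r)"
proof -
  let ?b = "INF x\<in>X. f x"
  have "a - ?b < top" using assms(1) by (meson diff_le_self_ennreal order_le_less_trans)
  then have "a - ?b = ennreal (enn2real (a - ?b))" by simp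
  also have "\<dots> \<le> ennreal (enn2real (a - ?b) + r)" using assms(2) by (intro ennreal_leI) simp
  finally show ?thesis using assms(1) by (simp add: ennreal_minus_le_iff)
qed

text \<open>A bound against all \<open>x\<close> at once passes to the infimum; starting from
  \<open>e / 2\<close> leaves the strict inequality below \<open>e\<close> at the end.\<close>

lemma regret_tendsto_0:
  fixes a :: "nat \<Rightarrow> ennreal"
  assumes a: "\<And>n. a n < top"
    and ev: "\<And>e. 0 < e \<Longrightarrow> eventually (\<lambda>n. \<forall>x\<in>X n. a n \<le> f n x + ennreal e) sequentially"
  shows "(\<lambda>n. enn2real (a n - (INF x\<in>X n. f n x))) \<longlonglongrightarrow> 0"
proof (rule tendstoI)
  fix e :: real assume e: "0 < e"
  from ev[OF half_gt_zero[OF e]]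
  show "eventually (\<lambda>n. dist (enn2real (a n - (INF x\<in>X n. f n x))) 0 < e) sequentially"
  proof eventually_elim
    case (elim n)
    have "a n - ennreal (e / 2) \<le> f n x" if "x \<in> X n" for x
      using elim that a[of n] by (auto simp: ennreal_minus_le_iff add.commute)
    then have "a n - ennreal (e / 2) \<le> (INF x\<in>X n. f n x)" by (intro INF_greatest)
    then have "a n - (INF x\<in>X n. f n x) \<le> ennreal (e / 2)"
      using a[of n] by (auto simp: ennreal_minus_le_iff add.commute)
    then have "enn2real (a n - (INF x\<in>X n. f n x)) \<le> e / 2"
      using e by (intro enn2real_leI) auto
    then show ?case using e by (simp add: dist_real_def)
  qed
qed

theorem theorem4:
  fixes G :: "('s, 'w::polish_space, 'y1::euclidean_space, 'u1::euclidean_space,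
      'v1::euclidean_space, 'y2::euclidean_space, 'u2::euclidean_space, 'v2::euclidean_space) game"
    and f1 :: "'y1 \<Rightarrow> 'w \<Rightarrow> real" and f2 :: "'y2 \<Rightarrow> 'w \<Rightarrow> real"
    and S :: "nat \<Rightarrow> nat \<times> nat"
    and P1 :: "(nat \<Rightarrow> ('u1 \<times> 'y1) measure) measure"
    and P2 :: "(nat \<Rightarrow> ('u2 \<times> 'y2) measure) measure"
  assumes game: "static_game G"
    and sizes: "size_sequence S"
    and densities: "obs_densities G f1 f2"
    and compact: "compact (act_space (team1 G))" "compact (act_space (team2 G))"
    and continuous:
      "continuous_cost (state_space G) (act_space (team1 G))
         (stat_space (team1 G)) (stat_space (team2 G)) (cost1 G)"
      "continuous_cost (state_space G) (act_space (team2 G))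
         (stat_space (team1 G)) (stat_space (team2 G)) (cost2 G)"
    and dominated:
      "dominated_cost (state_law G) (act_space (team1 G))
         (stat (team1 G) ` prob_measures (act_space (team1 G)))
         (stat (team2 G) ` prob_measures (act_space (team2 G))) (cost1 G)"
      "dominated_cost (state_law G) (act_space (team2 G))
         (stat (team1 G) ` prob_measures (act_space (team1 G)))
         (stat (team2 G) ` prob_measures (act_space (team2 G))) (cost2 G)"
    and private_symmetric: "P1 \<in> private_symmetric (team1 G)" "P2 \<in> private_symmetric (team2 G)"
    and nash: "nash_infinite G S P1 P2"
  shows "\<exists>\<epsilon> :: nat \<Rightarrow> nat \<Rightarrow> real.
    (\<forall>N1 N2. 0 \<le> \<epsilon> N1 N2) \<and>
    (\<lambda>n. case S n of (N1, N2) \<Rightarrow> \<epsilon> N1 N2) \<longlonglongrightarrow> 0 \<and>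
    (\<forall>(N1, N2) \<in> range S.
       eps_nash_finite G N1 N2 (\<epsilon> N1 N2)
         (marginal (team1 G) N1 P1) (marginal (team2 G) N2 P2))"
proof -
  let ?T1 = "team1 G" and ?T2 = "team2 G" and ?W = "state_space G" and ?\<mu> = "state_law G"
  let ?U1 = "act_space (team1 G)" and ?U2 = "act_space (team2 G)"
  define D1 where "D1 = normalize_density ?T1 f1"
  define D2 where "D2 = normalize_density ?T2 f2"
  note T = static_gameD(1,2)[OF game]
  note D = obs_densities_normalized(1,2)[OF game densities, folded D1_def D2_def]
  note K = obs_densities_normalized(3)[OF game densities, folded D1_def D2_def]
  obtain R1 where R1: "R1 \<in> space (prob_algebra (policy_space ?T1))" and P1: "\<And>N. marginal ?T1 N P1 = PiM {..<N} (\<lambda>_. R1)"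
    by (rule private_symmetric_marginal[OF private_symmetric(1)]) (rule that)
  obtain R2 where R2: "R2 \<in> space (prob_algebra (policy_space ?T2))" and P2: "\<And>N. marginal ?T2 N P2 = PiM {..<N} (\<lambda>_. R2)"
    by (rule private_symmetric_marginal[OF private_symmetric(2)]) (rule that)
  \<comment> \<open>The law of one equilibrium action of each team given the state; by private
    randomisation the actions of a team are independent copies of it given the state.\<close>
  define \<sigma>1 where "\<sigma>1 w = R1 \<bind> (\<lambda>\<gamma>. action_kernel ?T1 D1 \<gamma> w)" for w
  define \<sigma>2 where "\<sigma>2 w = R2 \<bind> (\<lambda>\<gamma>. action_kernel ?T2 D2 \<gamma> w)" for w
  have \<sigma>1: "\<sigma>1 \<in> borel_on ?W \<rightarrow>\<^sub>M prob_algebra (borel_on ?U1)"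
    unfolding \<sigma>1_def[abs_def] by (rule measurable_bind_action_kernel[OF T(1) D(1) R1])
  have \<sigma>2: "\<sigma>2 \<in> borel_on ?W \<rightarrow>\<^sub>M prob_algebra (borel_on ?U2)"
    unfolding \<sigma>2_def[abs_def] by (rule measurable_bind_action_kernel[OF T(2) D(2) R2])
  define N1 where "N1 n = fst (S n)" for n
  define N2 where "N2 n = snd (S n)" for n
  have N: "\<And>n. 0 < N1 n" "\<And>n. 0 < N2 n" "filterlim N1 at_top sequentially" "filterlim N2 at_top sequentially"
    using sizes unfolding size_sequence_def N1_def N2_def by auto
  have stat: "continuous_map (weak_topology ?U1) (top_of_set (stat_space ?T1)) (stat ?T1)"
    "continuous_map (weak_topology ?U2) (top_of_set (stat_space ?T2)) (stat ?T2)"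
    and cost1: "borel_cost ?W ?U1 (stat_space ?T1) (stat_space ?T2) (cost1 G)"
    and cost2: "borel_cost ?W ?U2 (stat_space ?T1) (stat_space ?T2) (cost2 G)"
    using game by (auto simp: static_game_def wf_team_def)
  obtain h1 where h1: "integrable ?\<mu> h1"
    and h1_bound: "\<forall>w\<in>space ?\<mu>. \<forall>u\<in>?U1. \<forall>v1\<in>stat ?T1 ` prob_measures ?U1. \<forall>v2\<in>stat ?T2 ` prob_measures ?U2. cost1 G w u v1 v2 \<le> h1 w"
    using dominated(1) unfolding dominated_cost_def by blast
  obtain h2 where h2: "integrable ?\<mu> h2"
    and h2_bound: "\<forall>w\<in>space ?\<mu>. \<forall>u\<in>?U2. \<forall>v1\<in>stat ?T1 ` prob_measures ?U1. \<forall>v2\<in>stat ?T2 ` prob_measures ?U2. cost2 G w u v1 v2 \<le> h2 w"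
    using dominated(2) unfolding dominated_cost_def by blast
  \<comment> \<open>Deviations of the first team against the second; \<open>B\<close> below is the
    same with the teams, their sizes and the order of the statistics exchanged.\<close>
  interpret A: mean_field_team ?\<mu> ?W ?U1 ?U2 "stat_space ?T1" "stat_space ?T2" "stat ?T1" "stat ?T2" "cost1 G" h1 N1 N2 \<sigma>2
    "base G" ?T1 D1
    by unfold_locales
       (use static_game_state_law[OF game] compact stat cost1 continuous(1) h1 h1_bound N \<sigma>2 T(1) D(1) static_gameD(5)[OF game] in auto)
  interpret B: mean_field_team ?\<mu> ?W ?U2 ?U1 "stat_space ?T2" "stat_space ?T1" "stat ?T2" "stat ?T1"
    "\<lambda>w u v2 v1. cost2 G w u v1 v2" h2 N2 N1 \<sigma>1 "base G" ?T2 D2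
    by unfold_locales
       (use static_game_state_law[OF game] compact stat borel_cost_swap[OF cost2] continuous_cost_swap[OF continuous(2)]
          h2 h2_bound N \<sigma>1 T(2) D(2) static_gameD(5)[OF game] in auto)
  \<comment> \<open>Here \<open>P\<close> is an arbitrary deviation, correlated or not; only the
    opponents are privately randomised.\<close>
  have J1: "J1 G (N1 n) (N2 n) P (PiM {..<N2 n} (\<lambda>_. R2)) = A.randomized_cost n P" if P: "P \<in> randomized ?T1 {..<N1 n}" for n P
  proof -
    obtain K where K: "cond_obs_law G (N1 n) (N2 n) K" "AE w in ?\<mu>. K w = cond_product_law G D1 D2 (N1 n) (N2 n) w"
      using K[OF N(1,2)] by blast
    have "J1 G (N1 n) (N2 n) P (PiM {..<N2 n} (\<lambda>_. R2)) = (\<integral>\<^sup>+w. \<integral>\<^sup>+u1. \<integral>\<^sup>+u2. ennreal (avg_cost1 G (N1 n) (N2 n) w (u1, u2))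
        \<partial>mixture ?T2 D2 (N2 n) (PiM {..<N2 n} (\<lambda>_. R2)) w \<partial>mixture ?T1 D1 (N1 n) P w \<partial>?\<mu>)"
      unfolding J1_def
      by (rule expected_cost_eq[OF game D K cost_measurable_avg_cost1[OF game N(1,2)] P PiM_randomized[OF R2]])
    also have "\<dots> = A.randomized_cost n P" unfolding A.randomized_cost_def A.cost_given_actions_def
    proof (intro nn_integral_cong)
      fix w u1 assume "w \<in> space ?\<mu>" and u1: "u1 \<in> space (mixture ?T1 D1 (N1 n) P w)"
      then have w: "w \<in> ?W" using static_gameD(5)[OF game] by simp
      have "space (mixture ?T1 D1 (N1 n) P w) = space (action_profiles ?T1 (N1 n))"
        by (rule kernelD(3)[OF measurable_mixture[OF T(1) D(1) P]]) (use w in simp)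
      then have u1: "u1 \<in> space (action_profiles ?T1 (N1 n))" using u1 by simp
      have mix: "mixture ?T2 D2 (N2 n) (PiM {..<N2 n} (\<lambda>_. R2)) w = PiM {..<N2 n} (\<lambda>_. \<sigma>2 w)"
        unfolding \<sigma>2_def by (rule mixture_PiM[OF T(2) D(2) R2 w])
      have "space (PiM {..<N2 n} (\<lambda>_. \<sigma>2 w)) = space (action_profiles ?T2 (N2 n))"
        using kernelD(3)[OF \<sigma>2] w by (simp add: space_PiM)
      then show "(\<integral>\<^sup>+u2. ennreal (avg_cost1 G (N1 n) (N2 n) w (u1, u2)) \<partial>mixture ?T2 D2 (N2 n) (PiM {..<N2 n} (\<lambda>_. R2)) w)
          = (\<integral>\<^sup>+u2. ennreal (A.sample_cost n w u1 u2) \<partial>PiM {..<N2 n} (\<lambda>_. \<sigma>2 w))"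
        unfolding mix A.sample_cost_def A.\<Phi>_def
        by (intro nn_integral_cong) (simp add: avg_cost1_eq[OF game N(1,2) w u1])
    qed
    finally show ?thesis .
  qed
  have J2: "J2 G (N1 n) (N2 n) (PiM {..<N1 n} (\<lambda>_. R1)) P = B.randomized_cost n P" if P: "P \<in> randomized ?T2 {..<N2 n}" for n P
  proof -
    obtain K where K: "cond_obs_law G (N1 n) (N2 n) K" "AE w in ?\<mu>. K w = cond_product_law G D1 D2 (N1 n) (N2 n) w"
      using K[OF N(1,2)] by blast
    have "J2 G (N1 n) (N2 n) (PiM {..<N1 n} (\<lambda>_. R1)) P = (\<integral>\<^sup>+w. \<integral>\<^sup>+u1. \<integral>\<^sup>+u2. ennreal (avg_cost2 G (N1 n) (N2 n) w (u1, u2))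
        \<partial>mixture ?T2 D2 (N2 n) P w \<partial>mixture ?T1 D1 (N1 n) (PiM {..<N1 n} (\<lambda>_. R1)) w \<partial>?\<mu>)"
      unfolding J2_def
      by (rule expected_cost_eq[OF game D K cost_measurable_avg_cost2[OF game N(1,2)] PiM_randomized[OF R1] P])
    also have "\<dots> = B.randomized_cost n P" unfolding B.randomized_cost_def B.cost_given_actions_def
    proof (rule nn_integral_cong)
      fix w assume "w \<in> space ?\<mu>"
      then have w: "w \<in> ?W" using static_gameD(5)[OF game] by simp
      then have w': "w \<in> space (borel_on ?W)" by simp
      note m1 = measurable_space[OF measurable_mixture[OF T(1) D(1) PiM_randomized[OF R1, of "{..<N1 n}"]] w']
      note m2 = measurable_space[OF measurable_mixture[OF T(2) D(2) P] w']
      have sp2: "space (mixture ?T2 D2 (N2 n) P w) = space (action_profiles ?T2 (N2 n))"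
        by (rule kernelD(3)[OF measurable_mixture[OF T(2) D(2) P] w'])
      have mix: "mixture ?T1 D1 (N1 n) (PiM {..<N1 n} (\<lambda>_. R1)) w = PiM {..<N1 n} (\<lambda>_. \<sigma>1 w)"
        unfolding \<sigma>1_def by (rule mixture_PiM[OF T(1) D(1) R1 w])
      have sp1: "space (PiM {..<N1 n} (\<lambda>_. \<sigma>1 w)) = space (action_profiles ?T1 (N1 n))"
        using kernelD(3)[OF \<sigma>1] w by (simp add: space_PiM)
      \<comment> \<open>Expected costs integrate the first team on the outside, whereas
        \<open>B\<close> has the deviating second team there.\<close>
      have "(\<integral>\<^sup>+u1. \<integral>\<^sup>+u2. ennreal (avg_cost2 G (N1 n) (N2 n) w (u1, u2))
          \<partial>mixture ?T2 D2 (N2 n) P w \<partial>mixture ?T1 D1 (N1 n) (PiM {..<N1 n} (\<lambda>_. R1)) w)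
        = (\<integral>\<^sup>+u2. \<integral>\<^sup>+u1. ennreal (avg_cost2 G (N1 n) (N2 n) w (u1, u2))
          \<partial>mixture ?T1 D1 (N1 n) (PiM {..<N1 n} (\<lambda>_. R1)) w \<partial>mixture ?T2 D2 (N2 n) P w)"
        by (rule nn_integral_pair_prob(2)[symmetric, OF m1 m2 cost_measurable_section[OF cost_measurable_avg_cost2[OF game N(1,2)] w]])
      also have "\<dots> = (\<integral>\<^sup>+u2. \<integral>\<^sup>+u1. ennreal (B.sample_cost n w u2 u1) \<partial>PiM {..<N1 n} (\<lambda>_. \<sigma>1 w) \<partial>mixture ?T2 D2 (N2 n) P w)"
        unfolding mix B.sample_cost_def B.\<Phi>_def
        by (intro nn_integral_cong) (simp add: sp1 sp2 avg_cost2_eq[OF game N(1,2) w])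
      finally show "(\<integral>\<^sup>+u1. \<integral>\<^sup>+u2. ennreal (avg_cost2 G (N1 n) (N2 n) w (u1, u2))
          \<partial>mixture ?T2 D2 (N2 n) P w \<partial>mixture ?T1 D1 (N1 n) (PiM {..<N1 n} (\<lambda>_. R1)) w)
        = (\<integral>\<^sup>+u2. \<integral>\<^sup>+u1. ennreal (B.sample_cost n w u2 u1) \<partial>PiM {..<N1 n} (\<lambda>_. \<sigma>1 w) \<partial>mixture ?T2 D2 (N2 n) P w)" .
    qed
    finally show ?thesis .
  qed
  have J1_inf: "J1_inf G S P P2 = limsup (\<lambda>n. A.randomized_cost n (PiM {..<N1 n} (\<lambda>_. R)))"
    if R: "R \<in> space (prob_algebra (policy_space ?T1))" and P: "\<And>N. marginal ?T1 N P = PiM {..<N} (\<lambda>_. R)" for R P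
    unfolding J1_inf_def by (simp add: case_prod_unfold P P2 J1[OF PiM_randomized[OF R]] flip: N1_def N2_def)
  have J2_inf: "J2_inf G S P1 P = limsup (\<lambda>n. B.randomized_cost n (PiM {..<N2 n} (\<lambda>_. R)))"
    if R: "R \<in> space (prob_algebra (policy_space ?T2))" and P: "\<And>N. marginal ?T2 N P = PiM {..<N} (\<lambda>_. R)" for R P
    unfolding J2_inf_def by (simp add: case_prod_unfold P P1 J2[OF PiM_randomized[OF R]] flip: N1_def N2_def)
  \<comment> \<open>Of all deviations in the infinite game, those in which everybody draws
    independently from one \<open>R\<close> are compared with the equilibrium.\<close>
  have opt1: "limsup (\<lambda>n. A.randomized_cost n (PiM {..<N1 n} (\<lambda>_. R1))) \<le> limsup (\<lambda>n. A.randomized_cost n (PiM {..<N1 n} (\<lambda>_. R)))"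
    if R: "R \<in> space (prob_algebra (policy_space ?T1))" for R
    using nash PiM_randomized[OF R, of UNIV]
    unfolding nash_infinite_def J1_inf[OF R1 P1, symmetric] J1_inf[OF R marginal_PiM[OF R], symmetric] by blast
  have opt2: "limsup (\<lambda>n. B.randomized_cost n (PiM {..<N2 n} (\<lambda>_. R2))) \<le> limsup (\<lambda>n. B.randomized_cost n (PiM {..<N2 n} (\<lambda>_. R)))"
    if R: "R \<in> space (prob_algebra (policy_space ?T2))" for R
    using nash PiM_randomized[OF R, of UNIV]
    unfolding nash_infinite_def J2_inf[OF R2 P2, symmetric] J2_inf[OF R marginal_PiM[OF R], symmetric] by blast
  let ?J1 = "\<lambda>N1 N2 P. J1 G N1 N2 P (marginal ?T2 N2 P2)" and ?J2 = "\<lambda>N1 N2 P. J2 G N1 N2 (marginal ?T1 N1 P1) P"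
  \<comment> \<open>The exact regret of the first team. As a function of the two sizes rather than
    of the index it stays well defined if \<open>S\<close> repeats a pair.\<close>
  define \<epsilon>1 where "\<epsilon>1 N1 N2 = enn2real (?J1 N1 N2 (marginal ?T1 N1 P1) - (INF P\<in>randomized ?T1 {..<N1}. ?J1 N1 N2 P))" for N1 N2
  define \<epsilon>2 where "\<epsilon>2 N1 N2 = enn2real (?J2 N1 N2 (marginal ?T2 N2 P2) - (INF P\<in>randomized ?T2 {..<N2}. ?J2 N1 N2 P))" for N1 N2
  have fin1: "?J1 (N1 n) (N2 n) (marginal ?T1 (N1 n) P1) < top" for n
    unfolding P1 P2 J1[OF PiM_randomized[OF R1]] A.randomized_cost_PiM[OF R1] by simp
  have fin2: "?J2 (N1 n) (N2 n) (marginal ?T2 (N2 n) P2) < top" for n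
    unfolding P1 P2 J2[OF PiM_randomized[OF R2]] B.randomized_cost_PiM[OF R2] by simp
  have "(\<lambda>n. \<epsilon>1 (N1 n) (N2 n)) \<longlonglongrightarrow> 0" unfolding \<epsilon>1_def
  proof (rule regret_tendsto_0[OF fin1])
    fix e :: real assume e: "0 < e"
    have "eventually (\<lambda>n. \<forall>P\<in>randomized ?T1 {..<N1 n}.
        A.randomized_cost n (PiM {..<N1 n} (\<lambda>_. R1)) \<le> A.randomized_cost n P + ennreal e) sequentially"
      by (rule A.eventually_no_profitable_deviation[OF R1 e]) (rule opt1)
    then show "eventually (\<lambda>n. \<forall>P\<in>randomized ?T1 {..<N1 n}. ?J1 (N1 n) (N2 n) (marginal ?T1 (N1 n) P1) \<le> ?J1 (N1 n) (N2 n) P + ennreal e) sequentially"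
      by eventually_elim (simp add: P1 P2 J1 PiM_randomized[OF R1])
  qed
  moreover have "(\<lambda>n. \<epsilon>2 (N1 n) (N2 n)) \<longlonglongrightarrow> 0" unfolding \<epsilon>2_def
  proof (rule regret_tendsto_0[OF fin2])
    fix e :: real assume e: "0 < e"
    have "eventually (\<lambda>n. \<forall>P\<in>randomized ?T2 {..<N2 n}.
        B.randomized_cost n (PiM {..<N2 n} (\<lambda>_. R2)) \<le> B.randomized_cost n P + ennreal e) sequentially"
      by (rule B.eventually_no_profitable_deviation[OF R2 e]) (rule opt2)
    then show "eventually (\<lambda>n. \<forall>P\<in>randomized ?T2 {..<N2 n}. ?J2 (N1 n) (N2 n) (marginal ?T2 (N2 n) P2) \<le> ?J2 (N1 n) (N2 n) P + ennreal e) sequentially"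
      by eventually_elim (simp add: P1 P2 J2 PiM_randomized[OF R2])
  qed
  ultimately have lim: "(\<lambda>n. \<epsilon>1 (N1 n) (N2 n) + \<epsilon>2 (N1 n) (N2 n)) \<longlonglongrightarrow> 0" by (rule tendsto_add_zero)
  have pos: "0 \<le> \<epsilon>1 M1 M2" "0 \<le> \<epsilon>2 M1 M2" for M1 M2 by (auto simp: \<epsilon>1_def \<epsilon>2_def)
  have rand: "P1 \<in> randomized ?T1 UNIV" "P2 \<in> randomized ?T2 UNIV" using nash unfolding nash_infinite_def by auto
  have "eps_nash_finite G (N1 n) (N2 n) (\<epsilon>1 (N1 n) (N2 n) + \<epsilon>2 (N1 n) (N2 n)) (marginal ?T1 (N1 n) P1) (marginal ?T2 (N2 n) P2)" for n
    unfolding eps_nash_finite_def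
  proof (intro conjI marginal_randomized rand)
    show "?J1 (N1 n) (N2 n) (marginal ?T1 (N1 n) P1)
        \<le> (INF P\<in>randomized ?T1 {..<N1 n}. ?J1 (N1 n) (N2 n) P) + ennreal (\<epsilon>1 (N1 n) (N2 n) + \<epsilon>2 (N1 n) (N2 n))"
      unfolding \<epsilon>1_def by (rule le_INF_plus_regret[OF fin1 pos(2)])
    show "?J2 (N1 n) (N2 n) (marginal ?T2 (N2 n) P2)
        \<le> (INF P\<in>randomized ?T2 {..<N2 n}. ?J2 (N1 n) (N2 n) P) + ennreal (\<epsilon>1 (N1 n) (N2 n) + \<epsilon>2 (N1 n) (N2 n))"
      unfolding \<epsilon>2_def add.commute[of "\<epsilon>1 _ _"] by (rule le_INF_plus_regret[OF fin2 pos(1)])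
  qed
  then have "\<forall>(M1, M2)\<in>range S. eps_nash_finite G M1 M2 (\<epsilon>1 M1 M2 + \<epsilon>2 M1 M2) (marginal ?T1 M1 P1) (marginal ?T2 M2 P2)"
    by (auto simp: N1_def N2_def case_prod_unfold)
  then show ?thesis
    using lim pos by (intro exI[of _ "\<lambda>M1 M2. \<epsilon>1 M1 M2 + \<epsilon>2 M1 M2"]) (simp add: N1_def N2_def case_prod_unfold)
qed

end
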